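(* Let $W$ be a vector space, let $r,N$ be positive integers, and let $U$ be any graded local subspace of $\mathcal{E}(W,r;N)$. Then there exists a smallest closed graded local subspace $\langle U\rangle$ of $\mathcal{E}(W,r;N)$ that contains $U$, and $\langle U\rangle$ is an $(r+1)$-toroidal vertex algebra (with vertex operator map $Y_{\mathcal{E}}$ and vacuum vector $1_W$) with $W$ as a canonical faithful $\sigma$-twisted module, where $Y_W(a(x_0,\mathbf{x});z_0,\mathbf{z})=a(z_0,\mathbf{z})$ for $a(x_0,\mathbf{x})\in\langle U\rangle$.
   Context: Conventions. All vector spaces are over $\mathbb{C}$; $\mathbb{N}$ is the set of nonnegative integers; $r$ is a fixed positive integer. $\mathbf{x}=(x_1,\dots,x_r)$ (similarly $\mathbf{y},\mathbf{z}$) are commuting formal variables, $\mathbf{x}^{\mathbf{m}}=x_1^{m_1}\cdots x_r^{m_r}$ for $\mathbf{m}\in\mathbb{Z}^r$, and $\mathbf{z}\mathbf{y}=(z_1y_1,\dots,z_ry_r)$. $\delta(z)=\sum_{n\in\mathbb{Z}}z^n$, and $(x_0\pm y_0)^{\alpha}$ ($\alpha\in\mathbb{C}$) is expanded in nonnegative integer powers of the second variable $y_0$. $\omega_N=\exp(2\pi\sqrt{-1}/N)$. $\mathrm{Res}_{x_0}$ is the coefficient of $x_0^{-1}$. For a vector space $W$ and a positive integer $N$, $$\mathcal{E}(W,r;N)=\mathrm{Hom}\big(W,W[[x_1^{\pm1},\dots,x_r^{\pm1}]]((x_0^{1/N}))\big),\qquad \mathcal{E}(W,r)=\mathcal{E}(W,r;1).$$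 Toroidal vertex algebra. An $(r+1)$-toroidal vertex algebra is a vector space $V$ with a linear map $Y(\cdot;x_0,\mathbf{x}):V\to\mathcal{E}(V,r)$, $v\mapsto Y(v;x_0,\mathbf{x})=\sum_{(m_0,\mathbf{m})\in\mathbb{Z}\times\mathbb{Z}^r}v_{m_0,\mathbf{m}}x_0^{-m_0-1}\mathbf{x}^{-\mathbf{m}}$, and a distinguished vector $\mathbf{1}\in V$, such that $Y(\mathbf{1};x_0,\mathbf{x})v=v$ and $Y(v;x_0,\mathbf{x})\mathbf{1}\in V[[x_0,x_1^{\pm1},\dots,x_r^{\pm1}]]$ for $v\in V$, and for $u,v\in V$ $$z_0^{-1}\delta\Big(\frac{x_0-y_0}{z_0}\Big)Y(u;x_0,\mathbf{z}\mathbf{y})Y(v;y_0,\mathbf{y})-z_0^{-1}\delta\Big(\frac{y_0-x_0}{-z_0}\Big)Y(v;y_0,\mathbf{y})Y(u;x_0,\mathbf{z}\mathbf{y})=y_0^{-1}\delta\Big(\frac{x_0-z_0}{y_0}\Big)Y(Y(u;z_0,\mathbf{z})v;y_0,\mathbf{y}).$$ An automorphism of $V$ is a linear bijection $\sigma$ with $\sigma(\mathbf{1})=\mathbf{1}$ and $\sigma(Y(u;x_0,\mathbf{x})v)=Y(\sigma(u);x_0,\mathbf{x})\sigma(v)$. It has period $N$ if $\sigma^N=1$ ($N$ need not be the order). Twisted module. Let $\sigma$ be an automorphism of $V$ with period $N$. A $\sigma$-twisted $V$-module is a vector space $W$ with a linear map $Y_W(\cdot;x_0,\mathbf{x}):V\to\mathcal{E}(W,r;N)$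 such that $Y_W(\mathbf{1};x_0,\mathbf{x})=1_W$ and for $u,v\in V$ $$z_0^{-1}\delta\Big(\frac{x_0-y_0}{z_0}\Big)Y_W(u;x_0,\mathbf{z}\mathbf{y})Y_W(v;y_0,\mathbf{y})-z_0^{-1}\delta\Big(\frac{y_0-x_0}{-z_0}\Big)Y_W(v;y_0,\mathbf{y})Y_W(u;x_0,\mathbf{z}\mathbf{y})=\frac1N\sum_{j=0}^{N-1}y_0^{-1}\delta\Big(\omega_N^j\Big(\frac{x_0-z_0}{y_0}\Big)^{1/N}\Big)Y_W(Y(\sigma^ju;z_0,\mathbf{z})v;y_0,\mathbf{y}).$$ It is faithful if $Y_W$ is injective. Grading, locality, $Y_{\mathcal{E}}$, closedness. For $j\in\mathbb{Z}$ put $\mathcal{E}(W,r;N)_j=x_0^{-j/N}\mathcal{E}(W,r)$ (depends only on $j$ mod $N$); $\mathcal{E}(W,r;N)=\bigoplus_{j=0}^{N-1}\mathcal{E}(W,r;N)_j$. $\sigma$ is the linear automorphism of $\mathcal{E}(W,r;N)$ acting on $\mathcal{E}(W,r;N)_j$ as the scalar $\omega_N^j$; its restriction to a graded subspace is again denoted $\sigma$. A subspace is graded if it is the direct sum of its intersections with the $\mathcal{E}(W,r;N)_j$. Elements $a(x_0,\mathbf{x}),b(x_0,\mathbf{x})\in\mathcal{E}(W,r;N)$ are mutually local if $(x_0-y_0)^k[a(x_0,\mathbf{x}),b(y_0,\mathbf{y})]=0$ for some $k\in\mathbb{N}$; a subset $U$ is local if any $a,b\in U$ (including $a=b$) are mutually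 local. For mutually local $a(x_0,\mathbf{x})\in\mathcal{E}(W,r;N)_j$ ($0\le j<N$) and $b(x_0,\mathbf{x})\in\mathcal{E}(W,r;N)$, define $a(y_0,\mathbf{y})_{m_0,\mathbf{m}}b(y_0,\mathbf{y})\in\mathcal{E}(W,r;N)$ for $(m_0,\mathbf{m})\in\mathbb{Z}\times\mathbb{Z}^r$ by $$Y_{\mathcal{E}}(a(y_0,\mathbf{y});z_0,\mathbf{z})b(y_0,\mathbf{y})=\sum_{m_0,\mathbf{m}}a(y_0,\mathbf{y})_{m_0,\mathbf{m}}b(y_0,\mathbf{y})z_0^{-m_0-1}\mathbf{z}^{-\mathbf{m}}=\mathrm{Res}_{x_0}\Big(\frac{x_0-z_0}{y_0}\Big)^{j/N}X,$$ $$X=z_0^{-1}\delta\Big(\frac{x_0-y_0}{z_0}\Big)a(x_0,\mathbf{z}\mathbf{y})b(y_0,\mathbf{y})-z_0^{-1}\delta\Big(\frac{y_0-x_0}{-z_0}\Big)b(y_0,\mathbf{y})a(x_0,\mathbf{z}\mathbf{y}).$$ On a graded local subspace this is extended linearly to arbitrary $a$. A graded local subspace $U$ is closed if $1_W\in U$ and $a(x_0,\mathbf{x})_{m_0,\mathbf{m}}b(x_0,\mathbf{x})\in U$ for all $a,b\in U$, $(m_0,\mathbf{m})\in\mathbb{Z}\times\mathbb{Z}^r$. *)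

theory Defs
  imports
    Complex_Main
    "HOL-Analysis.Finite_Cartesian_Product"
    "HOL-Library.FuncSet"
    "HOL-Library.Function_Algebras"
    "HOL-Library.Groups_Big_Fun"
begin

text \<open>
  The positive integer \<open>r\<close> is \<open>CARD('r)\<close>, and multi-exponents in \<open>\<int>\<^sup>r\<close> have type \<open>int ^ 'r\<close>.

  A formal series \<open>a(x\<^sub>0, x)\<close> with operator coefficients and exponents of \<open>x\<^sub>0\<close> in \<open>(1/N)\<int>\<close> is
  encoded by its coefficients: \<open>a n m w\<close> is the coefficient of \<open>x\<^sub>0\<^bsup>n/N\<^esup> x\<^sup>m\<close> in \<open>a(x\<^sub>0, x) w\<close>.
  So the first index counts in units of \<open>1/N\<close>, and multiplying by \<open>x\<^sub>0\<close> shifts it by \<open>N\<close>.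

  All infinite sums of coefficients are written with \<open>Sum_any\<close>, the sum over the support. Under the
  hypotheses where the series are used (truncation in \<open>x\<^sub>0\<close>, and locality for \<open>vertex_op_hom\<close>)
  the supports are finite.
\<close>

type_synonym ('r, 'w) field_series = "int \<Rightarrow> int ^ 'r \<Rightarrow> 'w \<Rightarrow> 'w"

definition linear_on ::
  "(complex \<Rightarrow> 'u \<Rightarrow> 'u) \<Rightarrow> 'u::ab_group_add set \<Rightarrow> (complex \<Rightarrow> 'w \<Rightarrow> 'w) \<Rightarrow> ('u \<Rightarrow> 'w::ab_group_add) \<Rightarrow> bool"
  where "linear_on s V s' f \<longleftrightarrow>
    (\<forall>u\<in>V. \<forall>v\<in>V. f (u + v) = f u + f v) \<and> (\<forall>c. \<forall>u\<in>V. f (s c u) = s' c (f u))"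

definition series_scale ::
  "(complex \<Rightarrow> 'w \<Rightarrow> 'w) \<Rightarrow> complex \<Rightarrow> ('r::finite, 'w) field_series \<Rightarrow> ('r, 'w) field_series"
  where "series_scale s c a = (\<lambda>n m w. s c (a n m w))"

text \<open>
  \<open>Hom(W, W[[x\<^sub>1\<^sup>\<plusminus>\<^sup>1, \<dots>, x\<^sub>r\<^sup>\<plusminus>\<^sup>1]]((x\<^sub>0\<^bsup>1/N\<^esup>)))\<close>; the truncation bound depends on \<open>w\<close> but not on \<open>m\<close>.
  The condition does not involve \<open>N\<close>, since exponents are counted in units of \<open>1/N\<close>. The space \<open>W\<close>
  is a subspace of an ambient space, and the values of \<open>a\<close> outside \<open>W\<close> are irrelevant.
\<close>
definition fields_on ::
  "(complex \<Rightarrow> 'w \<Rightarrow> 'w) \<Rightarrow> 'w::ab_group_add set \<Rightarrow> ('r::finite, 'w) field_series set"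
  where "fields_on s W = {a.
    (\<forall>n m. a n m ` W \<subseteq> W \<and> linear_on s W s (a n m)) \<and>
    (\<forall>w\<in>W. \<exists>K. \<forall>n<K. \<forall>m. a n m w = 0)}"

abbreviation fields ::
  "(complex \<Rightarrow> 'w \<Rightarrow> 'w) \<Rightarrow> ('r::finite, 'w::ab_group_add) field_series set"
  where "fields s \<equiv> fields_on s UNIV"

definition identity_field :: "('r::finite, 'w::ab_group_add) field_series"
  where "identity_field = (\<lambda>n m w. if n = 0 \<and> m = 0 then w else 0)"

definition omega :: "nat \<Rightarrow> complex"
  where "omega N = exp (2 * of_real pi * \<i> / of_nat N)"

text \<open>The coefficient of \<open>x\<^sub>0\<^bsup>\<alpha>-i\<^esup> y\<^sub>0\<^sup>i\<close> in \<open>(x\<^sub>0 - y\<^sub>0)\<^sup>\<alpha>\<close>.\<close>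
definition binomial_coeff :: "complex \<Rightarrow> nat \<Rightarrow> complex"
  where "binomial_coeff \<alpha> i = (-1) ^ i * (\<alpha> gchoose i)"


subsection \<open>The terms of the Jacobi identity\<close>

text \<open>
  In the following three definitions, the arguments \<open>c p q k l\<close> select the coefficient of
  \<open>z\<^sub>0\<^sup>c x\<^sub>0\<^bsup>p/N\<^esup> y\<^sub>0\<^bsup>q/N\<^esup> z\<^sup>k y\<^sup>l\<close> in a series applied to \<open>w\<close>. In \<open>a(x\<^sub>0, zy) b(y\<^sub>0, y)\<close>, the series \<open>a\<close>
  contributes \<open>z\<^sup>k y\<^sup>k\<close>, leaving \<open>y\<^bsup>l-k\<^esup>\<close> to \<open>b\<close>.

  The first is \<open>z\<^sub>0\<^bsup>-1\<^esup> \<delta>((x\<^sub>0 - y\<^sub>0)/z\<^sub>0) a(x\<^sub>0, zy) b(y\<^sub>0, y) w\<close>, from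
  \<open>z\<^sub>0\<^bsup>-1\<^esup> \<delta>((x\<^sub>0 - y\<^sub>0)/z\<^sub>0) = \<Sum>n\<in>\<int>. \<Sum>i\<ge>0. binomial_coeff n i z\<^sub>0\<^bsup>-n-1\<^esup> x\<^sub>0\<^bsup>n-i\<^esup> y\<^sub>0\<^sup>i\<close>.
\<close>
definition product_term ::
  "(complex \<Rightarrow> 'w \<Rightarrow> 'w) \<Rightarrow> nat \<Rightarrow> ('r::finite, 'w) field_series \<Rightarrow> ('r, 'w) field_series \<Rightarrow>
    int \<Rightarrow> int \<Rightarrow> int \<Rightarrow> int ^ 'r \<Rightarrow> int ^ 'r \<Rightarrow> 'w \<Rightarrow> 'w::ab_group_add"
  where "product_term s N a b c p q k l w =
    (let n = - c - 1 in
      Sum_any (\<lambda>i::nat. s (binomial_coeff (of_int n) i)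
        (a (p - int N * (n - int i)) k (b (q - int N * int i) (l - k) w))))"

text \<open>
  \<open>z\<^sub>0\<^bsup>-1\<^esup> \<delta>((y\<^sub>0 - x\<^sub>0)/(-z\<^sub>0)) b(y\<^sub>0, y) a(x\<^sub>0, zy) w\<close>, from \<open>z\<^sub>0\<^bsup>-1\<^esup> \<delta>((y\<^sub>0 - x\<^sub>0)/(-z\<^sub>0)) =
  \<Sum>n\<in>\<int>. \<Sum>i\<ge>0. (-1)\<^sup>n binomial_coeff n i z\<^sub>0\<^bsup>-n-1\<^esup> y\<^sub>0\<^bsup>n-i\<^esup> x\<^sub>0\<^sup>i\<close>.
\<close>
definition opposite_term ::
  "(complex \<Rightarrow> 'w \<Rightarrow> 'w) \<Rightarrow> nat \<Rightarrow> ('r::finite, 'w) field_series \<Rightarrow> ('r, 'w) field_series \<Rightarrow>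
    int \<Rightarrow> int \<Rightarrow> int \<Rightarrow> int ^ 'r \<Rightarrow> int ^ 'r \<Rightarrow> 'w \<Rightarrow> 'w::ab_group_add"
  where "opposite_term s N a b c p q k l w =
    (let n = - c - 1 in
      Sum_any (\<lambda>i::nat. s ((-1) powi n * binomial_coeff (of_int n) i)
        (b (q - int N * (n - int i)) (l - k) (a (p - int N * int i) k w))))"

text \<open>
  \<open>y\<^sub>0\<^bsup>-1\<^esup> \<delta>(\<omega>\<^sub>N\<^sup>j ((x\<^sub>0 - z\<^sub>0)/y\<^sub>0)\<^bsup>1/N\<^esup>) Y\<^sub>W(F(z\<^sub>0, z); y\<^sub>0, y) w\<close>, where \<open>F e k\<close> is the coefficient of
  \<open>z\<^sub>0\<^sup>e z\<^sup>k\<close> in \<open>F(z\<^sub>0, z)\<close>, from \<open>y\<^sub>0\<^bsup>-1\<^esup> \<delta>(\<omega>\<^sub>N\<^sup>j ((x\<^sub>0 - z\<^sub>0)/y\<^sub>0)\<^bsup>1/N\<^esup>) =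
  \<Sum>n\<in>\<int>. \<Sum>i\<ge>0. \<omega>\<^sub>N\<^bsup>jn\<^esup> binomial_coeff (n/N) i x\<^sub>0\<^bsup>n/N-i\<^esup> z\<^sub>0\<^sup>i y\<^sub>0\<^bsup>-1-n/N\<^esup>\<close>.
  For \<open>N = 1\<close> and \<open>j = 0\<close> the kernel is \<open>y\<^sub>0\<^bsup>-1\<^esup> \<delta>((x\<^sub>0 - z\<^sub>0)/y\<^sub>0)\<close>.
\<close>
definition iterate_term ::
  "(complex \<Rightarrow> 'w \<Rightarrow> 'w) \<Rightarrow> nat \<Rightarrow> nat \<Rightarrow> ('v \<Rightarrow> ('r::finite, 'w) field_series) \<Rightarrow> (int \<Rightarrow> int ^ 'r \<Rightarrow> 'v) \<Rightarrow>
    int \<Rightarrow> int \<Rightarrow> int \<Rightarrow> int ^ 'r \<Rightarrow> int ^ 'r \<Rightarrow> 'w \<Rightarrow> 'w::ab_group_add"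
  where "iterate_term s N j YW F c p q k l w =
    Sum_any (\<lambda>i::nat. let n = p + int N * int i in
      s (omega N powi (int j * n) * binomial_coeff (of_int n / of_nat N) i)
        (YW (F (c - int i) k) (q + int N + n) l w))"


subsection \<open>Toroidal vertex algebras and twisted modules\<close>

text \<open>
  \<open>Y v n m u\<close> is the coefficient of \<open>x\<^sub>0\<^sup>n x\<^sup>m\<close> in \<open>Y(v; x\<^sub>0, x) u\<close>; the mode \<open>v\<^bsub>m0,m\<^esub>\<close> is
  \<open>Y v (- m0 - 1) (- m)\<close>. The algebra lives on a subspace \<open>V\<close> of an ambient vector space.
\<close>
locale toroidal_vertex_algebra = vector_space scale
  for scale :: "complex \<Rightarrow> 'v::ab_group_add \<Rightarrow> 'v" +
  fixes V :: "'v set"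
    and Y :: "'v \<Rightarrow> ('r::finite, 'v) field_series"
    and vac :: 'v
  assumes subspace_V: "module.subspace scale V"
    and vac_in: "vac \<in> V"
    and Y_fields: "v \<in> V \<Longrightarrow> Y v \<in> fields_on scale V"
    and Y_linear: "u \<in> V \<Longrightarrow> linear_on scale V scale (\<lambda>v. Y v n m u)"
    and vacuum: "v \<in> V \<Longrightarrow> Y vac n m v = identity_field n m v"
    and creation: "\<lbrakk>v \<in> V; n < 0\<rbrakk> \<Longrightarrow> Y v n m vac = 0"
    and jacobi: "\<lbrakk>u \<in> V; v \<in> V; w \<in> V\<rbrakk> \<Longrightarrow>
      product_term scale 1 (Y u) (Y v) c p q k l w - opposite_term scale 1 (Y u) (Y v) c p q k l w =
      iterate_term scale 1 0 Y (\<lambda>e k. Y u e k v) c p q k l w"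

locale periodic_automorphism = toroidal_vertex_algebra scale V Y vac
  for scale :: "complex \<Rightarrow> 'v::ab_group_add \<Rightarrow> 'v"
    and V :: "'v set"
    and Y :: "'v \<Rightarrow> ('r::finite, 'v) field_series"
    and vac :: 'v +
  fixes \<sigma> :: "'v \<Rightarrow> 'v"
    and N :: nat
  assumes N_pos: "N > 0"
    and aut_linear: "linear_on scale V scale \<sigma>"
    and aut_bij: "bij_betw \<sigma> V V"
    and aut_vac: "\<sigma> vac = vac"
    and aut_Y: "\<lbrakk>u \<in> V; v \<in> V\<rbrakk> \<Longrightarrow> \<sigma> (Y u n m v) = Y (\<sigma> u) n m (\<sigma> v)"
    and aut_period: "v \<in> V \<Longrightarrow> (\<sigma> ^^ N) v = v"

locale twisted_module = periodic_automorphism scale V Y vac \<sigma> N + W: vector_space scaleW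
  for scale :: "complex \<Rightarrow> 'v::ab_group_add \<Rightarrow> 'v"
    and V :: "'v set"
    and Y :: "'v \<Rightarrow> ('r::finite, 'v) field_series"
    and vac :: 'v
    and \<sigma> :: "'v \<Rightarrow> 'v"
    and N :: nat
    and scaleW :: "complex \<Rightarrow> 'w::ab_group_add \<Rightarrow> 'w" +
  fixes YW :: "'v \<Rightarrow> ('r, 'w) field_series"
  assumes YW_fields: "v \<in> V \<Longrightarrow> YW v \<in> fields scaleW"
    and YW_linear: "linear_on scale V (series_scale scaleW) YW"
    and YW_vacuum: "YW vac = identity_field"
    and twisted_jacobi: "\<lbrakk>u \<in> V; v \<in> V\<rbrakk> \<Longrightarrow>
      product_term scaleW N (YW u) (YW v) c p q k l w - opposite_term scaleW N (YW u) (YW v) c p q k l w =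
      scaleW (1 / of_nat N)
        (\<Sum>j<N. iterate_term scaleW N j YW (\<lambda>e k. Y ((\<sigma> ^^ j) u) e k v) c p q k l w)"

locale faithful_twisted_module = twisted_module +
  assumes YW_inj: "inj_on YW V"


subsection \<open>Graded local spaces of fields\<close>

text \<open>
  \<open>fields_grade s N j\<close> is \<open>x\<^sub>0\<^bsup>-j/N\<^esup> \<E>(W, r)\<close>: all exponents \<open>n/N\<close> of \<open>x\<^sub>0\<close> lie in \<open>-j/N + \<int>\<close>.
  \<open>homogeneous_part N j\<close> is the projection onto it.
\<close>
definition fields_grade ::
  "(complex \<Rightarrow> 'w \<Rightarrow> 'w) \<Rightarrow> nat \<Rightarrow> nat \<Rightarrow> ('r::finite, 'w::ab_group_add) field_series set"
  where "fields_grade s N j = {a \<in> fields s. \<forall>n. \<not> int N dvd n + int j \<longrightarrow> a n = 0}"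

definition homogeneous_part ::
  "nat \<Rightarrow> nat \<Rightarrow> ('r::finite, 'w::ab_group_add) field_series \<Rightarrow> ('r, 'w) field_series"
  where "homogeneous_part N j a = (\<lambda>n. if int N dvd n + int j then a n else 0)"

definition sigma ::
  "(complex \<Rightarrow> 'w \<Rightarrow> 'w) \<Rightarrow> nat \<Rightarrow> ('r::finite, 'w::ab_group_add) field_series \<Rightarrow> ('r, 'w) field_series"
  where "sigma s N a = (\<Sum>j<N. series_scale s (omega N ^ j) (homogeneous_part N j a))"

text \<open>The displayed sum is a coefficient of \<open>(x\<^sub>0 - y\<^sub>0)\<^sup>k [a(x\<^sub>0, x), b(y\<^sub>0, y)]\<close>.\<close>
definition mutually_local ::
  "(complex \<Rightarrow> 'w \<Rightarrow> 'w) \<Rightarrow> nat \<Rightarrow> ('r::finite, 'w::ab_group_add) field_series \<Rightarrow> ('r, 'w) field_series \<Rightarrow> bool"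
  where "mutually_local s N a b \<longleftrightarrow> (\<exists>k::nat. \<forall>p q m m' w.
    (\<Sum>i\<le>k. s (binomial_coeff (of_nat k) i)
      (a (p - int N * int (k - i)) m (b (q - int N * int i) m' w) -
       b (q - int N * int i) m' (a (p - int N * int (k - i)) m w))) = 0)"

definition graded_subspace ::
  "(complex \<Rightarrow> 'w \<Rightarrow> 'w) \<Rightarrow> nat \<Rightarrow> ('r::finite, 'w::ab_group_add) field_series set \<Rightarrow> bool"
  where "graded_subspace s N U \<longleftrightarrow>
    U \<subseteq> fields s \<and> module.subspace (series_scale s) U \<and>
    (\<forall>a\<in>U. \<exists>!f. f \<in> (\<Pi>\<^sub>E j\<in>{..<N}. U \<inter> fields_grade s N j) \<and> a = (\<Sum>j<N. f j))"

definition graded_local_subspace ::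
  "(complex \<Rightarrow> 'w \<Rightarrow> 'w) \<Rightarrow> nat \<Rightarrow> ('r::finite, 'w::ab_group_add) field_series set \<Rightarrow> bool"
  where "graded_local_subspace s N U \<longleftrightarrow>
    graded_subspace s N U \<and> (\<forall>a\<in>U. \<forall>b\<in>U. mutually_local s N a b)"

text \<open>
  For \<open>a\<close> of degree \<open>j < N\<close>, \<open>vertex_op_hom s N j a c k b\<close> is the coefficient of \<open>z\<^sub>0\<^sup>c z\<^sup>k\<close> in
  \<open>Res\<^bsub>x0\<^esub> ((x\<^sub>0 - z\<^sub>0)/y\<^sub>0)\<^bsup>j/N\<^esup> X\<close> as a series in \<open>y\<^sub>0, y\<close>, where \<open>X\<close> is \<open>product_term - opposite_term\<close>
  and \<open>((x\<^sub>0 - z\<^sub>0)/y\<^sub>0)\<^bsup>j/N\<^esup> = \<Sum>i\<ge>0. binomial_coeff (j/N) i x\<^sub>0\<^bsup>j/N-i\<^esup> z\<^sub>0\<^sup>i y\<^sub>0\<^bsup>-j/N\<^esup>\<close>. The sum over \<open>i\<close> is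
  finite because locality makes \<open>X\<close> truncated from below in \<open>z\<^sub>0\<close>.
\<close>
definition vertex_op_hom ::
  "(complex \<Rightarrow> 'w \<Rightarrow> 'w) \<Rightarrow> nat \<Rightarrow> nat \<Rightarrow> ('r::finite, 'w::ab_group_add) field_series \<Rightarrow>
    int \<Rightarrow> int ^ 'r \<Rightarrow> ('r, 'w) field_series \<Rightarrow> ('r, 'w) field_series"
  where "vertex_op_hom s N j a c k b = (\<lambda>q l w.
    Sum_any (\<lambda>i::nat.
      let p = - int N - int j + int N * int i in
      s (binomial_coeff (of_nat j / of_nat N) i)
        (product_term s N a b (c - int i) p (q + int j) k l w -
         opposite_term s N a b (c - int i) p (q + int j) k l w)))"

definition vertex_op ::
  "(complex \<Rightarrow> 'w \<Rightarrow> 'w) \<Rightarrow> nat \<Rightarrow> ('r::finite, 'w::ab_group_add) field_series \<Rightarrow>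
    ('r, ('r, 'w) field_series) field_series"
  where "vertex_op s N a c k b = (\<Sum>j<N. vertex_op_hom s N j (homogeneous_part N j a) c k b)"

definition closed_graded_local_subspace ::
  "(complex \<Rightarrow> 'w \<Rightarrow> 'w) \<Rightarrow> nat \<Rightarrow> ('r::finite, 'w::ab_group_add) field_series set \<Rightarrow> bool"
  where "closed_graded_local_subspace s N U \<longleftrightarrow>
    graded_local_subspace s N U \<and> identity_field \<in> U \<and>
    (\<forall>a\<in>U. \<forall>b\<in>U. \<forall>m0 m. vertex_op s N a (- m0 - 1) (- m) b \<in> U)"

end

theory Submission
  imports Defs
    "HOL-Computational_Algebra.Formal_Power_Series"
    "HOL-Analysis.Complex_Transcendental"
begin

text \<open>
  The indices of the toroidal variables are mere labels, so all identities reduce to ordinary twisted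
  fields in one variable. If \<open>a, b\<close> are local of order \<open>K\<close>, then \<open>(x - y)\<^sup>K a(x) b(y) w\<close> is truncated in both
  variables, and \<open>Y\<^sub>\<E>(a; z) b(y) w\<close> is \<open>z\<^bsup>-K\<^esup>\<close> times the result of substituting \<open>x = y + z\<close> in it. This makes
  sense for fractional exponents and without reference to the grading. The twisted Jacobi identity is
  then Vandermonde's identity for binomial coefficients. For the Jacobi identity of \<open>Y\<^sub>\<E>\<close>, one multiplies
  \<open>u(x\<^sub>1) v(x\<^sub>2) w(x\<^sub>3)\<close> by powers of all differences \<open>x\<^sub>i - x\<^sub>j\<close>: the product becomes truncated in all three
  variables and independent of the order of the factors, and both \<open>Y\<^sub>\<E>(u) Y\<^sub>\<E>(v) w\<close> and
  \<open>Y\<^sub>\<E>(Y\<^sub>\<E>(u) v) w\<close> arise from it by substitution. A closed space containing \<open>U\<close> exists because a maximal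
  local set of fields is closed, by Dong's lemma.
\<close>

text \<open>Multiplication by x - y kills delta series, so no power of it may be cancelled freely
  from an identity of two-sided series. Every cancellation is tied to a truncation:
  \<open>expand_diffmul\<close> uses a lower bound in one variable, \<open>local_truncated\<close>
  obtains bounds in both from the two orders of a local product, and \<open>addmul_inj\<close> uses
  a lower bound in z0. Moreover \<open>Sum_any\<close> gives 0 on an infinite support, so
  interchanging sums calls for an explicit finite set.

  No branch has to be chosen: (y + z)^(p/N) is expanded in nonnegative powers of z with coefficients
  binomial(p/N, m). Hence \<open>expand_jacobi\<close> serves twice, with step N on W for the
  twisted identity and with step 1 on the space of series for the identity of
  \<open>vertex_op\<close>.

  Zorn's lemma replaces a construction of the closure by iterated products. Each operation under
  which the space must be closed keeps its result local to every field that is local to the given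
  ones, and a maximal local set contains all such results. The smallest closed space is then an
  intersection over a nonempty family.\<close>

lemma funpow_invariant:
  assumes "\<And>x. P x \<Longrightarrow> P (f x)" and "P x"
  shows "P ((f ^^ k) x)"
  by (induction k) (simp_all add: assms)

text \<open>The conversion rules for substitutions hold only on regular families, so commutation is
  demanded on an invariant class \<open>P\<close> rather than everywhere.\<close>

lemma funpow_intertwine:
  assumes "\<And>x. P x \<Longrightarrow> P (f x)" and "\<And>x. P x \<Longrightarrow> R (f x) = g (R x)" and "P x"
  shows "R ((f ^^ k) x) = (g ^^ k) (R x)"
proof (induction k)
  case (Suc k)
  have "P ((f ^^ k) x)"
    by (rule funpow_invariant[where P = P]) (simp_all add: assms)
  with Suc assms(2) show ?case by simp
qed simp

lemma funpow_commute:
  assumes "\<And>x. R (f x) = g (R x)"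
  shows "R ((f ^^ k) x) = (g ^^ k) (R x)"
  by (rule funpow_intertwine[where P = "\<lambda>_. True"]) (simp_all add: assms)

section \<open>Sums over the support\<close>

lemma Sum_any_reindex:
  assumes "inj h" and "\<And>x. f x \<noteq> 0 \<Longrightarrow> x \<in> range h"
  shows "Sum_any f = Sum_any (\<lambda>i. f (h i))"
proof -
  \<comment> \<open>The supports correspond bijectively; if they are infinite, both sides take the
    default value 0.\<close>
  have "{x. f x \<noteq> 0} = h ` {i. f (h i) \<noteq> 0}"
    using assms(2) by blast
  moreover have "inj_on h {i. f (h i) \<noteq> 0}"
    using assms(1) by (rule inj_on_subset) simp
  ultimately show ?thesis
    unfolding Sum_any.expand_set by (simp add: sum.reindex o_def)
qed

lemma Sum_any_on:
  assumes "finite S" and "\<And>x. x \<notin> S \<Longrightarrow> f x = 0"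
  shows "Sum_any f = sum f S"
  by (rule Sum_any.expand_superset) (use assms in auto)

lemma Sum_any_minus:
  fixes f g :: "'i \<Rightarrow> 'b::ab_group_add"
  assumes "finite {x. f x \<noteq> 0}" and "finite {x. g x \<noteq> 0}"
  shows "Sum_any (\<lambda>x. f x - g x) = Sum_any f - Sum_any g"
proof -
  let ?S = "{x. f x \<noteq> 0} \<union> {x. g x \<noteq> 0}"
  have "finite ?S" using assms by simp
  then have "Sum_any (\<lambda>x. f x - g x) = sum (\<lambda>x. f x - g x) ?S" "Sum_any f = sum f ?S" "Sum_any g = sum g ?S"
    by (auto intro!: Sum_any_on)
  then show ?thesis by (simp add: sum_subtractf)
qed

lemma sum_fun_apply: "(\<Sum>i\<in>I. f i) x = (\<Sum>i\<in>I. f i x)"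
  for f :: "'i \<Rightarrow> 'x \<Rightarrow> 'b::comm_monoid_add"
  by (induction I rule: infinite_finite_induct) (auto simp: zero_fun_def plus_fun_def)

text \<open>Finiteness concerns the family of functions: at a single point the support may be finite
  although the family has infinite support, and then the left side would be the default 0.\<close>

lemma Sum_any_fun_apply:
  fixes f :: "'i \<Rightarrow> 'x \<Rightarrow> 'b::ab_group_add"
  assumes "finite {i. f i \<noteq> 0}"
  shows "Sum_any f x = Sum_any (\<lambda>i. f i x)"
proof -
  have "Sum_any (\<lambda>i. f i x) = (\<Sum>i | f i \<noteq> 0. f i x)"
    by (rule Sum_any_on) (use assms in auto)
  then show ?thesis
    unfolding Sum_any.expand_set by (simp add: sum_fun_apply)
qed

text \<open>Extending the lower index to \<open>int\<close> makes Pascal's rule hold without side conditions.\<close>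

definition gbin :: "complex \<Rightarrow> int \<Rightarrow> complex"
  where "gbin a m = (if m < 0 then 0 else a gchoose nat m)"

lemma gbin_neg [simp]: "m < 0 \<Longrightarrow> gbin a m = 0"
  by (simp add: gbin_def)

lemma gbin_of_nat [simp]: "gbin a (int m) = a gchoose m"
  by (simp add: gbin_def)

lemma gbin_0 [simp]: "gbin a 0 = 1"
  by (simp add: gbin_def)

lemma gbin_pascal: "gbin (a + 1) m = gbin a m + gbin a (m - 1)"
proof (cases "m \<le> 0")
  case True
  then show ?thesis by (cases "m = 0") auto
next
  case False
  define k where "k = nat (m - 1)"
  have "m = int (Suc k)" and "m - 1 = int k" using False by (simp_all add: k_def)
  then show ?thesis
    using gbinomial_Suc_Suc[of a k] by (simp only: gbin_of_nat) simp
qed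

section \<open>Vandermonde-type identities with complex upper arguments\<close>

lemma gbin_Vandermonde:
  "(\<Sum>i\<le>m. (a gchoose i) * gbin b (int m - int i)) = gbin (a + b) (int m)"
proof -
  have "(\<Sum>i\<le>m. (a gchoose i) * gbin b (int m - int i)) = (\<Sum>i=0..m. (a gchoose i) * (b gchoose (m - i)))"
    by (auto intro!: sum.cong simp: atMost_atLeast0 simp flip: of_nat_diff)
  then show ?thesis by (simp add: gbinomial_Vandermonde)
qed

text \<open>The coefficient of z0^m z2^n in (1 + z0 + z2)^a (1 + z2)^b, computed once through z1 =
  z0 + z2 and once directly. It is the numerical content of \<open>substitute_assoc\<close>.\<close>

lemma gbin_trinomial:
  "(\<Sum>i\<le>m + n. gbin (of_nat i) (int m) * ((a gchoose i) * gbin b (int (m + n) - int i))) =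
   gbin a (int m) * gbin (a - of_nat m + b) (int n)"
proof -
  have "(\<Sum>i\<le>m + n. gbin (of_nat i) (int m) * ((a gchoose i) * gbin b (int (m + n) - int i))) =
      (\<Sum>i=m..m + n. gbin (of_nat i) (int m) * ((a gchoose i) * gbin b (int (m + n) - int i)))"
    by (rule sum.mono_neutral_right) (auto simp flip: binomial_gbinomial)
  also have "\<dots> = (\<Sum>i\<in>{0..n}. gbin (of_nat (i + m)) (int m) * ((a gchoose (i + m)) * gbin b (int (m + n) - int (i + m))))"
    using sum.shift_bounds_cl_nat_ivl[of "\<lambda>i. gbin (of_nat i) (int m) * ((a gchoose i) * gbin b (int (m + n) - int i))" 0 m n]
    by (simp add: add.commute)
  also have "\<dots> = (\<Sum>i\<le>n. (a gchoose m) * ((a - of_nat m gchoose i) * gbin b (int n - int i)))"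
  proof (rule sum.cong)
    fix i
    have "gbin (of_nat (i + m)) (int m) * (a gchoose (i + m)) = (a gchoose m) * (a - of_nat m gchoose i)"
      using gbinomial_trinomial_revision[of m "i + m" a] by (simp add: mult.commute)
    then show "gbin (of_nat (i + m)) (int m) * ((a gchoose (i + m)) * gbin b (int (m + n) - int (i + m))) =
        (a gchoose m) * ((a - of_nat m gchoose i) * gbin b (int n - int i))"
      by (simp add: mult.assoc[symmetric])
  qed (simp add: atMost_atLeast0)
  finally show ?thesis
    by (simp add: sum_distrib_left[symmetric] gbin_Vandermonde)
qed

lemma binomial_coeff_0 [simp]: "binomial_coeff a 0 = 1"
  by (simp add: binomial_coeff_def)

lemma binomial_coeff_Suc:
  "binomial_coeff (a + 1) (Suc i) = binomial_coeff a (Suc i) - binomial_coeff a i"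
  unfolding binomial_coeff_def gbinomial_Suc_Suc by (simp add: algebra_simps)

lemma binomial_coeff_upper: "binomial_coeff a i = (of_nat i - a - 1) gchoose i"
  unfolding binomial_coeff_def
  by (subst gbinomial_negated_upper) (simp add: mult.assoc[symmetric] flip: power_mult_distrib)

lemma binomial_coeff_negative:
  "binomial_coeff (of_int (- int m - 1)) i = gbin (of_int (int m + int i)) (int m)"
proof -
  have "binomial_coeff (of_int (- int m - 1)) i = (of_nat (m + i) gchoose i)"
    by (simp add: binomial_coeff_upper algebra_simps)
  also have "\<dots> = (of_nat (m + i) gchoose m)"
    by (subst gbinomial_of_nat_symmetric) simp_all
  finally show ?thesis by simp
qed

text \<open>Together with \<open>binomial_coeff_negative\<close> this shows that the two expansions
  of (x - y)^(-m-1) take their coefficients from one polynomial k -> binomial(k, m), up to sign: one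
  at k >= m, the other at k < 0.\<close>

lemma gbin_reflect:
  "gbin (of_int (- 1 - int i)) (int m) = (- 1) ^ m * gbin (of_int (int m + int i)) (int m)"
  using gbinomial_minus[of "of_nat i + 1" m] by (simp add: algebra_simps)

text \<open>The upper argument grows with i exactly so that the first factor is
  \<open>- a - 1 gchoose i\<close>. For a = p/N the fractional part cancels, which is what the delta
  kernel of the twisted Jacobi identity does.\<close>

lemma binomial_coeff_Vandermonde:
  "(\<Sum>i\<le>m. binomial_coeff (a + of_nat i) i * gbin (a + 1 + b) (int m - int i)) = gbin b (int m)"
proof -
  have "binomial_coeff (a + of_nat i) i = (- a - 1) gchoose i" for i
    by (simp add: binomial_coeff_upper)
  then show ?thesis by (simp add: gbin_Vandermonde)
qed

text \<open>Upper negation turns the second upper argument into m - b - 1 for every i, so the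
  ordinary Vandermonde identity applies.\<close>

lemma binomial_coeff_Vandermonde':
  "(\<Sum>i\<le>m. binomial_coeff a i * gbin (b - of_nat i) (int m - int i)) = gbin (b - a) (int m)"
proof -
  have "binomial_coeff a i * gbin (b - of_nat i) (int m - int i) =
      (- 1) ^ m * ((a gchoose i) * gbin (of_nat m - b - 1) (int m - int i))" if "i \<le> m" for i
  proof -
    have e: "int m - int i = int (m - i)" using that by simp
    have "(b - of_nat i) gchoose (m - i) = (- 1) ^ (m - i) * ((of_nat m - b - 1) gchoose (m - i))"
      by (subst gbinomial_negated_upper) (use that in \<open>simp add: of_nat_diff algebra_simps\<close>)
    moreover have "(- 1 :: complex) ^ m = (- 1) ^ i * (- 1) ^ (m - i)"
      using that by (simp flip: power_add)
    ultimately show ?thesis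
      unfolding e gbin_of_nat binomial_coeff_def by (simp add: mult_ac)
  qed
  then have "(\<Sum>i\<le>m. binomial_coeff a i * gbin (b - of_nat i) (int m - int i)) =
      (- 1) ^ m * gbin (a + (of_nat m - b - 1)) (int m)"
    by (simp add: sum_distrib_left[symmetric] gbin_Vandermonde)
  also have "\<dots> = gbin (b - a) (int m)"
    using gbinomial_negated_upper[of "b - a" m] by (simp add: algebra_simps)
  finally show ?thesis .
qed

section \<open>Double sequences\<close>

text \<open>Double sequences are the coefficients of series in \<open>x\<^bsup>1/N\<^esup>, y\<^bsup>1/N\<^esup>\<close>, and this is multiplication by \<open>x - y\<close>.\<close>

definition diffmul :: "nat \<Rightarrow> (int \<Rightarrow> int \<Rightarrow> 'b) \<Rightarrow> int \<Rightarrow> int \<Rightarrow> 'b::ab_group_add"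
  where "diffmul N F = (\<lambda>p q. F (p - int N) q - F p (q - int N))"

text \<open>With lower bounds in both variables, only finitely many coefficients survive for each
  total exponent; this makes the substitution x = y + z a finite sum.\<close>

definition truncated :: "(int \<Rightarrow> int \<Rightarrow> 'b::zero) \<Rightarrow> bool"
  where "truncated F \<longleftrightarrow> (\<exists>L. \<forall>p q. p < L \<or> q < L \<longrightarrow> F p q = 0)"

lemma truncatedI:
  assumes "\<And>p q. p < L \<Longrightarrow> F p q = 0" and "\<And>p q. q < L' \<Longrightarrow> F p q = 0"
  shows "truncated F"
  unfolding truncated_def by (rule exI[of _ "min L L'"]) (use assms in auto)

lemma diffmul_minus:
  "diffmul N (\<lambda>p q. F p q - G p q) = (\<lambda>p q. diffmul N F p q - diffmul N G p q)"
  by (simp add: diffmul_def fun_eq_iff)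

lemma diffmul_funpow_minus:
  "(diffmul N ^^ k) (\<lambda>p q. F p q - G p q) = (\<lambda>p q. (diffmul N ^^ k) F p q - (diffmul N ^^ k) G p q)"
  by (induction k) (simp_all add: diffmul_minus)

lemma diffmul_funpow_additive:
  assumes "\<And>x y. h (x - y) = h x - h y"
  shows "(diffmul N ^^ k) (\<lambda>p q. h (F p q)) = (\<lambda>p q. h ((diffmul N ^^ k) F p q))"
  by (induction k) (simp_all add: diffmul_def assms)

lemma diffmul_funpow_shift:
  "(diffmul N ^^ k) (\<lambda>p q. F (p - c) (q - d)) = (\<lambda>p q. (diffmul N ^^ k) F (p - c) (q - d))"
  by (induction k) (simp_all add: diffmul_def algebra_simps)

lemma diffmul_funpow_add:
  "(diffmul N ^^ (j + k)) F = (diffmul N ^^ j) ((diffmul N ^^ k) F)"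
  by (simp add: funpow_add)

lemma diffmul_funpow_zero [simp]: "(diffmul N ^^ k) (\<lambda>p q. 0) = (\<lambda>p q. 0)"
  by (induction k) (simp_all add: diffmul_def)

lemma diffmul_funpow_left_zero:
  assumes "\<And>p q. p < L \<Longrightarrow> F p q = 0"
  shows "p < L \<Longrightarrow> (diffmul N ^^ k) F p q = 0"
  by (induction k arbitrary: p q) (simp_all add: diffmul_def assms)

lemma diffmul_funpow_right_zero:
  assumes "\<And>p q. q < L \<Longrightarrow> F p q = 0"
  shows "q < L \<Longrightarrow> (diffmul N ^^ k) F p q = 0"
  by (induction k arbitrary: p q) (simp_all add: diffmul_def assms)

lemma truncated_diffmul_funpow:
  assumes "truncated F"
  shows "truncated ((diffmul N ^^ k) F)"
proof -
  obtain L where "\<forall>p q. p < L \<or> q < L \<longrightarrow> F p q = 0"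
    using assms by (auto simp: truncated_def)
  then show ?thesis
    by (intro truncatedI[of L _ L] diffmul_funpow_left_zero[of L F]
        diffmul_funpow_right_zero[of L F]) auto
qed

text \<open>The model is \<open>A\<close> = a(x) b(y) w, bounded below in y, and \<open>B\<close> =
  b(y) a(x) w, bounded below in x. Once (x - y)^K identifies them, the common series inherits both
  bounds.\<close>

lemma local_truncated:
  fixes A B :: "int \<Rightarrow> int \<Rightarrow> 'b::ab_group_add"
  assumes "\<And>p q. q < L \<Longrightarrow> A p q = 0" and "\<And>p q. p < L' \<Longrightarrow> B p q = 0"
    and "(diffmul N ^^ K) A = (diffmul N ^^ K) B"
  shows "truncated ((diffmul N ^^ K) A)"
proof (rule truncatedI)
  show "(diffmul N ^^ K) A p q = 0" if "q < L" for p q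
    by (rule diffmul_funpow_right_zero[of L A]) (use assms that in auto)
  show "(diffmul N ^^ K) A p q = 0" if "p < L'" for p q
    unfolding assms(3) by (rule diffmul_funpow_left_zero[of L' B]) (use assms that in auto)
qed

lemma truncated_minus:
  fixes F G :: "int \<Rightarrow> int \<Rightarrow> 'b::ab_group_add"
  assumes "truncated F" "truncated G"
  shows "truncated (\<lambda>p q. F p q - G p q)"
proof -
  obtain L where "\<forall>p q. p < L \<or> q < L \<longrightarrow> F p q = 0"
    using assms by (auto simp: truncated_def)
  moreover obtain L' where "\<forall>p q. p < L' \<or> q < L' \<longrightarrow> G p q = 0"
    using assms by (auto simp: truncated_def)
  ultimately show ?thesis
    unfolding truncated_def by (intro exI[of _ "min L L'"]) auto
qed

lemma truncated_compose:
  assumes "truncated F" "\<And>p q. F p q = 0 \<Longrightarrow> G p q = 0"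
  shows "truncated G"
  using assms unfolding truncated_def by metis

lemma truncated_shift:
  assumes "truncated F"
  shows "truncated (\<lambda>p q. F (p - c) (q - d))"
proof -
  obtain L where "\<forall>p q. p < L \<or> q < L \<longrightarrow> F p q = 0"
    using assms by (auto simp: truncated_def)
  then show ?thesis
    by (intro truncatedI[of "L + c" _ "L + d"]) auto
qed

lemma mult_ge_self_nat: "N > 0 \<Longrightarrow> 0 \<le> k \<Longrightarrow> k \<le> int N * k"
  using mult_right_mono[of 1 "int N" k] by simp

lemma truncated_diagonal:
  assumes "truncated F" "N > 0"
  shows "\<exists>S. finite S \<and> (\<forall>k. k \<notin> S \<longrightarrow> F (p + int N * k) (q - int N * k) = 0)"
proof -
  obtain L where L: "\<forall>p q. p < L \<or> q < L \<longrightarrow> F p q = 0"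
    using assms by (auto simp: truncated_def)
  have "F (p + int N * k) (q - int N * k) = 0" if "k \<notin> {min 0 (L - p)..max 0 (q - L)}" for k
  proof (cases "k < 0")
    case True
    with that have "k < L - p" by auto
    moreover have "- k \<le> int N * (- k)"
      by (rule mult_ge_self_nat[OF assms(2)]) (use True in simp)
    ultimately have "p + int N * k < L" by simp
    with L show ?thesis by blast
  next
    case False
    with that have "k > q - L" by auto
    moreover have "k \<le> int N * k"
      by (rule mult_ge_self_nat[OF assms(2)]) (use False in simp)
    ultimately have "q - int N * k < L" by simp
    with L show ?thesis by blast
  qed
  then show ?thesis by (intro exI[of _ "{min 0 (L - p)..max 0 (q - L)}"]) auto
qed

lemma truncated_antidiagonal:
  assumes "truncated F"
  shows "\<exists>S. finite S \<and> (\<forall>p. p \<notin> S \<longrightarrow> F p (c - p) = 0)"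
  using truncated_diagonal[OF assms, of 1 0 c] by simp

text \<open>With r = - j this is the passage to the degree-j part of the first field; with r = p it
  is what remains after averaging over the N-th roots of unity.\<close>

definition restrict_residue :: "nat \<Rightarrow> int \<Rightarrow> (int \<Rightarrow> int \<Rightarrow> 'b) \<Rightarrow> int \<Rightarrow> int \<Rightarrow> 'b::zero"
  where "restrict_residue N r F = (\<lambda>p q. if int N dvd p - r then F p q else 0)"

lemma diffmul_restrict_residue:
  "(diffmul N ^^ k) (restrict_residue N r F) = restrict_residue N r ((diffmul N ^^ k) F)"
proof -
  have "int N dvd p - int N - r \<longleftrightarrow> int N dvd p - r" for p
    using dvd_diff_left_iff[of "int N" "int N" "p - r"] by (simp add: algebra_simps)
  then have "restrict_residue N r (diffmul N G) = diffmul N (restrict_residue N r G)" for G :: "int \<Rightarrow> int \<Rightarrow> 'a"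
    by (auto simp: diffmul_def restrict_residue_def fun_eq_iff)
  then show ?thesis
    by (rule funpow_commute[where R = "restrict_residue N r", symmetric])
qed

lemma truncated_restrict_residue: "truncated F \<Longrightarrow> truncated (restrict_residue N r F)"
  by (erule truncated_compose) (simp add: restrict_residue_def)

section \<open>Expansions of integer powers of x - y, and the substitution x = y + z\<close>

locale complex_vector_space = vector_space scale
  for scale :: "complex \<Rightarrow> 'w::ab_group_add \<Rightarrow> 'w"
begin

lemma scale_Sum_any: "scale c (Sum_any f) = Sum_any (\<lambda>i. scale c (f i))"
proof (cases "c = 0")
  case False
  then have "{i. scale c (f i) \<noteq> 0} = {i. f i \<noteq> 0}" by simp
  then show ?thesis by (simp add: Sum_any.expand_set scale_sum_right)
qed simp

text \<open>Collects the coefficient of each \<open>Q k\<close>, which is where a Vandermonde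
  identity can be applied; the bounds on i and k reduce both sums to finite ones.\<close>

lemma Sum_any_scale_swap:
  assumes "finite S" and "\<And>k. k \<notin> S \<Longrightarrow> Q k = 0" and "\<And>i k. i > m \<Longrightarrow> g i k = 0"
  shows "Sum_any (\<lambda>i::nat. scale (c i) (Sum_any (\<lambda>k. scale (g i k) (Q k)))) =
    Sum_any (\<lambda>k. scale (\<Sum>i\<le>m. c i * g i k) (Q k))"
proof -
  have "Sum_any (\<lambda>k. scale (g i k) (Q k)) = (\<Sum>k\<in>S. scale (g i k) (Q k))" for i
    by (rule Sum_any_on) (use assms in auto)
  then have "Sum_any (\<lambda>i::nat. scale (c i) (Sum_any (\<lambda>k. scale (g i k) (Q k)))) =
      (\<Sum>i\<le>m. scale (c i) (\<Sum>k\<in>S. scale (g i k) (Q k)))"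
    by (simp, intro Sum_any_on) (use assms(3) in auto)
  also have "\<dots> = (\<Sum>k\<in>S. \<Sum>i\<le>m. scale (c i) (scale (g i k) (Q k)))"
    by (simp add: scale_sum_right sum.swap[of _ S])
  also have "\<dots> = (\<Sum>k\<in>S. scale (\<Sum>i\<le>m. c i * g i k) (Q k))"
    by (simp add: scale_sum_left)
  also have "\<dots> = Sum_any (\<lambda>k. scale (\<Sum>i\<le>m. c i * g i k) (Q k))"
    by (rule Sum_any_on[symmetric]) (use assms in auto)
  finally show ?thesis .
qed

text \<open>Multiplication by \<open>(x - y)\<^sup>n\<close>, expanded in nonnegative powers of \<open>y\<close>.\<close>

definition expand :: "nat \<Rightarrow> int \<Rightarrow> (int \<Rightarrow> int \<Rightarrow> 'w) \<Rightarrow> int \<Rightarrow> int \<Rightarrow> 'w"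
  where "expand N n A p q = Sum_any (\<lambda>i::nat. scale (binomial_coeff (of_int n) i)
    (A (p - int N * (n - int i)) (q - int N * int i)))"

text \<open>Multiplication by \<open>(- y + x)\<^sup>n\<close>, expanded in nonnegative powers of \<open>x\<close>.\<close>

definition expand_op :: "nat \<Rightarrow> int \<Rightarrow> (int \<Rightarrow> int \<Rightarrow> 'w) \<Rightarrow> int \<Rightarrow> int \<Rightarrow> 'w"
  where "expand_op N n B p q = scale ((- 1) powi n) (expand N n (\<lambda>p q. B q p) q p)"

text \<open>Associativity (x - y)^n (x - y) = (x - y)^(n+1), for the expansion in powers of y. The
  lower bound in y leaves finitely many terms, so Pascal's rule can be summed.\<close>

lemma expand_diffmul:
  assumes N: "N > 0" and A: "\<And>p q. q < L \<Longrightarrow> A p q = 0"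
  shows "expand N n (diffmul N A) = expand N (n + 1) A"
proof (intro ext)
  fix p q
  define f where "f i = A (p - int N * (n + 1 - int i)) (q - int N * int i)" for i :: nat
  define t where "t = nat (max 0 (q - L + 1))"
  have f0: "f i = 0" if "i \<ge> t" for i
    unfolding f_def by (rule A) (use that mult_ge_self_nat[OF N, of "int i"] in \<open>auto simp: t_def\<close>)
  have "expand N n (diffmul N A) p q =
      Sum_any (\<lambda>i::nat. scale (binomial_coeff (of_int n) i) (f i - f (Suc i)))"
    unfolding expand_def diffmul_def f_def by (simp add: algebra_simps)
  also have "\<dots> = (\<Sum>i<Suc t. scale (binomial_coeff (of_int n) i) (f i - f (Suc i)))"
    by (rule Sum_any_on) (use f0 in auto)
  \<comment> \<open>Summation by parts with Pascal's rule; the boundary term is zero because t lies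
    beyond the support of f.\<close>
  also have "\<dots> = (\<Sum>i<Suc t. scale (binomial_coeff (of_int (n + 1)) i) (f i)) -
      scale (binomial_coeff (of_int n) t) (f (Suc t))"
  proof (induction t)
    case 0
    show ?case by (simp add: scale_right_diff_distrib)
  next
    case (Suc t)
    have "binomial_coeff (of_int (n + 1)) (Suc t) = binomial_coeff (of_int n) (Suc t) - binomial_coeff (of_int n) t"
      using binomial_coeff_Suc[of "of_int n" t] by simp
    then show ?case
      unfolding sum.lessThan_Suc[of _ "Suc t"] Suc.IH
      by (simp only:) (simp add: scale_right_diff_distrib scale_left_diff_distrib)
  qed
  also have "\<dots> = (\<Sum>i<Suc t. scale (binomial_coeff (of_int (n + 1)) i) (f i))"
    by (simp add: f0)
  also have "\<dots> = expand N (n + 1) A p q"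
    unfolding expand_def f_def[symmetric] by (rule Sum_any_on[symmetric]) (use f0 in auto)
  finally show "expand N n (diffmul N A) p q = expand N (n + 1) A p q" .
qed

lemma expand_0: "expand N 0 A = A"
proof (intro ext)
  fix p q
  have "binomial_coeff 0 i = 0" if "i \<noteq> 0" for i
    using that by (cases i) (auto simp: binomial_coeff_def)
  then show "expand N 0 A p q = A p q"
    unfolding expand_def by (subst Sum_any_on[of "{0}"]) auto
qed

lemma expand_diffmul_funpow:
  assumes N: "N > 0" and A: "\<And>p q. q < L \<Longrightarrow> A p q = 0"
  shows "expand N n ((diffmul N ^^ k) A) = expand N (n + int k) A"
proof (induction k arbitrary: n)
  case (Suc k)
  have "expand N n (diffmul N ((diffmul N ^^ k) A)) = expand N (n + 1) ((diffmul N ^^ k) A)"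
    using expand_diffmul[OF N, of L "(diffmul N ^^ k) A" n] diffmul_funpow_right_zero[of L A] A by blast
  with Suc show ?case by (simp add: algebra_simps)
qed simp

lemma expand_nat:
  assumes "N > 0" and "\<And>p q. q < L \<Longrightarrow> A p q = 0"
  shows "expand N (int k) A = (diffmul N ^^ k) A"
  using expand_diffmul_funpow[of N L A 0 k] assms by (simp add: expand_0)

lemma expand_uminus: "expand N n (\<lambda>p q. - A p q) p q = - expand N n A p q"
  unfolding expand_def by (simp add: Sum_any.expand_set sum_negf)

lemma expand_op_diffmul:
  assumes N: "N > 0" and B: "\<And>p q. p < L \<Longrightarrow> B p q = 0"
  shows "expand_op N n (diffmul N B) = expand_op N (n + 1) B"
proof (intro ext)
  fix p q
  have sw: "(\<lambda>p q. diffmul N B q p) = (\<lambda>p q. - diffmul N (\<lambda>p q. B q p) p q)"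
    by (simp add: diffmul_def)
  have "expand N n (diffmul N (\<lambda>p q. B q p)) = expand N (n + 1) (\<lambda>p q. B q p)"
    by (rule expand_diffmul[OF N, of L]) (rule B)
  then show "expand_op N n (diffmul N B) p q = expand_op N (n + 1) B p q"
    unfolding expand_op_def sw expand_uminus by (simp add: power_int_add)
qed

lemma expand_op_0: "expand_op N 0 B = B"
  by (simp add: expand_op_def expand_0 fun_eq_iff)

lemma expand_op_diffmul_funpow:
  assumes N: "N > 0" and B: "\<And>p q. p < L \<Longrightarrow> B p q = 0"
  shows "expand_op N n ((diffmul N ^^ k) B) = expand_op N (n + int k) B"
proof (induction k arbitrary: n)
  case (Suc k)
  have "expand_op N n (diffmul N ((diffmul N ^^ k) B)) = expand_op N (n + 1) ((diffmul N ^^ k) B)"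
    using expand_op_diffmul[OF N, of L "(diffmul N ^^ k) B" n] diffmul_funpow_left_zero[of L B] B by blast
  with Suc show ?case by (simp add: algebra_simps)
qed simp

lemma expand_op_nat:
  assumes "N > 0" and "\<And>p q. p < L \<Longrightarrow> B p q = 0"
  shows "expand_op N (int k) B = (diffmul N ^^ k) B"
  using expand_op_diffmul_funpow[of N L B 0 k] assms by (simp add: expand_op_0)

text \<open>
  The difference of the two expansions of \<open>(x - y)\<^bsup>-m-1\<^esup>\<close> is a derivative of the delta function,
  whose coefficients are \<open>gbin k m\<close> for all integers \<open>k\<close>.
\<close>

lemma expand_negative_diff:
  assumes N: "N > 0" and Q: "truncated Q"
  shows "expand N (- int m - 1) Q p q - expand_op N (- int m - 1) Q p q =
    Sum_any (\<lambda>k. scale (gbin (of_int (k - 1)) (int m)) (Q (p + int N * k) (q - int N * (k - 1 - int m))))"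
proof -
  \<comment> \<open>Both expansions are read off this one family: the first uses the indices k = m +
    i, the second k = - 1 - i.\<close>
  define g where "g k = scale (gbin (of_int k) (int m)) (Q (p + int N * (k + 1)) (q - int N * (k - int m)))" for k
  obtain S where S: "finite S" "\<And>k. k \<notin> S \<Longrightarrow> Q (p + int N + int N * k) (q + int N * int m - int N * k) = 0"
    using truncated_diagonal[OF Q N] by metis
  have g0: "g k = 0" if "k \<notin> S" for k
    using S(2)[OF that] by (simp add: g_def algebra_simps)
  have 1: "expand N (- int m - 1) Q p q = Sum_any (\<lambda>k. if k \<ge> int m then g k else 0)"
  proof -
    have inj: "inj (\<lambda>i. int m + int i)" by (simp add: inj_def)
    have "k \<in> range (\<lambda>i. int m + int i)" if "k \<ge> int m" for k
      by (rule image_eqI[of _ _ "nat (k - int m)"]) (use that in auto)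
    then have "Sum_any (\<lambda>k. if k \<ge> int m then g k else 0) = Sum_any (\<lambda>i. g (int m + int i))"
      by (subst Sum_any_reindex[OF inj]) (auto split: if_splits)
    also have "\<dots> = expand N (- int m - 1) Q p q"
      unfolding expand_def g_def binomial_coeff_negative by (simp add: algebra_simps)
    finally show ?thesis by simp
  qed
  have 2: "expand_op N (- int m - 1) Q p q = - Sum_any (\<lambda>k. if k < 0 then g k else 0)"
  proof -
    have inj: "inj (\<lambda>i. - 1 - int i)" by (simp add: inj_def)
    have "k \<in> range (\<lambda>i. - 1 - int i)" if "k < 0" for k
      by (rule image_eqI[of _ _ "nat (- k - 1)"]) (use that in auto)
    then have "Sum_any (\<lambda>k. if k < 0 then g k else 0) = Sum_any (\<lambda>i. g (- 1 - int i))"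
      by (subst Sum_any_reindex[OF inj]) (auto split: if_splits)
    also have "\<dots> = scale ((- 1) ^ m) (expand N (- int m - 1) (\<lambda>p q. Q q p) q p)"
      unfolding expand_def g_def binomial_coeff_negative gbin_reflect scale_Sum_any
      by (simp add: algebra_simps)
    also have "(- 1 :: complex) ^ m = - ((- 1) powi (- int m - 1))"
      by (cases "even m") (simp_all add: power_int_diff power_int_minus)
    finally show ?thesis by (simp add: expand_op_def)
  qed
  have "Sum_any g = Sum_any (\<lambda>k. (if k \<ge> int m then g k else 0) + (if k < 0 then g k else 0))"
  proof (rule Sum_any.cong)
    fix k
    \<comment> \<open>Neither expansion reaches 0 <= k < m, but these are the zeros of binomial(k,
      m), so the two half-lines join to a sum over all integers.\<close>
    have "g k = 0" if "0 \<le> k" "k < int m"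
    proof -
      have "gbin (of_int k) (int m) = 0"
        using that binomial_gbinomial[of "nat k" m, where 'a = complex] by (simp add: binomial_eq_0)
      then show ?thesis by (simp add: g_def)
    qed
    then show "g k = (if k \<ge> int m then g k else 0) + (if k < 0 then g k else 0)" by auto
  qed
  also have "\<dots> = Sum_any (\<lambda>k. if k \<ge> int m then g k else 0) + Sum_any (\<lambda>k. if k < 0 then g k else 0)"
  proof (rule Sum_any.distrib)
    show "finite {k. (if k \<ge> int m then g k else 0) \<noteq> 0}"
      by (rule finite_subset[OF _ S(1)]) (use g0 in \<open>auto split: if_splits\<close>)
    show "finite {k. (if k < 0 then g k else 0) \<noteq> 0}"
      by (rule finite_subset[OF _ S(1)]) (use g0 in \<open>auto split: if_splits\<close>)
  qed
  finally have "expand N (- int m - 1) Q p q - expand_op N (- int m - 1) Q p q = Sum_any g"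
    by (simp add: 1 2)
  also have "\<dots> = Sum_any (\<lambda>k. g (k - 1))"
    by (rule Sum_any_reindex) (auto simp: inj_def intro: image_eqI[of _ _ "_ + 1"])
  finally show ?thesis by (simp add: g_def algebra_simps)
qed

text \<open>Splitting (x - y)^n as (x - y)^(n-K) (x - y)^K moves both expansions onto the common
  truncated series. For n >= K they then agree, which is the case m < 0; otherwise
  \<open>expand_negative_diff\<close> applies with m = K - 1 - n.\<close>

lemma expand_diff:
  assumes N: "N > 0" and A: "\<And>p q. q < L \<Longrightarrow> A p q = 0" and B: "\<And>p q. p < L' \<Longrightarrow> B p q = 0"
    and loc: "(diffmul N ^^ K) A = (diffmul N ^^ K) B"
    and m: "m = int K - 1 - n"
  shows "expand N n A p q - expand_op N n B p q =
    Sum_any (\<lambda>k. scale (gbin (of_int (k - 1)) m)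
      ((diffmul N ^^ K) A (p + int N * k) (q - int N * (k - 1 - m))))"
proof -
  have tr: "truncated ((diffmul N ^^ K) A)"
    using A B loc by (rule local_truncated)
  have eA: "expand N (n - int K) ((diffmul N ^^ K) A) = expand N n A"
    by (subst expand_diffmul_funpow[OF N A]) auto
  have eB: "expand_op N (n - int K) ((diffmul N ^^ K) A) = expand_op N n B"
    unfolding loc by (subst expand_op_diffmul_funpow[OF N B]) auto
  show ?thesis
  proof (cases "m < 0")
    case True
    define j where "j = nat (n - int K)"
    have j: "n - int K = int j" using True m by (simp add: j_def)
    obtain M where "\<forall>p q. p < M \<or> q < M \<longrightarrow> (diffmul N ^^ K) A p q = 0"
      using tr by (auto simp: truncated_def)
    then have "expand N n A = expand_op N n B"
      unfolding eA[symmetric] eB[symmetric] j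
      by (subst expand_nat[OF N, of M], simp, subst expand_op_nat[OF N, of M]) auto
    with True show ?thesis by simp
  next
    case False
    define j where "j = nat m"
    have "m = int j" "n - int K = - int j - 1" using False m by (auto simp: j_def)
    with expand_negative_diff[OF N tr, of j p q] eA eB show ?thesis by simp
  qed
qed

text \<open>The coefficient of \<open>z\<^sup>m y\<^bsup>q/N\<^esup>\<close> in the series obtained by substituting \<open>x = y + z\<close>.\<close>

definition substitute :: "nat \<Rightarrow> (int \<Rightarrow> int \<Rightarrow> 'w) \<Rightarrow> int \<Rightarrow> int \<Rightarrow> 'w"
  where "substitute N F m q = Sum_any (\<lambda>p. scale (gbin (of_int p / of_nat N) m) (F p (q - p + int N * m)))"

lemma substitute_support:
  assumes "truncated F"
  shows "\<exists>S. finite S \<and> (\<forall>p. p \<notin> S \<longrightarrow> F p (q - p + int N * m) = 0)"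
  using truncated_antidiagonal[OF assms, of "q + int N * m"] by (simp add: algebra_simps)

lemma substitute_finite:
  assumes "truncated F"
  shows "finite {p. scale (a p) (F p (q - p + int N * m)) \<noteq> 0}"
proof -
  obtain S where "finite S" "\<forall>p. p \<notin> S \<longrightarrow> F p (q - p + int N * m) = 0"
    using substitute_support[OF assms] by metis
  then show ?thesis by (auto intro: finite_subset[of _ S])
qed

lemma substitute_neg: "m < 0 \<Longrightarrow> substitute N F m q = 0"
  by (simp add: substitute_def)

lemma substitute_minus:
  assumes "truncated F" "truncated G"
  shows "substitute N (\<lambda>p q. F p q - G p q) m q = substitute N F m q - substitute N G m q"
  unfolding substitute_def scale_right_diff_distrib
  by (rule Sum_any_minus) (rule substitute_finite[OF assms(1)], rule substitute_finite[OF assms(2)])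

text \<open>Under x = y + z the factor x - y is z; on coefficients this is Pascal's rule with upper
  argument p/N.\<close>

lemma substitute_diffmul:
  assumes N: "N > 0" and F: "truncated F"
  shows "substitute N (diffmul N F) m q = substitute N F (m - 1) q"
proof -
  let ?e = "\<lambda>p. q - p + int N * (m - 1)"
  have F1: "truncated (\<lambda>p q. F (p - int N) q)" and F2: "truncated (\<lambda>p q. F p (q - int N))"
    using truncated_shift[OF F, of "int N" 0] truncated_shift[OF F, of 0 "int N"] by simp_all
  have "substitute N (\<lambda>p q. F (p - int N) q) m q =
      Sum_any (\<lambda>p. scale (gbin (of_int (p + int N) / of_nat N) m) (F (p + int N - int N) (q - (p + int N) + int N * m)))"
    unfolding substitute_def
    by (rule Sum_any_reindex) (auto simp: inj_def intro: image_eqI[of _ _ "_ - int N"])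
  also have "\<dots> = Sum_any (\<lambda>p. scale (gbin (of_int p / of_nat N + 1) m) (F p (?e p)))"
    using N by (simp add: add_divide_distrib algebra_simps)
  finally have "substitute N (diffmul N F) m q =
      Sum_any (\<lambda>p. scale (gbin (of_int p / of_nat N + 1) m) (F p (?e p))) -
      Sum_any (\<lambda>p. scale (gbin (of_int p / of_nat N) m) (F p (?e p)))"
    using substitute_minus[OF F1 F2, of N m q] by (simp add: diffmul_def substitute_def algebra_simps)
  also have "\<dots> = substitute N F (m - 1) q"
    unfolding substitute_def
    by (subst Sum_any_minus[symmetric], rule substitute_finite[OF F], rule substitute_finite[OF F])
      (simp only: gbin_pascal scale_left_distrib add_diff_cancel_left')
  finally show ?thesis .
qed

lemma substitute_diffmul_funpow:
  assumes "N > 0" "truncated F"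
  shows "substitute N ((diffmul N ^^ k) F) m q = substitute N F (m - int k) q"
proof (induction k arbitrary: m)
  case (Suc k)
  have "substitute N (diffmul N ((diffmul N ^^ k) F)) m q = substitute N ((diffmul N ^^ k) F) (m - 1) q"
    by (rule substitute_diffmul) (simp_all add: assms truncated_diffmul_funpow)
  with Suc show ?case by (simp add: algebra_simps)
qed simp

lemma substitute_restrict_residue:
  assumes "N > 0"
  shows "substitute N (restrict_residue N r F) m q =
    Sum_any (\<lambda>k. scale (gbin (of_int (r + int N * k) / of_nat N) m) (F (r + int N * k) (q - (r + int N * k) + int N * m)))"
proof -
  have inj: "inj (\<lambda>k. r + int N * k)" using assms by (simp add: inj_def)
  have "p \<in> range (\<lambda>k. r + int N * k)" if "int N dvd p - r" for p
    using that by (auto elim!: dvdE intro!: image_eqI simp: algebra_simps)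
  then show ?thesis
    unfolding substitute_def
    by (subst Sum_any_reindex[OF inj]) (auto simp: restrict_residue_def split: if_splits)
qed

section \<open>Regularized substitution\<close>

text \<open>
  A series that becomes truncated in both variables after multiplication by a power of \<open>x - y\<close>
  behaves like a rational function with poles at \<open>x = y\<close>, and \<open>specialize\<close> substitutes \<open>x = y + z\<close> in it.
\<close>

definition regular :: "nat \<Rightarrow> (int \<Rightarrow> int \<Rightarrow> 'w) \<Rightarrow> bool"
  where "regular N F \<longleftrightarrow> (\<exists>K. truncated ((diffmul N ^^ K) F))"

definition specialize :: "nat \<Rightarrow> (int \<Rightarrow> int \<Rightarrow> 'w) \<Rightarrow> int \<Rightarrow> int \<Rightarrow> 'w"
  where "specialize N F c q = (let K = (SOME K. truncated ((diffmul N ^^ K) F)) in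
    substitute N ((diffmul N ^^ K) F) (c + int K) q)"

lemma regularI: "truncated ((diffmul N ^^ K) F) \<Longrightarrow> regular N F"
  by (auto simp: regular_def)

text \<open>The choice inside \<open>specialize\<close> is immaterial: two admissible powers K and M
  are compared through K + M, since an extra factor x - y only shifts the exponent of z.\<close>

lemma specialize_eq:
  assumes N: "N > 0" and K: "truncated ((diffmul N ^^ K) F)"
  shows "specialize N F c q = substitute N ((diffmul N ^^ K) F) (c + int K) q"
proof -
  define M where "M = (SOME K. truncated ((diffmul N ^^ K) F))"
  have M: "truncated ((diffmul N ^^ M) F)"
    unfolding M_def by (rule someI[of _ K]) (rule K)
  have "substitute N ((diffmul N ^^ (K + M)) F) (c + int K + int M) q = substitute N ((diffmul N ^^ M) F) (c + int M) q"
    unfolding diffmul_funpow_add substitute_diffmul_funpow[OF N M] by (simp add: algebra_simps)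
  moreover have "substitute N ((diffmul N ^^ (K + M)) F) (c + int K + int M) q = substitute N ((diffmul N ^^ K) F) (c + int K) q"
    unfolding add.commute[of K M] diffmul_funpow_add substitute_diffmul_funpow[OF N K] by (simp add: algebra_simps)
  ultimately show ?thesis by (simp add: specialize_def M_def[symmetric] Let_def)
qed

lemma specialize_truncated:
  "N > 0 \<Longrightarrow> truncated F \<Longrightarrow> specialize N F c q = substitute N F c q"
  using specialize_eq[of N 0 F c q] by simp

lemma specialize_below:
  assumes "N > 0" "truncated ((diffmul N ^^ K) F)" "c < - int K"
  shows "specialize N F c q = 0"
  using assms by (simp add: specialize_eq substitute_neg)

lemma regular_common:
  assumes "regular N F" "regular N G"
  obtains K where "truncated ((diffmul N ^^ K) F)" "truncated ((diffmul N ^^ K) G)"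
proof -
  obtain K M where "truncated ((diffmul N ^^ K) F)" "truncated ((diffmul N ^^ M) G)"
    using assms by (auto simp: regular_def)
  then have "truncated ((diffmul N ^^ (K + M)) F)" "truncated ((diffmul N ^^ (K + M)) G)"
    using truncated_diffmul_funpow[of "(diffmul N ^^ K) F" M N] truncated_diffmul_funpow[of "(diffmul N ^^ M) G" K N]
    by (simp_all add: add.commute[of K M] flip: diffmul_funpow_add)
  then show ?thesis using that by blast
qed

lemma regular_minus:
  assumes "regular N F" "regular N G"
  shows "regular N (\<lambda>p q. F p q - G p q)"
proof -
  obtain K where "truncated ((diffmul N ^^ K) F)" "truncated ((diffmul N ^^ K) G)"
    using regular_common[OF assms] .
  then show ?thesis
    by (intro regularI[where K = K]) (simp add: diffmul_funpow_minus truncated_minus)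
qed

lemma specialize_minus:
  assumes "N > 0" "regular N F" "regular N G"
  shows "specialize N (\<lambda>p q. F p q - G p q) c q = specialize N F c q - specialize N G c q"
proof -
  obtain K where "truncated ((diffmul N ^^ K) F)" "truncated ((diffmul N ^^ K) G)"
    using regular_common[OF assms(2,3)] .
  then show ?thesis
    using assms(1) by (simp add: specialize_eq[of N K] diffmul_funpow_minus truncated_minus substitute_minus)
qed

lemma regular_diffmul: "regular N F \<Longrightarrow> regular N (diffmul N F)"
  unfolding regular_def funpow_swap1[symmetric]
  using truncated_diffmul_funpow[where N = N and k = 1] by auto

lemma specialize_diffmul:
  assumes "N > 0" "regular N F"
  shows "specialize N (diffmul N F) c q = specialize N F (c - 1) q"
proof -
  obtain K where K: "truncated ((diffmul N ^^ K) F)"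
    using assms by (auto simp: regular_def)
  then have "truncated ((diffmul N ^^ K) (diffmul N F))"
    using truncated_diffmul_funpow[OF K, where N = N and k = 1] by (simp add: funpow_swap1)
  then show ?thesis
    using assms(1) K substitute_diffmul[OF assms(1) K, of "c + int K" q]
    by (simp add: specialize_eq[of N K] funpow_swap1 algebra_simps)
qed

lemma regular_shift:
  assumes "regular N F" shows "regular N (\<lambda>p q. F (p - c) (q - d))"
  using assms unfolding regular_def diffmul_funpow_shift by (blast intro: truncated_shift)

lemma specialize_shift_right:
  assumes "N > 0" "regular N F"
  shows "specialize N (\<lambda>p q. F p (q - d)) c q = specialize N F c (q - d)"
proof -
  obtain K where K: "truncated ((diffmul N ^^ K) F)"
    using assms by (auto simp: regular_def)
  have sh: "(diffmul N ^^ K) (\<lambda>p q. F p (q - d)) = (\<lambda>p q. (diffmul N ^^ K) F p (q - d))"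
    using diffmul_funpow_shift[of K N F 0 d] by simp
  have "truncated (\<lambda>p q. (diffmul N ^^ K) F p (q - d))"
    using truncated_shift[OF K, of 0 d] by simp
  then show ?thesis
    using assms(1) K by (simp add: specialize_eq[of N K] sh substitute_def algebra_simps)
qed

text \<open>The factor x becomes y + z.\<close>

lemma specialize_shift_left:
  assumes "N > 0" "regular N F"
  shows "specialize N (\<lambda>p q. F (p - int N) q) c q = specialize N F c (q - int N) + specialize N F (c - 1) q"
proof -
  have "regular N (\<lambda>p q. F p (q - int N))" "regular N (\<lambda>p q. F (p - int N) q)"
    using regular_shift[OF assms(2), of 0 "int N"] regular_shift[OF assms(2), of "int N" 0] by simp_all
  then show ?thesis
    using specialize_diffmul[OF assms, of c q] specialize_shift_right[OF assms, of "int N" c q]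
    by (simp add: diffmul_def specialize_minus assms(1) algebra_simps)
qed

text \<open>Each coefficient of \<open>specialize\<close> is a finite linear combination, so a
  linear operator passes through it. This lets a third field act on a product of two.\<close>

lemma specialize_linear_image:
  assumes "N > 0" "regular N F"
    and h: "\<And>x y. h (x + y) = h x + h y" "\<And>c x. h (scale c x) = scale c (h x)"
  shows "regular N (\<lambda>p q. h (F p q))" and "specialize N (\<lambda>p q. h (F p q)) c q = h (specialize N F c q)"
proof -
  have h0: "h 0 = 0" using h(2)[of 0 0] by simp
  have hd: "h (x - y) = h x - h y" for x y
    using h(1)[of "x - y" y] by (simp add: algebra_simps)
  obtain K where K: "truncated ((diffmul N ^^ K) F)"
    using assms by (auto simp: regular_def)
  have e: "(diffmul N ^^ K) (\<lambda>p q. h (F p q)) = (\<lambda>p q. h ((diffmul N ^^ K) F p q))"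
    by (rule diffmul_funpow_additive) (rule hd)
  have K': "truncated (\<lambda>p q. h ((diffmul N ^^ K) F p q))"
    by (rule truncated_compose[OF K]) (simp add: h0)
  then show "regular N (\<lambda>p q. h (F p q))"
    by (intro regularI[where K = K]) (simp add: e)
  obtain S where S: "finite S" "\<forall>p. p \<notin> S \<longrightarrow> (diffmul N ^^ K) F p (q - p + int N * (c + int K)) = 0"
    using substitute_support[OF K] by metis
  have hs: "h (sum f S) = (\<Sum>p\<in>S. h (f p))" for f
    by (induction S rule: infinite_finite_induct) (simp_all add: h0 h)
  have "specialize N (\<lambda>p q. h (F p q)) c q =
      (\<Sum>p\<in>S. scale (gbin (of_int p / of_nat N) (c + int K)) (h ((diffmul N ^^ K) F p (q - p + int N * (c + int K)))))"
    using K' assms(1) unfolding specialize_eq[OF assms(1), where K = K and F = "\<lambda>p q. h (F p q)", unfolded e, OF K'] substitute_def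
    by (intro Sum_any_on) (use S h0 in auto)
  also have "\<dots> = h (\<Sum>p\<in>S. scale (gbin (of_int p / of_nat N) (c + int K)) ((diffmul N ^^ K) F p (q - p + int N * (c + int K))))"
    by (simp add: hs h)
  also have "\<dots> = h (specialize N F c q)"
    unfolding specialize_eq[OF assms(1) K] substitute_def
    by (subst Sum_any_on[OF S(1)]) (use S in auto)
  finally show "specialize N (\<lambda>p q. h (F p q)) c q = h (specialize N F c q)" .
qed

lemma specialize_scale:
  assumes "N > 0" "regular N F"
  shows "regular N (\<lambda>p q. scale a (F p q))"
    and "specialize N (\<lambda>p q. scale a (F p q)) c q = scale a (specialize N F c q)"
  using specialize_linear_image[OF assms, of "scale a"]
  by (simp_all add: scale_right_distrib mult.commute)

lemma regular_add:
  assumes "N > 0" "regular N F" "regular N G"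
  shows "regular N (\<lambda>p q. F p q + G p q)"
  using regular_minus[OF assms(2) specialize_scale(1)[OF assms(1,3), of "- 1"]] by simp

lemma specialize_add:
  assumes "N > 0" "regular N F" "regular N G"
  shows "specialize N (\<lambda>p q. F p q + G p q) c q = specialize N F c q + specialize N G c q"
  using specialize_minus[OF assms(1,2) specialize_scale(1)[OF assms(1,3), of "- 1"]]
    specialize_scale(2)[OF assms(1,3), of "- 1"] by simp

lemma specialize_sum:
  assumes "N > 0" "finite I" "\<And>i. i \<in> I \<Longrightarrow> regular N (F i)"
  shows "regular N (\<lambda>p q. \<Sum>i\<in>I. F i p q) \<and>
    specialize N (\<lambda>p q. \<Sum>i\<in>I. F i p q) c q = (\<Sum>i\<in>I. specialize N (F i) c q)"
  using assms(2,3)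
proof (induction I rule: finite_induct)
  case empty
  have "truncated (\<lambda>p q. 0 :: 'w)" by (simp add: truncated_def)
  then show ?case
    using assms(1) regularI[where K = 0 and N = N and F = "\<lambda>p q. 0 :: 'w"] by (simp add: specialize_truncated substitute_def)
next
  case (insert i I)
  then show ?case
    using regular_add[OF assms(1), of "F i" "\<lambda>p q. \<Sum>i\<in>I. F i p q"]
      specialize_add[OF assms(1), of "F i" "\<lambda>p q. \<Sum>i\<in>I. F i p q" c q] by simp
qed

lemma regular_restrict_residue: "regular N F \<Longrightarrow> regular N (restrict_residue N r F)"
  unfolding regular_def diffmul_restrict_residue by (blast intro: truncated_restrict_residue)

lemma specialize_restrict_residue:
  assumes "N > 0" "truncated ((diffmul N ^^ K) F)"
  shows "specialize N (restrict_residue N r F) c q =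
    Sum_any (\<lambda>k. scale (gbin (of_int (r + int N * k) / of_nat N) (c + int K))
      ((diffmul N ^^ K) F (r + int N * k) (q - (r + int N * k) + int N * (c + int K))))"
  using assms truncated_restrict_residue[OF assms(2), of N r]
  by (simp add: specialize_eq[of N K] diffmul_restrict_residue substitute_restrict_residue)

text \<open>Multiplying \<open>x\<close> and \<open>y\<close> by the same root of unity commutes with \<open>specialize\<close>.\<close>

lemma specialize_twist:
  assumes N: "N > 0" and F: "regular N F" and \<phi>: "\<And>n. \<phi> (n - int N) = \<phi> n"
  shows "specialize N (\<lambda>p q. scale (\<phi> (p + q)) (F p q)) c q = scale (\<phi> q) (specialize N F c q)"
proof -
  obtain K where K: "truncated ((diffmul N ^^ K) F)"
    using F by (auto simp: regular_def)
  have "\<phi> (n + int N * int k) = \<phi> n" for n k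
  proof (induction k)
    case (Suc k)
    then show ?case using \<phi>[of "n + int N * int (Suc k)"] by (simp add: algebra_simps)
  qed simp
  then have \<phi>': "\<phi> (n + int N * k) = \<phi> n" if "k \<ge> 0" for n k
    using that by (metis int_nat_eq)
  have e: "(diffmul N ^^ k) (\<lambda>p q. scale (\<phi> (p + q)) (F p q)) = (\<lambda>p q. scale (\<phi> (p + q)) ((diffmul N ^^ k) F p q))" for k
  proof (induction k)
    case (Suc k)
    have "\<phi> (p - int N + q) = \<phi> (p + q)" "\<phi> (p + (q - int N)) = \<phi> (p + q)" for p q
      using \<phi>[of "p + q"] by (simp_all add: algebra_simps)
    with Suc show ?case by (simp add: diffmul_def scale_right_diff_distrib)
  qed simp
  have K': "truncated (\<lambda>p q. scale (\<phi> (p + q)) ((diffmul N ^^ K) F p q))"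
    by (rule truncated_compose[OF K]) simp
  show ?thesis
  proof (cases "c + int K < 0")
    case True
    then show ?thesis
      using N K K' by (simp add: specialize_eq[of N K] e substitute_neg)
  next
    case False
    \<comment> \<open>All contributions to y^(q/N) have total exponent congruent to q modulo N, so
      the twist is constant along the sum.\<close>
    then have "\<phi> (p + (q - p + int N * (c + int K))) = \<phi> q" for p
      using \<phi>'[of "c + int K" q] by simp
    then show ?thesis
      using N K K' by (simp add: specialize_eq[of N K] e substitute_def scale_Sum_any mult.commute)
  qed
qed

section \<open>The Jacobi identity for local double sequences\<close>

text \<open>The right side is the iterate term after averaging over roots of unity, which leaves
  only exponents of x congruent to p modulo N. Summing over i,
  \<open>binomial_coeff_Vandermonde\<close> removes p/N and leaves the delta coefficients of
  \<open>expand_diff\<close>.\<close>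

lemma expand_jacobi:
  assumes N: "N > 0" and A: "\<And>p q. q < L \<Longrightarrow> A p q = 0" and B: "\<And>p q. p < L' \<Longrightarrow> B p q = 0"
    and loc: "(diffmul N ^^ K) A = (diffmul N ^^ K) B"
  shows "expand N n A p q - expand_op N n B p q =
    Sum_any (\<lambda>i::nat. scale (binomial_coeff (of_int (p + int N * int i) / of_nat N) i)
      (specialize N (restrict_residue N p A) (- n - 1 - int i) (q + int N + p + int N * int i)))"
proof -
  define m where "m = int K - 1 - n"
  define Q where "Q k = (diffmul N ^^ K) A (p + int N * k) (q - int N * (k - 1 - m))" for k
  have tr: "truncated ((diffmul N ^^ K) A)"
    using A B loc by (rule local_truncated)
  obtain S where S: "finite S" "\<And>k. k \<notin> S \<Longrightarrow> Q k = 0"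
    using truncated_diagonal[OF tr N, of p "q + int N * (1 + m)"] unfolding Q_def
    by (auto simp: algebra_simps)
  have pN: "of_int (p + int N * k) / of_nat N = of_int p / of_nat N + (of_int k :: complex)" for k
    using N by (simp add: add_divide_distrib)
  have "specialize N (restrict_residue N p A) (- n - 1 - int i) (q + int N + p + int N * int i) =
      Sum_any (\<lambda>k. scale (gbin (of_int (p + int N * k) / of_nat N) (m - int i)) (Q k))" for i
    unfolding specialize_restrict_residue[OF N tr] Q_def m_def by (simp add: algebra_simps)
  then have "Sum_any (\<lambda>i::nat. scale (binomial_coeff (of_int (p + int N * int i) / of_nat N) i)
      (specialize N (restrict_residue N p A) (- n - 1 - int i) (q + int N + p + int N * int i))) =
    Sum_any (\<lambda>i::nat. scale (binomial_coeff (of_int (p + int N * int i) / of_nat N) i)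
      (Sum_any (\<lambda>k. scale (gbin (of_int (p + int N * k) / of_nat N) (m - int i)) (Q k))))"
    by simp
  also have "\<dots> = Sum_any (\<lambda>k. scale (\<Sum>i\<le>nat m. binomial_coeff (of_int (p + int N * int i) / of_nat N) i *
      gbin (of_int (p + int N * k) / of_nat N) (m - int i)) (Q k))"
    by (rule Sum_any_scale_swap[OF S]) auto
  also have "\<dots> = Sum_any (\<lambda>k. scale (gbin (of_int (k - 1)) m) (Q k))"
  proof (cases "m < 0")
    case False
    then have m: "m = int (nat m)" by simp
    have "(\<Sum>i\<le>nat m. binomial_coeff (of_int (p + int N * int i) / of_nat N) i *
        gbin (of_int (p + int N * k) / of_nat N) (m - int i)) = gbin (of_int (k - 1)) m" for k
      using binomial_coeff_Vandermonde[of "of_int p / of_nat N" "of_int (k - 1)" "nat m"] m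
      unfolding pN by simp
    then show ?thesis by simp
  qed simp
  also have "\<dots> = expand N n A p q - expand_op N n B p q"
    unfolding Q_def by (rule expand_diff[symmetric, OF N A B loc m_def])
  finally show ?thesis by simp
qed

text \<open>Links the residue in \<open>vertex_op_hom\<close> to substitution. The factor ((x -
  z)/y)^(j/N) makes the exponents of the degree-j part integral, and
  \<open>binomial_coeff_Vandermonde'\<close> recovers the coefficients of (y + z)^(k - j/N).\<close>

lemma specialize_residue_formula:
  assumes N: "N > 0" and A: "\<And>p q. q < L \<Longrightarrow> A p q = 0" and B: "\<And>p q. p < L' \<Longrightarrow> B p q = 0"
    and loc: "(diffmul N ^^ K) A = (diffmul N ^^ K) B"
  shows "Sum_any (\<lambda>i::nat. let p = - int N - int j + int N * int i; n = - (c - int i) - 1 in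
      scale (binomial_coeff (of_nat j / of_nat N) i) (expand N n A p (q + int j) - expand_op N n B p (q + int j))) =
    specialize N (restrict_residue N (- int j) A) c q"
proof -
  define m where "m = c + int K"
  define Q where "Q k = (diffmul N ^^ K) A (- int j + int N * k) (q + int j - int N * (k - m))" for k
  have tr: "truncated ((diffmul N ^^ K) A)"
    using A B loc by (rule local_truncated)
  obtain S where S: "finite S" "\<And>k. k \<notin> S \<Longrightarrow> Q k = 0"
    using truncated_diagonal[OF tr N, of "- int j" "q + int j + int N * m"] unfolding Q_def
    by (auto simp: algebra_simps)
  have "(let p = - int N - int j + int N * int i; n = - (c - int i) - 1 in
      scale (binomial_coeff (of_nat j / of_nat N) i) (expand N n A p (q + int j) - expand_op N n B p (q + int j))) =
      scale (binomial_coeff (of_nat j / of_nat N) i)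
        (Sum_any (\<lambda>k. scale (gbin (of_int k - of_nat i) (m - int i)) (Q k)))" (is "?l = scale _ ?r") for i :: nat
  proof -
    let ?g = "\<lambda>k. scale (gbin (of_int (k - 1)) (m - int i))
      ((diffmul N ^^ K) A (- int N - int j + int N * int i + int N * k) (q + int j - int N * (k - 1 - (m - int i))))"
    have "expand N (- (c - int i) - 1) A (- int N - int j + int N * int i) (q + int j) -
        expand_op N (- (c - int i) - 1) B (- int N - int j + int N * int i) (q + int j) = Sum_any ?g"
      by (rule expand_diff[OF N A B loc]) (auto simp: m_def)
    \<comment> \<open>Replacing k by k + 1 - i makes the exponents of the series independent of i,
      so that the two sums can be interchanged.\<close>
    also have "\<dots> = Sum_any (\<lambda>k. ?g (k + 1 - int i))"
      by (rule Sum_any_reindex) (auto simp: inj_def intro: image_eqI[of _ _ "_ - 1 + int i"])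
    also have "\<dots> = Sum_any (\<lambda>k. scale (gbin (of_int k - of_nat i) (m - int i)) (Q k))"
      unfolding Q_def by (simp add: algebra_simps)
    finally show ?thesis by simp
  qed
  then have "Sum_any (\<lambda>i::nat. let p = - int N - int j + int N * int i; n = - (c - int i) - 1 in
      scale (binomial_coeff (of_nat j / of_nat N) i) (expand N n A p (q + int j) - expand_op N n B p (q + int j))) =
    Sum_any (\<lambda>i::nat. scale (binomial_coeff (of_nat j / of_nat N) i)
      (Sum_any (\<lambda>k. scale (gbin (of_int k - of_nat i) (m - int i)) (Q k))))"
    by (rule Sum_any.cong)
  also have "\<dots> = Sum_any (\<lambda>k. scale (\<Sum>i\<le>nat m. binomial_coeff (of_nat j / of_nat N) i *
      gbin (of_int k - of_nat i) (m - int i)) (Q k))"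
    by (rule Sum_any_scale_swap[OF S]) auto
  also have "\<dots> = Sum_any (\<lambda>k. scale (gbin (of_int (- int j + int N * k) / of_nat N) m) (Q k))"
  proof (cases "m < 0")
    case False
    then have m: "m = int (nat m)" by simp
    have "(\<Sum>i\<le>nat m. binomial_coeff (of_nat j / of_nat N) i * gbin (of_int k - of_nat i) (m - int i)) =
        gbin (of_int (- int j + int N * k) / of_nat N) m" for k
      using binomial_coeff_Vandermonde'[of "of_nat j / of_nat N" "of_int k" "nat m"] m N
      by (simp add: diff_divide_distrib)
    then show ?thesis by simp
  qed simp
  also have "\<dots> = specialize N (restrict_residue N (- int j) A) c q"
    unfolding specialize_restrict_residue[OF N tr] Q_def m_def by (simp add: algebra_simps)
  finally show ?thesis .
qed

end

section \<open>Triple sequences\<close>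

text \<open>Multiplication by \<open>x\<^sub>1 - x\<^sub>2\<close>, \<open>x\<^sub>1 - x\<^sub>3\<close> and \<open>x\<^sub>2 - x\<^sub>3\<close>.\<close>

definition mul12 :: "nat \<Rightarrow> (int \<Rightarrow> int \<Rightarrow> int \<Rightarrow> 'b) \<Rightarrow> int \<Rightarrow> int \<Rightarrow> int \<Rightarrow> 'b::ab_group_add"
  where "mul12 N F = (\<lambda>s p q. F (s - int N) p q - F s (p - int N) q)"

definition mul13 :: "nat \<Rightarrow> (int \<Rightarrow> int \<Rightarrow> int \<Rightarrow> 'b) \<Rightarrow> int \<Rightarrow> int \<Rightarrow> int \<Rightarrow> 'b::ab_group_add"
  where "mul13 N F = (\<lambda>s p q. F (s - int N) p q - F s p (q - int N))"

definition mul23 :: "nat \<Rightarrow> (int \<Rightarrow> int \<Rightarrow> int \<Rightarrow> 'b) \<Rightarrow> int \<Rightarrow> int \<Rightarrow> int \<Rightarrow> 'b::ab_group_add"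
  where "mul23 N F = (\<lambda>s p q. F s (p - int N) q - F s p (q - int N))"

lemma mul12_funpow: "(mul12 N ^^ k) F s p q = (diffmul N ^^ k) (\<lambda>s p. F s p q) s p"
  by (induction k arbitrary: s p q) (simp_all add: mul12_def diffmul_def)

lemma mul13_funpow: "(mul13 N ^^ k) F s p q = (diffmul N ^^ k) (\<lambda>s q. F s p q) s q"
  by (induction k arbitrary: s p q) (simp_all add: mul13_def diffmul_def)

lemma mul23_funpow: "(mul23 N ^^ k) F s p q = (diffmul N ^^ k) (\<lambda>p q. F s p q) p q"
  by (induction k arbitrary: s p q) (simp_all add: mul23_def diffmul_def)

lemma mul12_mul13: "(mul12 N ^^ j) ((mul13 N ^^ k) F) = (mul13 N ^^ k) ((mul12 N ^^ j) F)"
proof -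
  have "mul12 N (mul13 N G) = mul13 N (mul12 N G)" for G :: "int \<Rightarrow> int \<Rightarrow> int \<Rightarrow> 'a"
    by (simp add: mul12_def mul13_def fun_eq_iff)
  then have "mul13 N ((mul12 N ^^ j) G) = (mul12 N ^^ j) (mul13 N G)" for G :: "int \<Rightarrow> int \<Rightarrow> int \<Rightarrow> 'a"
    by (rule funpow_commute[where R = "mul13 N", OF sym])
  then show ?thesis
    by (rule funpow_commute[where R = "(mul12 N ^^ j)", OF sym])
qed

lemma mul12_mul23: "(mul12 N ^^ j) ((mul23 N ^^ k) F) = (mul23 N ^^ k) ((mul12 N ^^ j) F)"
proof -
  have "mul12 N (mul23 N G) = mul23 N (mul12 N G)" for G :: "int \<Rightarrow> int \<Rightarrow> int \<Rightarrow> 'a"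
    by (simp add: mul12_def mul23_def fun_eq_iff)
  then have "mul23 N ((mul12 N ^^ j) G) = (mul12 N ^^ j) (mul23 N G)" for G :: "int \<Rightarrow> int \<Rightarrow> int \<Rightarrow> 'a"
    by (rule funpow_commute[where R = "mul23 N", OF sym])
  then show ?thesis
    by (rule funpow_commute[where R = "(mul12 N ^^ j)", OF sym])
qed

lemma mul13_mul23: "(mul13 N ^^ j) ((mul23 N ^^ k) F) = (mul23 N ^^ k) ((mul13 N ^^ j) F)"
proof -
  have "mul13 N (mul23 N G) = mul23 N (mul13 N G)" for G :: "int \<Rightarrow> int \<Rightarrow> int \<Rightarrow> 'a"
    by (simp add: mul13_def mul23_def fun_eq_iff)
  then have "mul23 N ((mul13 N ^^ j) G) = (mul13 N ^^ j) (mul23 N G)" for G :: "int \<Rightarrow> int \<Rightarrow> int \<Rightarrow> 'a"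
    by (rule funpow_commute[where R = "mul23 N", OF sym])
  then show ?thesis
    by (rule funpow_commute[where R = "(mul13 N ^^ j)", OF sym])
qed

definition clear_poles :: "nat \<Rightarrow> nat \<Rightarrow> (int \<Rightarrow> int \<Rightarrow> int \<Rightarrow> 'b) \<Rightarrow> int \<Rightarrow> int \<Rightarrow> int \<Rightarrow> 'b::ab_group_add"
  where "clear_poles N K F = (mul23 N ^^ K) ((mul12 N ^^ K) ((mul13 N ^^ K) F))"

text \<open>The three multiplications commute; placing one of them innermost allows the locality of
  the corresponding pair of fields to be used first.\<close>

lemma clear_poles_eq:
  shows clear_poles_12: "clear_poles N K F = (mul23 N ^^ K) ((mul13 N ^^ K) ((mul12 N ^^ K) F))"
    and clear_poles_13: "clear_poles N K F = (mul23 N ^^ K) ((mul12 N ^^ K) ((mul13 N ^^ K) F))"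
    and clear_poles_23: "clear_poles N K F = (mul12 N ^^ K) ((mul13 N ^^ K) ((mul23 N ^^ K) F))"
  by (simp_all add: clear_poles_def mul12_mul13 mul12_mul23 mul13_mul23)

lemma clear_poles_cong_12:
  assumes "\<And>q. (diffmul N ^^ K) (\<lambda>s p. F s p q) = (diffmul N ^^ K) (\<lambda>s p. G s p q)"
  shows "clear_poles N K F = clear_poles N K G"
proof -
  have "(mul12 N ^^ K) F = (mul12 N ^^ K) G"
    by (intro ext) (simp add: mul12_funpow assms)
  then show ?thesis by (simp add: clear_poles_12)
qed

lemma clear_poles_cong_13:
  assumes "\<And>p. (diffmul N ^^ K) (\<lambda>s q. F s p q) = (diffmul N ^^ K) (\<lambda>s q. G s p q)"
  shows "clear_poles N K F = clear_poles N K G"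
proof -
  have "(mul13 N ^^ K) F = (mul13 N ^^ K) G"
    by (intro ext) (simp add: mul13_funpow assms)
  then show ?thesis by (simp add: clear_poles_13)
qed

lemma clear_poles_cong_23:
  assumes "\<And>s. (diffmul N ^^ K) (\<lambda>p q. F s p q) = (diffmul N ^^ K) (\<lambda>p q. G s p q)"
  shows "clear_poles N K F = clear_poles N K G"
proof -
  have "(mul23 N ^^ K) F = (mul23 N ^^ K) G"
    by (intro ext) (simp add: mul23_funpow assms)
  then show ?thesis by (simp add: clear_poles_23)
qed

lemma clear_poles_left_zero:
  assumes "\<And>s p q. s < L \<Longrightarrow> F s p q = 0" and "s < L"
  shows "clear_poles N K F s p q = 0"
proof -
  have 1: "(mul13 N ^^ K) F s p q = 0" if "s < L" for s p q
    unfolding mul13_funpow by (rule diffmul_funpow_left_zero[of L]) (simp_all add: assms(1) that)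
  have "(mul12 N ^^ K) ((mul13 N ^^ K) F) s p q = 0" for p q
    unfolding mul12_funpow by (rule diffmul_funpow_left_zero[of L]) (simp_all add: 1 assms(2))
  then have "(mul12 N ^^ K) ((mul13 N ^^ K) F) s = (\<lambda>p q. 0)"
    by (intro ext)
  then show ?thesis
    unfolding clear_poles_def mul23_funpow by simp
qed

lemma clear_poles_middle_zero:
  assumes "\<And>s p q. p < L \<Longrightarrow> F s p q = 0" and "p < L"
  shows "clear_poles N K F s p q = 0"
proof -
  have 1: "(mul13 N ^^ K) F s p q = 0" if "p < L" for s p q
    unfolding mul13_funpow assms(1)[OF that] by simp
  have 2: "(mul12 N ^^ K) ((mul13 N ^^ K) F) s p q = 0" if "p < L" for s p q
    unfolding mul12_funpow by (rule diffmul_funpow_right_zero[of L]) (simp_all add: 1 that)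
  show ?thesis
    unfolding clear_poles_def mul23_funpow
    by (rule diffmul_funpow_left_zero[of L]) (simp_all add: 2 assms(2))
qed

lemma clear_poles_right_zero:
  assumes "\<And>s p q. q < L \<Longrightarrow> F s p q = 0" and "q < L"
  shows "clear_poles N K F s p q = 0"
proof -
  have 1: "(mul13 N ^^ K) F s p q = 0" if "q < L" for s p q
    unfolding mul13_funpow by (rule diffmul_funpow_right_zero[of L]) (simp_all add: assms(1) that)
  have 2: "(mul12 N ^^ K) ((mul13 N ^^ K) F) s p q = 0" if "q < L" for s p q
    unfolding mul12_funpow 1[OF that] by simp
  show ?thesis
    unfolding clear_poles_def mul23_funpow
    by (rule diffmul_funpow_right_zero[of L]) (simp_all add: 2 assms(2))
qed

text \<open>Exchanging the first two variables negates x1 - x2 and interchanges the other two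
  differences, hence the sign (-1)^K.\<close>

lemma clear_poles_swap:
  "clear_poles N K (\<lambda>p s q. F s p q) = (\<lambda>p s q. if even K then clear_poles N K F s p q else - clear_poles N K F s p q)"
proof -
  define sw where "sw G = (\<lambda>p s q. G s p q)" for G :: "int \<Rightarrow> int \<Rightarrow> int \<Rightarrow> 'a"
  have m12: "(mul12 N ^^ k) (sw G) = (if even k then sw ((mul12 N ^^ k) G) else - sw ((mul12 N ^^ k) G))" for G k
    by (induction k) (auto simp: mul12_def fun_eq_iff sw_def)
  have m13: "(mul13 N ^^ k) (sw G) = sw ((mul23 N ^^ k) G)" for G k
    by (induction k) (simp_all add: mul13_def mul23_def sw_def)
  have m23: "(mul23 N ^^ k) (sw G) = sw ((mul13 N ^^ k) G)" for G k
    by (induction k) (simp_all add: mul13_def mul23_def sw_def)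
  have u: "(mul23 N ^^ k) (- G) = - (mul23 N ^^ k) G" for G :: "int \<Rightarrow> int \<Rightarrow> int \<Rightarrow> 'a" and k
    by (induction k) (simp_all add: mul23_def fun_eq_iff)
  have e: "(mul13 N ^^ K) ((mul12 N ^^ K) ((mul23 N ^^ K) F)) = clear_poles N K F"
    by (simp add: clear_poles_def mul12_mul13 mul12_mul23 mul13_mul23)
  have "clear_poles N K (sw F) = (if even K then sw (clear_poles N K F) else - sw (clear_poles N K F))"
    unfolding clear_poles_def[of N K "sw F"] m13 m12
    by (cases "even K") (simp_all add: u m23 e)
  then show ?thesis
    unfolding sw_def by (auto simp: fun_eq_iff)
qed

definition truncated3 :: "(int \<Rightarrow> int \<Rightarrow> int \<Rightarrow> 'b::zero) \<Rightarrow> bool"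
  where "truncated3 P \<longleftrightarrow> (\<exists>L. \<forall>s p q. s < L \<or> p < L \<or> q < L \<longrightarrow> P s p q = 0)"

lemma truncated3_box:
  assumes "truncated3 P"
  shows "\<exists>S. finite S \<and> (\<forall>s p. s \<notin> S \<or> p \<notin> S \<longrightarrow> P s p (c - s - p) = 0)"
proof -
  obtain L where "\<forall>s p q. s < L \<or> p < L \<or> q < L \<longrightarrow> P s p q = 0"
    using assms by (auto simp: truncated3_def)
  then have "P s p (c - s - p) = 0" if "s \<notin> {L..c - 2 * L} \<or> p \<notin> {L..c - 2 * L}" for s p
    using that by (cases "s < L \<or> p < L \<or> c - s - p < L") auto
  then show ?thesis by blast
qed

text \<open>With \<open>Z\<close> the shift of the index, the last assumption reads \<open>(E - Z)\<^sup>K H = 0\<close>.\<close>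

lemma shift_nilpotent:
  fixes E :: "'h::ab_group_add \<Rightarrow> 'h" and H :: "int \<Rightarrow> 'h"
  assumes E: "\<And>x y. E (x - y) = E x - E y"
    and "\<And>n. n < n0 \<Longrightarrow> H n = 0"
    and "((\<lambda>G n. E (G n) - G (n - 1)) ^^ K) H = (\<lambda>n. 0)"
  shows "(E ^^ (K + nat (n - n0))) (H n) = 0"
proof -
  have E0: "E 0 = 0" using E[of 0 0] by simp
  then have E0': "(E ^^ k) 0 = 0" for k by (induction k) simp_all
  have Em: "(E ^^ k) (x - y) = (E ^^ k) x - (E ^^ k) y" for k x y
    by (induction k) (simp_all add: E)
  show ?thesis
    using assms(2,3)
  proof (induction K arbitrary: H n)
    case 0
    then show ?case by (simp add: E0')
  next
    case (Suc K)
    define H' where "H' n = E (H n) - H (n - 1)" for n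
    have "H' n = 0" if "n < n0" for n
      using that Suc.prems(1) by (simp add: H'_def E0)
    moreover have "((\<lambda>G n. E (G n) - G (n - 1)) ^^ K) H' = (\<lambda>n. 0)"
      using Suc.prems(2) unfolding funpow_Suc_right by (simp add: H'_def[abs_def])
    ultimately have "(E ^^ (K + nat (n - n0))) (H' n) = 0" for n
      by (rule Suc.IH)
    \<comment> \<open>\<open>H'\<close> is the image of \<open>H\<close> under E - Z, so its
      vanishing trades one power of E for one step down in the index. Starting at n0, the step
      reaches the range where \<open>H\<close> is zero.\<close>
    then have rec: "(E ^^ (Suc K + nat (n - n0))) (H n) = (E ^^ (K + nat (n - n0))) (H (n - 1))" for n
      by (simp add: H'_def Em funpow_swap1)
    show ?case
    proof (cases "n < n0")
      case True
      then show ?thesis by (simp add: Suc.prems(1) E0' E0)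
    next
      case False
      then have "n0 \<le> n" by simp
      then show ?thesis
      proof (induction n rule: int_ge_induct)
        case base
        show ?case unfolding rec by (simp add: Suc.prems(1) E0')
      next
        case (step n)
        have "K + nat (n + 1 - n0) = Suc K + nat (n - n0)" using step.hyps by simp
        then show ?case using step.IH rec[of "n + 1"] by simp
      qed
    qed
  qed
qed

text \<open>Multiplication by \<open>z\<^sub>0 + z\<^sub>2\<close>.\<close>

definition addmul :: "(int \<Rightarrow> int \<Rightarrow> 'b) \<Rightarrow> int \<Rightarrow> int \<Rightarrow> 'b::ab_group_add"
  where "addmul X = (\<lambda>c d. X c (d - 1) + X (c - 1) d)"

text \<open>Below a lowest power of z0 everything is zero, and the coefficient at each next power of
  z0 is determined by the previous one because z2 is invertible. Without such a bound the sum of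
  (-1)^n z0^n z2^(-n-1) over all integers n would be in the kernel.\<close>

lemma addmul_inj:
  assumes "\<And>c d. c < n0 \<Longrightarrow> X c d = 0" "\<And>c d. c < n0 \<Longrightarrow> Y c d = 0"
    and "(addmul ^^ K) X = (addmul ^^ K) Y"
  shows "X = Y"
  using assms
proof (induction K arbitrary: X Y)
  case (Suc K)
  have "addmul X = addmul Y"
    by (rule Suc.IH) (use Suc.prems in \<open>auto simp: addmul_def funpow_Suc_right simp del: funpow.simps\<close>)
  then have rec: "X c (d - 1) + X (c - 1) d = Y c (d - 1) + Y (c - 1) d" for c d
    by (simp add: addmul_def fun_eq_iff)
  have "\<forall>d. X c d = Y c d" for c
  proof (cases "c < n0")
    case False
    then have "n0 - 1 \<le> c" by simp
    then show ?thesis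
    proof (induction c rule: int_ge_induct)
      case base
      then show ?case by (simp add: Suc.prems)
    next
      case (step c)
      show ?case
      proof
        fix d
        show "X (c + 1) d = Y (c + 1) d"
          using rec[of "c + 1" "d + 1"] step.IH by simp
      qed
    qed
  qed (simp add: Suc.prems)
  then show ?case by (simp add: fun_eq_iff)
qed simp

lemma addmul_funpow_shift:
  "(addmul ^^ k) (\<lambda>c d. X (c - i) (d - j)) = (\<lambda>c d. (addmul ^^ k) X (c - i) (d - j))"
  by (induction k) (simp_all add: addmul_def algebra_simps)

lemma diffmul_funpow_swap:
  "(diffmul N ^^ k) (\<lambda>p q. F q p) = (\<lambda>p q. if even k then (diffmul N ^^ k) F q p else - (diffmul N ^^ k) F q p)"
  by (induction k) (auto simp: diffmul_def fun_eq_iff)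

text \<open>The order K is explicit because Dong's lemma and the choice of a common clearing power
  have to track it; \<open>a\<close> and \<open>b\<close> stand for single toroidal
  components.\<close>

definition local_order :: "nat \<Rightarrow> nat \<Rightarrow> (int \<Rightarrow> 'b \<Rightarrow> 'b) \<Rightarrow> (int \<Rightarrow> 'b \<Rightarrow> 'b::ab_group_add) \<Rightarrow> bool"
  where "local_order N K a b \<longleftrightarrow>
    (\<forall>w. (diffmul N ^^ K) (\<lambda>p q. a p (b q w)) = (diffmul N ^^ K) (\<lambda>p q. b q (a p w)))"

lemma local_order_sym:
  assumes "local_order N K a b"
  shows "local_order N K b a"
  unfolding local_order_def
proof
  fix w
  have eq: "(diffmul N ^^ K) (\<lambda>p q. a p (b q w)) = (diffmul N ^^ K) (\<lambda>p q. b q (a p w))"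
    using assms by (auto simp: local_order_def)
  show "(diffmul N ^^ K) (\<lambda>p q. b p (a q w)) = (diffmul N ^^ K) (\<lambda>p q. a q (b p w))"
    using diffmul_funpow_swap[of K N "\<lambda>p q. a p (b q w)"] diffmul_funpow_swap[of K N "\<lambda>p q. b q (a p w)"]
    by (simp only: eq)
qed

lemma local_order_mono:
  assumes "local_order N K a b" "K \<le> M"
  shows "local_order N M a b"
proof -
  have "(diffmul N ^^ M) F = (diffmul N ^^ (M - K)) ((diffmul N ^^ K) F)" for F :: "int \<Rightarrow> int \<Rightarrow> 'a"
    using assms(2) by (simp flip: diffmul_funpow_add)
  with assms(1) show ?thesis by (simp add: local_order_def)
qed

section \<open>One-variable fields, their products and Dong's lemma\<close>

context complex_vector_space
begin

lemma specialize_diffmul_funpow: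
  assumes "N > 0" "regular N F"
  shows "specialize N ((diffmul N ^^ k) F) c q = specialize N F (c - int k) q"
proof (induction k arbitrary: c)
  case (Suc k)
  have "regular N ((diffmul N ^^ k) F)"
    by (rule funpow_invariant[where P = "regular N"]) (simp_all add: regular_diffmul assms)
  then show ?case
    using Suc by (simp add: specialize_diffmul assms algebra_simps)
qed simp

definition is_field :: "(int \<Rightarrow> 'w \<Rightarrow> 'w) \<Rightarrow> bool"
  where "is_field a \<longleftrightarrow> (\<forall>n x y. a n (x + y) = a n x + a n y) \<and>
    (\<forall>n c x. a n (scale c x) = scale c (a n x)) \<and> (\<forall>w. \<exists>L. \<forall>n<L. a n w = 0)"

lemma is_field_add: "is_field a \<Longrightarrow> a n (x + y) = a n x + a n y"
  by (simp add: is_field_def)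

lemma is_field_scale: "is_field a \<Longrightarrow> a n (scale c x) = scale c (a n x)"
  by (simp add: is_field_def)

lemma is_field_bound: "is_field a \<Longrightarrow> \<exists>L. \<forall>n<L. a n w = 0"
  by (simp add: is_field_def)

lemma is_field_0 [simp]: "is_field a \<Longrightarrow> a n 0 = 0"
  using is_field_scale[of a n 0 0] by simp

lemma is_field_diff: "is_field a \<Longrightarrow> a n (x - y) = a n x - a n y"
  using is_field_add[of a n "x - y" y] by (simp add: algebra_simps)

definition nth_product :: "nat \<Rightarrow> (int \<Rightarrow> 'w \<Rightarrow> 'w) \<Rightarrow> int \<Rightarrow> (int \<Rightarrow> 'w \<Rightarrow> 'w) \<Rightarrow> int \<Rightarrow> 'w \<Rightarrow> 'w"
  where "nth_product N a c b q w = specialize N (\<lambda>p q. a p (b q w)) c q"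

lemma product_truncated:
  assumes a: "is_field a" and b: "is_field b" and loc: "local_order N K a b"
  shows "truncated ((diffmul N ^^ K) (\<lambda>p q. a p (b q w)))"
proof -
  obtain L where L: "\<forall>n<L. a n w = 0" using is_field_bound[OF a] by blast
  obtain L' where L': "\<forall>n<L'. b n w = 0" using is_field_bound[OF b] by blast
  show ?thesis
    by (rule local_truncated[of L' _ L "\<lambda>p q. b q (a p w)"])
      (use L L' a b loc in \<open>auto simp: local_order_def\<close>)
qed

lemma product_regular:
  "is_field a \<Longrightarrow> is_field b \<Longrightarrow> local_order N K a b \<Longrightarrow> regular N (\<lambda>p q. a p (b q w))"
  by (rule regularI) (rule product_truncated)

lemma nth_product_below:
  assumes "N > 0" "is_field a" "is_field b" "local_order N K a b" "c < - int K"
  shows "nth_product N a c b q w = 0"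
  unfolding nth_product_def using assms by (intro specialize_below product_truncated)

text \<open>The bound depends on the fields only through K, L and L', which yields truncation
  uniform in the toroidal exponents. For p < L the opposite order of the factors shows the
  vanishing; for p >= L the other exponent falls below L'.\<close>

lemma nth_product_zero:
  assumes N: "N > 0" and a: "is_field a" and b: "is_field b" and loc: "local_order N K a b"
    and L: "\<And>p. p < L \<Longrightarrow> a p w = 0" and L': "\<And>q. q < L' \<Longrightarrow> b q w = 0"
    and q: "q < L + L' - int N * (c + int K)"
  shows "nth_product N a c b q w = 0"
proof -
  let ?F = "\<lambda>p q. a p (b q w)"
  have loc': "(diffmul N ^^ K) ?F = (diffmul N ^^ K) (\<lambda>p q. b q (a p w))"
    using loc by (auto simp: local_order_def)
  have "(diffmul N ^^ K) ?F p (q - p + int N * (c + int K)) = 0" for p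
  proof (cases "p < L")
    case True
    then show ?thesis
      unfolding loc' by (rule diffmul_funpow_left_zero[rotated]) (simp add: L b)
  next
    case False
    then have "q - p + int N * (c + int K) < L'" using q by simp
    then show ?thesis
      by (rule diffmul_funpow_right_zero[rotated]) (simp add: L' a)
  qed
  then show ?thesis
    unfolding nth_product_def specialize_eq[OF N product_truncated[OF a b loc]] substitute_def by simp
qed

lemma is_field_nth_product:
  assumes N: "N > 0" and a: "is_field a" and b: "is_field b" and loc: "local_order N K a b"
  shows "is_field (nth_product N a c b)"
  unfolding is_field_def
proof (intro conjI allI)
  note reg = product_regular[OF a b loc]
  fix n x y d
  show "nth_product N a c b n (x + y) = nth_product N a c b n x + nth_product N a c b n y"
    unfolding nth_product_def is_field_add[OF a] is_field_add[OF b] by (rule specialize_add[OF N reg reg])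
  show "nth_product N a c b n (scale d x) = scale d (nth_product N a c b n x)"
    unfolding nth_product_def is_field_scale[OF a] is_field_scale[OF b] by (rule specialize_scale[OF N reg])
next
  fix w
  obtain L where L: "\<forall>n<L. a n w = 0" using is_field_bound[OF a] by blast
  obtain L' where L': "\<forall>n<L'. b n w = 0" using is_field_bound[OF b] by blast
  show "\<exists>L. \<forall>n<L. nth_product N a c b n w = 0"
    by (intro exI allI impI nth_product_zero[OF N a b loc, of L _ L']) (use L L' in auto)
qed

text \<open>Substituting \<open>x\<^sub>2 = x\<^sub>3 + z\<^sub>2\<close>; the remaining indices are those of \<open>z\<^sub>2, x\<^sub>1, x\<^sub>3\<close>.\<close>

definition specialize23 :: "nat \<Rightarrow> (int \<Rightarrow> int \<Rightarrow> int \<Rightarrow> 'w) \<Rightarrow> int \<Rightarrow> int \<Rightarrow> int \<Rightarrow> 'w"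
  where "specialize23 N F n = (\<lambda>s q. specialize N (F s) n q)"

lemma regular_mul13: "(\<And>s. regular N (F s)) \<Longrightarrow> regular N (mul13 N F s)"
  unfolding mul13_def using regular_minus[of N "F (s - int N)" "\<lambda>p q. F s p (q - int N)"]
    regular_shift[of N "F s" 0 "int N"] by simp

lemma regular_mul12: "(\<And>s. regular N (F s)) \<Longrightarrow> regular N (mul12 N F s)"
  unfolding mul12_def using regular_minus[of N "F (s - int N)" "\<lambda>p q. F s (p - int N) q"]
    regular_shift[of N "F s" "int N" 0] by simp

lemma specialize23_mul13:
  assumes "N > 0" "\<And>s. regular N (F s)"
  shows "specialize23 N (mul13 N F) = (\<lambda>n. diffmul N (specialize23 N F n))"
proof (intro ext)
  fix n s q
  have "regular N (\<lambda>p q. F s p (q - int N))"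
    using regular_shift[OF assms(2), where c = 0 and d = "int N"] by simp
  then show "specialize23 N (mul13 N F) n s q = diffmul N (specialize23 N F n) s q"
    using assms by (simp add: specialize23_def mul13_def diffmul_def specialize_minus specialize_shift_right)
qed

text \<open>After x2 = x3 + z2 the factor x1 - x2 is (x1 - x3) - z2, the operator E - Z of
  \<open>shift_nilpotent\<close>.\<close>

lemma specialize23_mul12:
  assumes "N > 0" "\<And>s. regular N (F s)"
  shows "specialize23 N (mul12 N F) = (\<lambda>n. diffmul N (specialize23 N F n) - specialize23 N F (n - 1))"
proof (intro ext)
  fix n s q
  have "regular N (\<lambda>p q. F s (p - int N) q)"
    using regular_shift[OF assms(2), where c = "int N" and d = 0] by simp
  then show "specialize23 N (mul12 N F) n s q = (diffmul N (specialize23 N F n) - specialize23 N F (n - 1)) s q"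
    using assms by (simp add: specialize23_def mul12_def diffmul_def specialize_minus specialize_shift_left)
qed

lemma specialize23_mul_funpow:
  assumes N: "N > 0" and F: "\<And>s. regular N (F s)"
  shows "specialize23 N ((mul12 N ^^ K) ((mul13 N ^^ M) F)) =
      ((\<lambda>H n. diffmul N (H n) - H (n - 1)) ^^ K) (((\<lambda>H n. diffmul N (H n)) ^^ M) (specialize23 N F))"
    and "regular N ((mul12 N ^^ K) ((mul13 N ^^ M) F) s)"
proof -
  let ?P = "\<lambda>F. \<forall>s. regular N (F s)"
  have 13: "?P ((mul13 N ^^ M) F)"
    by (rule funpow_invariant[where P = ?P]) (simp_all add: regular_mul13 F)
  have "?P ((mul12 N ^^ K) ((mul13 N ^^ M) F))"
    by (rule funpow_invariant[where P = ?P]) (simp_all add: regular_mul12 13)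
  then show "regular N ((mul12 N ^^ K) ((mul13 N ^^ M) F) s)" by simp
  have "specialize23 N ((mul13 N ^^ M) F) = ((\<lambda>H n. diffmul N (H n)) ^^ M) (specialize23 N F)"
    by (rule funpow_intertwine[where P = ?P]) (simp_all add: regular_mul13 specialize23_mul13 N F)
  moreover have "specialize23 N ((mul12 N ^^ K) ((mul13 N ^^ M) F)) =
      ((\<lambda>H n. diffmul N (H n) - H (n - 1)) ^^ K) (specialize23 N ((mul13 N ^^ M) F))"
    by (rule funpow_intertwine[where P = ?P]) (simp_all add: regular_mul12 specialize23_mul12 N 13)
  ultimately show "specialize23 N ((mul12 N ^^ K) ((mul13 N ^^ M) F)) =
      ((\<lambda>H n. diffmul N (H n) - H (n - 1)) ^^ K) (((\<lambda>H n. diffmul N (H n)) ^^ M) (specialize23 N F))"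
    by simp
qed

lemma specialize23_field:
  assumes "N > 0" "is_field u" "is_field v" "is_field w" "local_order N K v w"
  shows "specialize23 N (\<lambda>s p q. u s (v p (w q \<omega>))) c = (\<lambda>s q. u s (nth_product N v c w q \<omega>))"
    and "regular N (\<lambda>p q. u s (v p (w q \<omega>)))"
  using specialize_linear_image[OF assms(1) product_regular[OF assms(3-5)], of "u _" \<omega>]
  by (simp_all add: specialize23_def nth_product_def is_field_add is_field_scale assms)

text \<open>Dong's lemma. The commutator of c(x1) with a(x2) b(x3) is annihilated by (x1 - x2)^K (x1
  - x3)^K, and x2 = x3 + z2 makes this ((x1 - x3) - z2)^K (x1 - x3)^K. As powers of z2 below -K are
  absent, \<open>shift_nilpotent\<close> trades it for a power of x1 - x3 alone.\<close>

theorem local_order_nth_product: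
  assumes N: "N > 0" and a: "is_field a" and b: "is_field b" and c: "is_field c"
    and ab: "local_order N K a b" and ca: "local_order N K c a" and cb: "local_order N K c b"
  shows "local_order N (2 * K + nat (n + int K)) c (nth_product N a n b)"
  unfolding local_order_def
proof
  fix w
  define G1 where "G1 = (\<lambda>s p q. c s (a p (b q w)))"
  define G2 where "G2 = (\<lambda>s p q. a p (b q (c s w)))"
  define G where "G = (\<lambda>s p q. G1 s p q - G2 s p q)"
  have reg1: "regular N (G1 s)" for s
    unfolding G1_def by (rule specialize23_field(2)[OF N c a b ab])
  have reg2: "regular N (G2 s)" for s
    unfolding G2_def by (rule product_regular[OF a b ab])
  have reg: "regular N (G s)" for s
    unfolding G_def by (rule regular_minus[OF reg1 reg2])
  have H: "specialize23 N G m = (\<lambda>s q. c s (nth_product N a m b q w) - nth_product N a m b q (c s w))" for m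
  proof -
    have "specialize23 N G m = (\<lambda>s q. specialize23 N G1 m s q - specialize23 N G2 m s q)"
      unfolding specialize23_def G_def by (intro ext) (simp add: specialize_minus[OF N reg1 reg2])
    also have "specialize23 N G1 m = (\<lambda>s q. c s (nth_product N a m b q w))"
      unfolding G1_def by (rule specialize23_field(1)[OF N c a b ab])
    also have "specialize23 N G2 m = (\<lambda>s q. nth_product N a m b q (c s w))"
      by (simp add: specialize23_def G2_def nth_product_def)
    finally show ?thesis .
  qed
  have "(mul12 N ^^ K) ((mul13 N ^^ K) G) = (\<lambda>s p q. 0)"
  proof -
    \<comment> \<open>The derivation rule [c, ab] = [c, a] b + a [c, b]: the first part is killed by
      (x1 - x2)^K, the second by (x1 - x3)^K.\<close>
    define D1 where "D1 = (\<lambda>s p q. c s (a p (b q w)) - a p (c s (b q w)))"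
    define D2 where "D2 = (\<lambda>s p q. a p (c s (b q w) - b q (c s w)))"
    have G12: "G = (\<lambda>s p q. D1 s p q + D2 s p q)"
      by (simp add: G_def G1_def G2_def D1_def D2_def is_field_diff[OF a])
    have add: "(mul12 N ^^ k) (\<lambda>s p q. X s p q + Y s p q) = (\<lambda>s p q. (mul12 N ^^ k) X s p q + (mul12 N ^^ k) Y s p q)"
      "(mul13 N ^^ k) (\<lambda>s p q. X s p q + Y s p q) = (\<lambda>s p q. (mul13 N ^^ k) X s p q + (mul13 N ^^ k) Y s p q)"
      for X Y :: "int \<Rightarrow> int \<Rightarrow> int \<Rightarrow> 'w" and k
      by (induction k) (simp_all add: mul12_def mul13_def fun_eq_iff)
    have z: "(mul12 N ^^ k) (\<lambda>s p q. 0) = (\<lambda>s p q. 0 :: 'w)" "(mul13 N ^^ k) (\<lambda>s p q. 0) = (\<lambda>s p q. 0 :: 'w)" for k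
      by (induction k) (simp_all add: mul12_def mul13_def)
    have D1: "(mul12 N ^^ K) D1 = (\<lambda>s p q. 0)"
      using ca by (simp add: fun_eq_iff mul12_funpow D1_def diffmul_funpow_minus local_order_def)
    have D2: "(mul13 N ^^ K) D2 = (\<lambda>s p q. 0)"
    proof (intro ext)
      fix s p q
      have "(diffmul N ^^ K) (\<lambda>s q. a p (c s (b q w) - b q (c s w))) =
          (\<lambda>s q. a p ((diffmul N ^^ K) (\<lambda>s q. c s (b q w) - b q (c s w)) s q))"
        by (rule diffmul_funpow_additive) (rule is_field_diff[OF a])
      then show "(mul13 N ^^ K) D2 s p q = 0"
        using cb a by (simp add: mul13_funpow D2_def diffmul_funpow_minus local_order_def)
    qed
    have "(mul12 N ^^ K) ((mul13 N ^^ K) D1) = (\<lambda>s p q. 0)"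
      by (simp add: mul12_mul13 D1 z)
    then show ?thesis by (simp add: G12 add D2 z)
  qed
  then have "((\<lambda>H n. diffmul N (H n) - H (n - 1)) ^^ K) (((\<lambda>H n. diffmul N (H n)) ^^ K) (specialize23 N G)) =
      specialize23 N (\<lambda>s p q. 0)"
    using specialize23_mul_funpow(1)[OF N, of G K K, OF reg] by simp
  also have "specialize23 N (\<lambda>s p q. 0) = (\<lambda>n. 0)"
    by (simp add: specialize23_def specialize_truncated[OF N] truncated_def substitute_def fun_eq_iff)
  also have "((\<lambda>H n. diffmul N (H n)) ^^ K) (specialize23 N G) = (\<lambda>n. (diffmul N ^^ K) (specialize23 N G n))"
    by (induction K) simp_all
  finally have nil: "((\<lambda>H n. diffmul N (H n) - H (n - 1)) ^^ K) (\<lambda>n. (diffmul N ^^ K) (specialize23 N G n)) = (\<lambda>n. 0)" .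
  have low: "(diffmul N ^^ K) (specialize23 N G m) = 0" if "m < - int K" for m
    using that by (simp add: H nth_product_below[OF N a b ab] c zero_fun_def)
  have dm: "diffmul N (X - Y) = diffmul N X - diffmul N Y" for X Y :: "int \<Rightarrow> int \<Rightarrow> 'w"
    by (simp add: diffmul_def fun_eq_iff)
  \<comment> \<open>\<open>shift_nilpotent\<close> with n0 = - K costs K + nat (n + K) factors; K
    further factors x1 - x3 were already present.\<close>
  have "(diffmul N ^^ (K + nat (n - (- int K)))) ((diffmul N ^^ K) (specialize23 N G n)) = 0"
    by (rule shift_nilpotent[OF dm low nil])
  then have "(diffmul N ^^ (2 * K + nat (n + int K))) (specialize23 N G n) = 0"
    by (simp add: mult_2 add_ac flip: diffmul_funpow_add)
  then show "(diffmul N ^^ (2 * K + nat (n + int K))) (\<lambda>p q. c p (nth_product N a n b q w)) =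
      (diffmul N ^^ (2 * K + nat (n + int K))) (\<lambda>p q. nth_product N a n b q (c p w))"
    unfolding H diffmul_funpow_minus by (simp add: fun_eq_iff)
qed

section \<open>Simultaneous substitution x1 = x3 + z1, x2 = x3 + z2\<close>

definition substitute2 :: "nat \<Rightarrow> (int \<Rightarrow> int \<Rightarrow> int \<Rightarrow> 'w) \<Rightarrow> int \<Rightarrow> int \<Rightarrow> int \<Rightarrow> 'w"
  where "substitute2 N P c1 c2 q = substitute N (\<lambda>s q. substitute N (P s) c2 q) c1 q"

lemma substitute2_neg: "c1 < 0 \<or> c2 < 0 \<Longrightarrow> substitute2 N P c1 c2 q = 0"
  by (auto simp: substitute2_def substitute_def)

lemma substitute2_sum:
  assumes "finite S" and "\<And>s p. s \<notin> S \<or> p \<notin> S \<Longrightarrow> P s p (q + int N * (c1 + c2) - s - p) = 0"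
  shows "substitute2 N P c1 c2 q = (\<Sum>s\<in>S. \<Sum>p\<in>S.
    scale (gbin (of_int s / of_nat N) c1 * gbin (of_int p / of_nat N) c2) (P s p (q + int N * (c1 + c2) - s - p)))"
proof -
  have e: "q - s + int N * c1 - p + int N * c2 = q + int N * (c1 + c2) - s - p" for s p
    by (simp add: algebra_simps)
  have inner: "substitute N (P s) c2 (q - s + int N * c1) =
      (\<Sum>p\<in>S. scale (gbin (of_int p / of_nat N) c2) (P s p (q + int N * (c1 + c2) - s - p)))" for s
    unfolding substitute_def e by (rule Sum_any_on[OF assms(1)]) (simp add: assms(2))
  have "substitute2 N P c1 c2 q = (\<Sum>s\<in>S. scale (gbin (of_int s / of_nat N) c1)
      (\<Sum>p\<in>S. scale (gbin (of_int p / of_nat N) c2) (P s p (q + int N * (c1 + c2) - s - p))))"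
    unfolding substitute2_def substitute_def[of N _ c1] inner
    by (rule Sum_any_on[OF assms(1)]) (simp add: assms(2))
  then show ?thesis by (simp add: scale_sum_right)
qed

lemma substitute2_swap:
  assumes "truncated3 P"
  shows "substitute2 N (\<lambda>p s q. P s p q) c2 c1 q = substitute2 N P c1 c2 q"
proof -
  obtain S where S: "finite S"
    "\<And>s p. s \<notin> S \<or> p \<notin> S \<Longrightarrow> P s p (q + int N * (c1 + c2) - s - p) = 0"
    using truncated3_box[OF assms] by metis
  have e: "q + int N * (c2 + c1) - p - s = q + int N * (c1 + c2) - s - p" for s p
    by (simp add: algebra_simps)
  have S': "p \<notin> S \<or> s \<notin> S \<Longrightarrow> P s p (q + int N * (c2 + c1) - p - s) = 0" for s p
    unfolding e using S(2)[of s p] by blast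
  have "substitute2 N (\<lambda>p s q. P s p q) c2 c1 q = (\<Sum>p\<in>S. \<Sum>s\<in>S.
      scale (gbin (of_int p / of_nat N) c2 * gbin (of_int s / of_nat N) c1) (P s p (q + int N * (c2 + c1) - p - s)))"
    by (rule substitute2_sum[OF S(1)]) (rule S')
  also have "\<dots> = (\<Sum>s\<in>S. \<Sum>p\<in>S.
      scale (gbin (of_int s / of_nat N) c1 * gbin (of_int p / of_nat N) c2) (P s p (q + int N * (c1 + c2) - s - p)))"
    by (subst sum.swap) (simp only: e mult.commute)
  also have "\<dots> = substitute2 N P c1 c2 q"
    by (rule substitute2_sum[symmetric, OF S(1)]) (rule S(2))
  finally show ?thesis .
qed

lemma substitute2_uminus: "substitute2 N (\<lambda>s p q. - P s p q) c1 c2 q = - substitute2 N P c1 c2 q"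
  unfolding substitute2_def substitute_def by (simp add: Sum_any.expand_set sum_negf)

section \<open>Truncation in three variables and associativity of substitution\<close>

lemma truncated3_inner:
  assumes "truncated3 P"
  shows "truncated (P s)"
  using assms unfolding truncated3_def truncated_def by blast

lemma truncated3_substitute:
  assumes "truncated3 P"
  shows "truncated (\<lambda>s q. substitute N (P s) c q)"
proof -
  obtain L where L: "\<forall>s p q. s < L \<or> p < L \<or> q < L \<longrightarrow> P s p q = 0"
    using assms by (auto simp: truncated3_def)
  have "P s p (q - p + int N * c) = 0" if "q < 2 * L - int N * c" for s p q
    using L that by (cases "p < L") auto
  then show ?thesis
    using L by (intro truncatedI[of L _ "2 * L - int N * c"]) (auto simp: substitute_def)
qed

text \<open>
  Associativity of substitution: \<open>x\<^sub>1 = y + z\<^sub>1, x\<^sub>2 = y + z\<^sub>2\<close> followed by \<open>z\<^sub>1 = z\<^sub>2 + z\<^sub>0\<close> agrees with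
  \<open>x\<^sub>1 = x\<^sub>2 + z\<^sub>0\<close> followed by \<open>x\<^sub>2 = y + z\<^sub>2\<close>.
\<close>

lemma substitute_assoc:
  assumes N: "N > 0" and P: "truncated3 P"
  shows "substitute 1 (\<lambda>c1 c2. substitute2 N P c1 c2 q) c0 c2 =
    substitute N (\<lambda>p q. substitute N (\<lambda>s p. P s p q) c0 p) c2 q"
proof -
  define Q where "Q s p = P s p (q + int N * (c0 + c2) - s - p)" for s p
  obtain S where S: "finite S" "\<And>s p. s \<notin> S \<or> p \<notin> S \<Longrightarrow> Q s p = 0"
    using truncated3_box[OF P] unfolding Q_def by metis
  let ?g = "\<lambda>s. gbin (of_int s / of_nat N)"
  have L: "substitute 1 (\<lambda>c1 c2. substitute2 N P c1 c2 q) c0 c2 =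
      (\<Sum>s\<in>S. \<Sum>p\<in>S. scale (\<Sum>i\<le>nat (c0 + c2). gbin (of_nat i) c0 * (?g s (int i) * ?g p (c0 + c2 - int i))) (Q s p))"
  proof -
    have e: "substitute2 N P i (c2 - i + c0) q = (\<Sum>s\<in>S. \<Sum>p\<in>S. scale (?g s i * ?g p (c0 + c2 - i)) (Q s p))" for i
    proof -
      have i: "i + (c2 - i + c0) = c0 + c2" "i + (c0 + c2 - i) = c0 + c2" "c2 - i + c0 = c0 + c2 - i"
        by simp_all
      show ?thesis
        by (subst substitute2_sum[OF S(1)]) (simp_all only: i S(2)[unfolded Q_def] Q_def)
    qed
    have "substitute 1 (\<lambda>c1 c2. substitute2 N P c1 c2 q) c0 c2 =
        Sum_any (\<lambda>i. scale (gbin (of_int i) c0) (substitute2 N P i (c2 - i + c0) q))"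
      by (simp add: substitute_def)
    also have "\<dots> = (\<Sum>i\<in>int ` {..nat (c0 + c2)}. scale (gbin (of_int i) c0) (substitute2 N P i (c2 - i + c0) q))"
    proof (rule Sum_any_on)
      fix i assume i: "i \<notin> int ` {..nat (c0 + c2)}"
      have "i < 0 \<or> c2 - i + c0 < 0"
      proof (rule ccontr)
        assume "\<not> ?thesis"
        then have "i = int (nat i)" "nat i \<le> nat (c0 + c2)" by auto
        with i show False by (metis atMost_iff image_eqI)
      qed
      then show "scale (gbin (of_int i) c0) (substitute2 N P i (c2 - i + c0) q) = 0"
        by (simp add: substitute2_neg)
    qed simp
    also have "\<dots> = (\<Sum>i\<le>nat (c0 + c2). scale (gbin (of_nat i) c0) (substitute2 N P (int i) (c2 - int i + c0) q))"
      by (subst sum.reindex) (simp_all add: o_def)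
    also have "\<dots> = (\<Sum>i\<le>nat (c0 + c2). \<Sum>s\<in>S. \<Sum>p\<in>S.
        scale (gbin (of_nat i) c0 * (?g s (int i) * ?g p (c0 + c2 - int i))) (Q s p))"
      unfolding e by (simp add: scale_sum_right)
    also have "\<dots> = (\<Sum>s\<in>S. \<Sum>p\<in>S. \<Sum>i\<le>nat (c0 + c2).
        scale (gbin (of_nat i) c0 * (?g s (int i) * ?g p (c0 + c2 - int i))) (Q s p))"
      by (subst sum.swap) (subst sum.swap[of _ S "{..nat (c0 + c2)}"], rule refl)
    finally show ?thesis by (simp add: scale_sum_left)
  qed
  have R: "substitute N (\<lambda>p q. substitute N (\<lambda>s p. P s p q) c0 p) c2 q =
      (\<Sum>s\<in>S. \<Sum>p\<in>S. scale (?g s c0 * gbin (of_int s / of_nat N - of_int c0 + of_int p / of_nat N) c2) (Q s p))"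
  proof -
    \<comment> \<open>Here t is the exponent of x2 after x1 = x2 + z0, that is t = p + s - N c0 for
      original exponents s and p; \<open>T\<close> collects the values that can occur.\<close>
    define h where "h s t = scale (?g s c0 * ?g t c2) (Q s (t - s + int N * c0))" for s t
    have PQ: "P s (t - s + int N * c0) (q - t + int N * c2) = Q s (t - s + int N * c0)" for s t
      by (simp add: Q_def algebra_simps)
    define T where "T = (\<lambda>(s, p). p + s - int N * c0) ` (S \<times> S)"
    have T: "finite T" by (simp add: T_def S)
    have h0: "h s t = 0" if "s \<notin> S \<or> t \<notin> T" for s t
    proof (rule ccontr)
      assume "h s t \<noteq> 0"
      then have "s \<in> S" "t - s + int N * c0 \<in> S" using S(2) by (auto simp: h_def)
      then have "t \<in> T" unfolding T_def by (intro image_eqI[of _ _ "(s, t - s + int N * c0)"]) auto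
      with \<open>s \<in> S\<close> that show False by simp
    qed
    have "substitute N (\<lambda>p q. substitute N (\<lambda>s p. P s p q) c0 p) c2 q = Sum_any (\<lambda>t. Sum_any (\<lambda>s. h s t))"
      unfolding substitute_def PQ h_def scale_Sum_any by (simp add: mult.commute)
    also have "\<dots> = (\<Sum>t\<in>T. \<Sum>s\<in>S. h s t)"
    proof -
      have "Sum_any (\<lambda>s. h s t) = (\<Sum>s\<in>S. h s t)" for t
        by (rule Sum_any_on[OF S(1)]) (simp add: h0)
      then show ?thesis by (simp, intro Sum_any_on[OF T]) (simp add: h0)
    qed
    also have "\<dots> = (\<Sum>s\<in>S. \<Sum>t\<in>T. h s t)" by (rule sum.swap)
    also have "\<dots> = (\<Sum>s\<in>S. \<Sum>p\<in>S. h s (p + s - int N * c0))"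
    proof (rule sum.cong)
      fix s
      have "(\<Sum>t\<in>T. h s t) = Sum_any (h s)" by (rule Sum_any_on[OF T, symmetric]) (simp add: h0)
      also have "\<dots> = Sum_any (\<lambda>p. h s (p + s - int N * c0))"
        by (rule Sum_any_reindex) (auto simp: inj_def intro: image_eqI[of _ _ "_ - s + int N * c0"])
      also have "\<dots> = (\<Sum>p\<in>S. h s (p + s - int N * c0))"
        by (rule Sum_any_on[OF S(1)]) (simp add: h_def S(2))
      finally show "(\<Sum>t\<in>T. h s t) = (\<Sum>p\<in>S. h s (p + s - int N * c0))" .
    qed simp
    also have "\<dots> = (\<Sum>s\<in>S. \<Sum>p\<in>S. scale (?g s c0 * gbin (of_int s / of_nat N - of_int c0 + of_int p / of_nat N) c2) (Q s p))"
    proof -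
      have "of_int (p + s - int N * c0) / of_nat N = (of_int s / of_nat N - of_int c0 + of_int p / of_nat N :: complex)" for s p
        using N by (simp add: diff_divide_distrib add_divide_distrib)
      then show ?thesis by (simp add: h_def)
    qed
    finally show ?thesis .
  qed
  have "(\<Sum>i\<le>nat (c0 + c2). gbin (of_nat i) c0 * (?g s (int i) * ?g p (c0 + c2 - int i))) =
      ?g s c0 * gbin (of_int s / of_nat N - of_int c0 + of_int p / of_nat N) c2" for s p
  \<comment> \<open>The trinomial identity covers natural exponents only. For c2 < 0 <= c0 every
    summand vanishes: either i < c0, so binomial(i, c0) = 0, or the lower index c0 + c2 - i is
    negative.\<close>
  proof (cases "c0 < 0 \<or> c2 < 0")
    case True
    show ?thesis
    proof (cases "c0 < 0")
      case False
      with True have c2: "c2 < 0" "c0 \<ge> 0" by simp_all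
      have "(\<Sum>i\<le>nat (c0 + c2). gbin (of_nat i) c0 * (?g s (int i) * ?g p (c0 + c2 - int i))) = 0"
      proof (rule sum.neutral, intro ballI)
        fix i assume "i \<in> {..nat (c0 + c2)}"
        then have "c0 + c2 - int i < 0 \<or> i < nat c0" using c2 by auto
        then show "gbin (of_nat i) c0 * (?g s (int i) * ?g p (c0 + c2 - int i)) = 0"
        proof
          assume "i < nat c0"
          then have "gbin (of_nat i) c0 = 0"
            using c2 by (simp add: gbin_def binomial_eq_0 flip: binomial_gbinomial)
          then show ?thesis by simp
        qed simp
      qed
      then show ?thesis using c2 by simp
    qed simp
  next
    case False
    then obtain m n where "c0 = int m" "c2 = int n"
      by (metis not_less zero_le_imp_eq_int)
    then show ?thesis
      using gbin_trinomial[where m = m and n = n and a = "of_int s / of_nat N" and b = "of_int p / of_nat N"]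
      by (simp add: nat_add_distrib)
  qed
  then show ?thesis by (simp only: L R)
qed

text \<open>With x1 = x3 + z1 the two operators become multiplication by z1 - z2 and by z1.
  Exponents of z1 and z2 are integers, hence the step 1.\<close>

lemma specialize_family_diffmul:
  assumes "N > 0" "\<And>n. regular N (H n)"
  shows "(\<lambda>c1 c2. specialize N (((\<lambda>H n. diffmul N (H n) - H (n - 1)) ^^ K) (((\<lambda>H n. diffmul N (H n)) ^^ M) H) c2) c1 q) =
    (diffmul 1 ^^ K) (\<lambda>c1 c2. specialize N (H c2) (c1 - int M) q)"
proof -
  let ?P = "\<lambda>H. \<forall>n. regular N (H n)"
  let ?R = "\<lambda>H c1 c2. specialize N (H c2) c1 q"
  have M: "((\<lambda>H n. diffmul N (H n)) ^^ M) H = (\<lambda>n. (diffmul N ^^ M) (H n))"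
    by (induction M) simp_all
  have reg: "regular N ((diffmul N ^^ M) (H n))" for n
    by (rule funpow_invariant[where P = "regular N"]) (simp_all add: regular_diffmul assms)
  have minus: "regular N (diffmul N (G n) - G (n - 1))" if "?P G" for G n
    using regular_minus[of N "diffmul N (G n)" "G (n - 1)"] that
    by (simp add: regular_diffmul fun_diff_def)
  have step: "?R (\<lambda>n. diffmul N (G n) - G (n - 1)) = diffmul 1 (?R G)" if "?P G" for G
  proof (intro ext)
    fix c1 c2
    have "specialize N (\<lambda>p q. diffmul N (G c2) p q - G (c2 - 1) p q) c1 q =
        specialize N (G c2) (c1 - 1) q - specialize N (G (c2 - 1)) c1 q"
      using that by (simp add: specialize_minus specialize_diffmul regular_diffmul assms(1))
    then show "?R (\<lambda>n. diffmul N (G n) - G (n - 1)) c1 c2 = diffmul 1 (?R G) c1 c2"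
      by (simp add: fun_diff_def diffmul_def[of "Suc 0"])
  qed
  have "?R (((\<lambda>H n. diffmul N (H n) - H (n - 1)) ^^ K) (\<lambda>n. (diffmul N ^^ M) (H n))) =
      (diffmul 1 ^^ K) (?R (\<lambda>n. (diffmul N ^^ M) (H n)))"
  proof (rule funpow_intertwine[where P = ?P])
    show "?P (\<lambda>n. diffmul N (G n) - G (n - 1))" if "?P G" for G using minus[OF that] by blast
    show "?R (\<lambda>n. diffmul N (G n) - G (n - 1)) = diffmul 1 (?R G)" if "?P G" for G by (rule step[OF that])
  qed (use reg in blast)
  then show ?thesis
    by (simp add: M specialize_diffmul_funpow assms)
qed

text \<open>The exponent of a variable is bounded below when its field acts first on the vector.
  After clearing, locality allows each of the three fields to be moved to that place.\<close>

lemma clear_poles_product_truncated: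
  assumes u: "is_field u" and v: "is_field v" and w: "is_field w"
    and uv: "local_order N K u v" and uw: "local_order N K u w" and vw: "local_order N K v w"
  shows "truncated3 (clear_poles N K (\<lambda>s p q. u s (v p (w q \<omega>))))"
proof -
  let ?F = "\<lambda>s p q. u s (v p (w q \<omega>))"
  obtain L1 where L1: "\<forall>n<L1. u n \<omega> = 0" using is_field_bound[OF u] by blast
  obtain L2 where L2: "\<forall>n<L2. v n \<omega> = 0" using is_field_bound[OF v] by blast
  obtain L3 where L3: "\<forall>n<L3. w n \<omega> = 0" using is_field_bound[OF w] by blast
  have linear: "(diffmul N ^^ K) (\<lambda>p q. a (X p q)) = (diffmul N ^^ K) (\<lambda>p q. a (Y p q))"
    if "(diffmul N ^^ K) X = (diffmul N ^^ K) Y" "\<And>x y. a (x - y) = a x - a y" for X Y a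
    using that(1) by (simp add: diffmul_funpow_additive[of a, OF that(2)])
  have e23: "clear_poles N K ?F = clear_poles N K (\<lambda>s p q. u s (w q (v p \<omega>)))"
    by (rule clear_poles_cong_23, rule linear) (use vw u in \<open>auto simp: local_order_def is_field_diff\<close>)
  have e12: "clear_poles N K ?F = clear_poles N K (\<lambda>s p q. v p (u s (w q \<omega>)))"
    by (rule clear_poles_cong_12) (use uv in \<open>auto simp: local_order_def\<close>)
  also have "\<dots> = clear_poles N K (\<lambda>s p q. v p (w q (u s \<omega>)))"
    by (rule clear_poles_cong_13, rule linear) (use uw v in \<open>auto simp: local_order_def is_field_diff\<close>)
  finally have e1: "clear_poles N K ?F = clear_poles N K (\<lambda>s p q. v p (w q (u s \<omega>)))" .
  have "s < L1 \<Longrightarrow> clear_poles N K ?F s p q = 0" for s p q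
    unfolding e1 by (rule clear_poles_left_zero) (use L1 v w in auto)
  moreover have "p < L2 \<Longrightarrow> clear_poles N K ?F s p q = 0" for s p q
    unfolding e23 by (rule clear_poles_middle_zero) (use L2 u w in auto)
  moreover have "q < L3 \<Longrightarrow> clear_poles N K ?F s p q = 0" for s p q
    by (rule clear_poles_right_zero) (use L3 u v in auto)
  ultimately show ?thesis
    unfolding truncated3_def by (intro exI[of _ "min L1 (min L2 L3)"]) auto
qed

text \<open>Under x1 = x3 + z1, x2 = x3 + z2 the cleared differences become z1 - z2, z1 and z2. The
  first is \<open>diffmul 1\<close> on the left; the powers of the other two are the shifts by K on
  the right.\<close>

lemma nth_product_product:
  assumes N: "N > 0" and u: "is_field u" and v: "is_field v" and w: "is_field w"
    and uv: "local_order N K u v" and uw: "local_order N K u w" and vw: "local_order N K v w"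
  shows "(diffmul 1 ^^ K) (\<lambda>c1 c2. nth_product N u c1 (nth_product N v c2 w) q \<omega>) c1 c2 =
    substitute2 N (clear_poles N K (\<lambda>s p q. u s (v p (w q \<omega>)))) (c1 + int K) (c2 + int K) q"
proof -
  define F where "F = (\<lambda>s p q. u s (v p (w q \<omega>)))"
  define G where "G = (mul12 N ^^ K) ((mul13 N ^^ K) F)"
  define P where "P = clear_poles N K F"
  have P3: "truncated3 P"
    unfolding P_def F_def by (rule clear_poles_product_truncated[OF u v w uv uw vw])
  have regF: "regular N (F s)" for s
    unfolding F_def by (rule specialize23_field(2)[OF N u v w vw])
  have vcw: "is_field (nth_product N v c w)" for c
    by (rule is_field_nth_product[OF N v w vw])
  have HF: "specialize23 N F c = (\<lambda>s q. u s (nth_product N v c w q \<omega>))" for c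
    unfolding F_def by (rule specialize23_field(1)[OF N u v w vw])
  have regH: "regular N (specialize23 N F c)" for c
    unfolding HF by (rule product_regular[OF u vcw local_order_nth_product[OF N v w u vw uv uw]])
  have PG: "P s = (diffmul N ^^ K) (G s)" for s
    unfolding P_def clear_poles_def G_def by (intro ext) (simp add: mul23_funpow)
  have regG: "regular N (G s)" for s
    unfolding G_def by (rule specialize23_mul_funpow(2)[OF N regF])
  have G: "specialize23 N P c = specialize23 N G (c - int K)" for c
    unfolding specialize23_def PG by (intro ext) (simp add: specialize_diffmul_funpow[OF N regG])
  have "specialize N (specialize23 N G c2) (c1 + int K) q =
      (diffmul 1 ^^ K) (\<lambda>c1 c2. specialize N (specialize23 N F c2) (c1 - int K) q) (c1 + int K) c2"
    unfolding G_def specialize23_mul_funpow(1)[OF N, of F K K, OF regF]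
    by (rule fun_cong[OF fun_cong[OF specialize_family_diffmul[OF N regH]]])
  also have "\<dots> = (diffmul 1 ^^ K) (\<lambda>c1 c2. specialize N (specialize23 N F c2) c1 q) c1 c2"
    using diffmul_funpow_shift[of K 1 "\<lambda>c1 c2. specialize N (specialize23 N F c2) c1 q" "int K" 0] by simp
  also have "\<dots> = (diffmul 1 ^^ K) (\<lambda>c1 c2. nth_product N u c1 (nth_product N v c2 w) q \<omega>) c1 c2"
    by (simp add: HF nth_product_def[of N u])
  finally have "(diffmul 1 ^^ K) (\<lambda>c1 c2. nth_product N u c1 (nth_product N v c2 w) q \<omega>) c1 c2 =
      specialize N (specialize23 N P (c2 + int K)) (c1 + int K) q"
    by (simp add: G)
  also have "specialize23 N P (c2 + int K) = (\<lambda>s q. substitute N (P s) (c2 + int K) q)"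
    by (simp add: specialize23_def specialize_truncated[OF N truncated3_inner[OF P3]])
  also have "specialize N \<dots> (c1 + int K) q = substitute2 N P (c1 + int K) (c2 + int K) q"
    unfolding substitute2_def by (rule specialize_truncated[OF N truncated3_substitute[OF P3]])
  finally show ?thesis by (simp add: P_def F_def)
qed

text \<open>The cleared product is the same for both orders of u and v, up to a sign (-1)^K from
  exchanging the variables; this cancels the sign between (z1 - z2)^K and (z2 - z1)^K.\<close>

lemma nth_product_local:
  assumes N: "N > 0" and u: "is_field u" and v: "is_field v" and w: "is_field w"
    and uv: "local_order N K u v" and uw: "local_order N K u w" and vw: "local_order N K v w"
  shows "(diffmul 1 ^^ K) (\<lambda>c1 c2. nth_product N u c1 (nth_product N v c2 w) q \<omega>) =
    (diffmul 1 ^^ K) (\<lambda>c1 c2. nth_product N v c2 (nth_product N u c1 w) q \<omega>)"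
proof (intro ext)
  fix c1 c2
  define P where "P = clear_poles N K (\<lambda>s p q. u s (v p (w q \<omega>)))"
  have P3: "truncated3 P"
    unfolding P_def by (rule clear_poles_product_truncated[OF u v w uv uw vw])
  have "clear_poles N K (\<lambda>p s q. v p (u s (w q \<omega>))) = (\<lambda>p s q. if even K then clear_poles N K (\<lambda>s p q. v p (u s (w q \<omega>))) s p q else - clear_poles N K (\<lambda>s p q. v p (u s (w q \<omega>))) s p q)"
    by (rule clear_poles_swap)
  also have "clear_poles N K (\<lambda>s p q. v p (u s (w q \<omega>))) = P"
    unfolding P_def by (rule clear_poles_cong_12[symmetric]) (use uv in \<open>auto simp: local_order_def\<close>)
  finally have P': "clear_poles N K (\<lambda>p s q. v p (u s (w q \<omega>))) = (\<lambda>p s q. if even K then P s p q else - P s p q)" .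
  have "(diffmul 1 ^^ K) (\<lambda>c2 c1. nth_product N v c2 (nth_product N u c1 w) q \<omega>) c2 c1 =
      substitute2 N (\<lambda>p s q. if even K then P s p q else - P s p q) (c2 + int K) (c1 + int K) q"
    unfolding P'[symmetric] by (rule nth_product_product[OF N v u w local_order_sym[OF uv] vw uw])
  also have "\<dots> = (if even K then substitute2 N P (c1 + int K) (c2 + int K) q else - substitute2 N P (c1 + int K) (c2 + int K) q)"
    using substitute2_swap[OF P3] substitute2_uminus[of N "\<lambda>p s q. P s p q"] by simp
  finally have "(diffmul 1 ^^ K) (\<lambda>c2 c1. nth_product N v c2 (nth_product N u c1 w) q \<omega>) c2 c1 = \<dots>" .
  then show "(diffmul 1 ^^ K) (\<lambda>c1 c2. nth_product N u c1 (nth_product N v c2 w) q \<omega>) c1 c2 =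
      (diffmul 1 ^^ K) (\<lambda>c1 c2. nth_product N v c2 (nth_product N u c1 w) q \<omega>) c1 c2"
    unfolding nth_product_product[OF N u v w uv uw vw] P_def[symmetric]
      diffmul_funpow_swap[of K 1 "\<lambda>c2 c1. nth_product N v c2 (nth_product N u c1 w) q \<omega>"]
    by (cases "even K") simp_all
qed

lemma nth_product_product_truncated:
  assumes N: "N > 0" and u: "is_field u" and v: "is_field v" and w: "is_field w"
    and uv: "local_order N K u v" and uw: "local_order N K u w" and vw: "local_order N K v w"
  shows "truncated ((diffmul 1 ^^ K) (\<lambda>c1 c2. nth_product N u c1 (nth_product N v c2 w) q \<omega>))"
  unfolding truncated_def nth_product_product[OF assms]
  by (intro exI[of _ "- int K"]) (auto intro: substitute2_neg)

section \<open>The iterate formula\<close>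

lemma specialize_addmul_funpow:
  assumes "regular 1 F"
  shows "specialize 1 (\<lambda>p q. F (p - int k) q) = (addmul ^^ k) (specialize 1 F)"
proof (induction k)
  case (Suc k)
  have "regular 1 (\<lambda>p q. F (p - int k) q)"
    using regular_shift[OF assms, of "int k" 0] by simp
  then have "specialize 1 (\<lambda>p q. F (p - int 1 - int k) q) = addmul (specialize 1 (\<lambda>p q. F (p - int k) q))"
    using specialize_shift_left[of 1 "\<lambda>p q. F (p - int k) q"] by (intro ext) (simp add: addmul_def)
  moreover have "p - int 1 - int k = p - int (Suc k)" for p by simp
  ultimately show ?case by (simp only: Suc funpow.simps o_apply)
qed simp

text \<open>Substituting \<open>x\<^sub>1 = x\<^sub>2 + z\<^sub>0\<close>; the remaining indices are those of \<open>z\<^sub>0, x\<^sub>2, x\<^sub>3\<close>.\<close>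

definition specialize12 :: "nat \<Rightarrow> (int \<Rightarrow> int \<Rightarrow> int \<Rightarrow> 'w) \<Rightarrow> int \<Rightarrow> int \<Rightarrow> int \<Rightarrow> 'w"
  where "specialize12 N F n = (\<lambda>p q. specialize N (\<lambda>s p. F s p q) n p)"

lemma regular12_mul13:
  assumes "\<And>q. regular N (\<lambda>s p. F s p q)" shows "regular N (\<lambda>s p. mul13 N F s p q)"
  using regular_minus[OF regular_shift[OF assms, of "int N" 0] assms] by (simp add: mul13_def)

lemma regular12_mul23:
  assumes "\<And>q. regular N (\<lambda>s p. F s p q)" shows "regular N (\<lambda>s p. mul23 N F s p q)"
  using regular_minus[OF regular_shift[OF assms, of 0 "int N"] assms] by (simp add: mul23_def)

text \<open>After x1 = x2 + z0 the factor x1 - x3 is (x2 - x3) + z0.\<close>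

lemma specialize12_mul13:
  assumes "N > 0" "\<And>q. regular N (\<lambda>s p. F s p q)"
  shows "specialize12 N (mul13 N F) = (\<lambda>n. diffmul N (specialize12 N F n) + specialize12 N F (n - 1))"
proof (intro ext)
  fix n p q
  have "regular N (\<lambda>s p. F (s - int N) p q)"
    using regular_shift[OF assms(2), of "int N" 0] by simp
  then show "specialize12 N (mul13 N F) n p q = (diffmul N (specialize12 N F n) + specialize12 N F (n - 1)) p q"
    using assms specialize_shift_left[OF assms(1), of "\<lambda>s p. F s p q" n p]
    by (simp add: specialize12_def mul13_def diffmul_def specialize_minus)
qed

lemma specialize12_mul23:
  assumes "N > 0" "\<And>q. regular N (\<lambda>s p. F s p q)"
  shows "specialize12 N (mul23 N F) = (\<lambda>n. diffmul N (specialize12 N F n))"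
proof (intro ext)
  fix n p q
  have "regular N (\<lambda>s p. F s (p - int N) q)"
    using regular_shift[OF assms(2), of 0 "int N"] by simp
  then show "specialize12 N (mul23 N F) n p q = diffmul N (specialize12 N F n) p q"
    using assms specialize_shift_right[OF assms(1), of "\<lambda>s p. F s p q" "int N" n p]
    by (simp add: specialize12_def mul23_def diffmul_def specialize_minus)
qed

text \<open>After x1 = x2 + z0 and x2 = x3 + z2 the three differences are z0, z2 and z0 + z2: the
  first two only shift exponents, the third becomes \<open>addmul\<close>.\<close>

lemma specialize_clear_poles_iterate:
  assumes N: "N > 0" and F: "\<And>q. regular N (\<lambda>s p. F s p q)" and H: "\<And>n. regular N (specialize12 N F n)"
  shows "specialize N (specialize12 N (clear_poles N K F) c0) c2 q =
    (addmul ^^ K) (\<lambda>c0 c2. specialize N (specialize12 N F c0) c2 q) (c0 - int K) (c2 - int K)"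
proof -
  let ?P = "\<lambda>F. \<forall>q. regular N (\<lambda>s p. F s p q)"
  let ?Q = "\<lambda>H. \<forall>n. regular N (H n)"
  let ?R = "\<lambda>H c0 c2. specialize N (H c0) c2 q"
  let ?e = "\<lambda>H n. diffmul N (H n) + H (n - 1)"
  define F1 where "F1 = (mul23 N ^^ K) F"
  define F2 where "F2 = (mul13 N ^^ K) F1"
  have P1: "?P F1"
    unfolding F1_def by (rule funpow_invariant[where P = ?P]) (use regular12_mul23 F in auto)
  have P2: "?P F2"
    unfolding F2_def by (rule funpow_invariant[where P = ?P]) (use regular12_mul13 P1 in auto)
  have "specialize12 N F1 = ((\<lambda>H n. diffmul N (H n)) ^^ K) (specialize12 N F)"
    unfolding F1_def
    by (rule funpow_intertwine[where P = ?P]) (use regular12_mul23 specialize12_mul23[OF N] F in auto)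
  also have "\<dots> = (\<lambda>n. (diffmul N ^^ K) (specialize12 N F n))"
    by (induction K) simp_all
  finally have S1: "specialize12 N F1 = (\<lambda>n. (diffmul N ^^ K) (specialize12 N F n))" .
  have S2: "specialize12 N F2 = (?e ^^ K) (specialize12 N F1)"
    unfolding F2_def
    by (rule funpow_intertwine[where P = ?P]) (use regular12_mul13 specialize12_mul13[OF N] P1 in auto)
  have S3: "specialize12 N (clear_poles N K F) c0 = specialize12 N F2 (c0 - int K)"
  proof (intro ext)
    fix p q
    have "(\<lambda>s p. clear_poles N K F s p q) = (diffmul N ^^ K) (\<lambda>s p. F2 s p q)"
      unfolding clear_poles_23 F2_def F1_def by (intro ext) (simp add: mul12_funpow)
    then show "specialize12 N (clear_poles N K F) c0 p q = specialize12 N F2 (c0 - int K) p q"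
      using P2 by (simp add: specialize12_def specialize_diffmul_funpow[OF N])
  qed
  have Q1: "?Q (specialize12 N F1)"
    unfolding S1 by (intro allI funpow_invariant[where P = "regular N"]) (simp_all add: regular_diffmul H)
  have add: "regular N (diffmul N (G n) + G (n - 1))" if "?Q G" for G n
    using regular_add[OF N, of "diffmul N (G n)" "G (n - 1)"] that
    by (simp add: regular_diffmul plus_fun_def)
  have step: "?R (?e G) = addmul (?R G)" if "?Q G" for G
    using specialize_add[OF N, of "diffmul N (G _)" "G (_ - 1)"] that
    by (simp add: regular_diffmul plus_fun_def specialize_diffmul N addmul_def)
  have "?R (specialize12 N F2) = (addmul ^^ K) (?R (specialize12 N F1))"
    unfolding S2
  proof (rule funpow_intertwine[where P = ?Q])
    show "?Q (?e G)" if "?Q G" for G using add[OF that] by blast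
    show "?R (?e G) = addmul (?R G)" if "?Q G" for G by (rule step[OF that])
  qed (rule Q1)
  also have "?R (specialize12 N F1) = (\<lambda>c0 c2. ?R (specialize12 N F) c0 (c2 - int K))"
    unfolding S1 by (simp add: specialize_diffmul_funpow[OF N H])
  also have "(addmul ^^ K) \<dots> = (\<lambda>c0 c2. (addmul ^^ K) (?R (specialize12 N F)) c0 (c2 - int K))"
    using addmul_funpow_shift[of K "?R (specialize12 N F)" 0 "int K"] by simp
  finally have "?R (specialize12 N F2) (c0 - int K) c2 =
      (addmul ^^ K) (?R (specialize12 N F)) (c0 - int K) (c2 - int K)"
    by (simp add: fun_eq_iff)
  then show ?thesis by (simp add: S3)
qed

text \<open>Multiplied by (z0 z2 (z0 + z2))^K, both sides come from the same cleared product of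
  three fields, the left through x1 = x2 + z0 and the right through z1 = z2 + z0.
  \<open>substitute_assoc\<close> identifies the two routes.\<close>

theorem nth_product_iterate:
  assumes N: "N > 0" and u: "is_field u" and v: "is_field v" and w: "is_field w"
    and uv: "local_order N K u v" and uw: "local_order N K u w" and vw: "local_order N K v w"
  shows "nth_product N (nth_product N u c0 v) c2 w q \<omega> =
    specialize 1 (\<lambda>c1 c2. nth_product N u c1 (nth_product N v c2 w) q \<omega>) c0 c2"
proof -
  define F where "F = (\<lambda>s p q. u s (v p (w q \<omega>)))"
  define P where "P = clear_poles N K F"
  define E where "E = (\<lambda>c1 c2. nth_product N u c1 (nth_product N v c2 w) q \<omega>)"
  define X where "X = (\<lambda>c0 c2. nth_product N (nth_product N u c0 v) c2 w q \<omega>)"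
  have P3: "truncated3 P"
    unfolding P_def F_def by (rule clear_poles_product_truncated[OF u v w uv uw vw])
  have EP: "(diffmul 1 ^^ K) E (c1 - int K) (c2 - int K) = substitute2 N P c1 c2 q" for c1 c2
    unfolding E_def nth_product_product[OF N u v w uv uw vw] P_def F_def by simp
  have Etr: "truncated ((diffmul 1 ^^ K) E)"
    unfolding E_def by (rule nth_product_product_truncated[OF N u v w uv uw vw])
  then have Ereg: "regular 1 E" by (rule regularI)
  have tT: "truncated (\<lambda>c1 c2. substitute2 N P c1 c2 q)"
    using truncated_shift[OF Etr, of "int K" "int K"] by (simp only: EP)
  have ucv: "is_field (nth_product N u c v)" for c
    by (rule is_field_nth_product[OF N u v uv])
  have Freg: "regular N (\<lambda>s p. F s p q)" for q
    unfolding F_def by (rule product_regular[OF u v uv])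
  have FX: "specialize12 N F c = (\<lambda>p q. nth_product N u c v p (w q \<omega>))" for c
    by (simp add: specialize12_def F_def nth_product_def)
  have Hreg: "regular N (specialize12 N F c)" for c
    unfolding FX
    by (rule product_regular[OF ucv w local_order_sym[OF local_order_nth_product[OF N u v w uv local_order_sym[OF uw] local_order_sym[OF vw]]]])
  have X: "X = (\<lambda>c0 c2. specialize N (specialize12 N F c0) c2 q)"
    by (simp add: X_def FX nth_product_def[of N "nth_product N u _ v"])
  have "(addmul ^^ K) X c0 c2 = (addmul ^^ K) (specialize 1 E) c0 c2" for c0 c2
  proof -
    have "(addmul ^^ K) X c0 c2 = specialize N (specialize12 N P (c0 + int K)) (c2 + int K) q"
      unfolding X P_def specialize_clear_poles_iterate[OF N Freg Hreg] by simp
    also have "specialize12 N P (c0 + int K) = (\<lambda>p q. substitute N (\<lambda>s p. P s p q) (c0 + int K) p)"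
    proof -
      have "truncated (\<lambda>s p. P s p q)" for q
        using P3 unfolding truncated3_def truncated_def by blast
      then show ?thesis by (simp add: specialize12_def specialize_truncated[OF N])
    qed
    also have "specialize N \<dots> (c2 + int K) q = substitute N \<dots> (c2 + int K) q"
    proof (rule specialize_truncated[OF N])
      obtain L where L: "\<forall>s p q. s < L \<or> p < L \<or> q < L \<longrightarrow> P s p q = 0"
        using P3 by (auto simp: truncated3_def)
      have "P s (p - s + int N * (c0 + int K)) q = 0" if "p < 2 * L - int N * (c0 + int K)" for s p q
        using L that by (cases "s < L") auto
      then show "truncated (\<lambda>p q. substitute N (\<lambda>s p. P s p q) (c0 + int K) p)"
        using L by (intro truncatedI[of "2 * L - int N * (c0 + int K)" _ L]) (auto simp: substitute_def)
    qed
    also have "\<dots> = substitute 1 (\<lambda>c1 c2. substitute2 N P c1 c2 q) (c0 + int K) (c2 + int K)"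
      by (rule substitute_assoc[OF N P3, symmetric])
    also have "\<dots> = specialize 1 (\<lambda>c1 c2. (diffmul 1 ^^ K) E (c1 - int K) (c2 - int K)) (c0 + int K) (c2 + int K)"
      unfolding EP by (rule specialize_truncated[symmetric, OF _ tT]) simp
    also have "\<dots> = specialize 1 (\<lambda>c1 c2. (diffmul 1 ^^ K) E (c1 - int K) c2) (c0 + int K) c2"
      using specialize_shift_right[of 1 "\<lambda>c1 c2. (diffmul 1 ^^ K) E (c1 - int K) c2" "int K" "c0 + int K" "c2 + int K"]
        regularI[where N = 1 and K = 0 and F = "\<lambda>c1 c2. (diffmul 1 ^^ K) E (c1 - int K) c2"]
        truncated_shift[OF Etr, of "int K" 0]
      by simp
    also have "\<dots> = (addmul ^^ K) (specialize 1 ((diffmul 1 ^^ K) E)) (c0 + int K) c2"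
      using specialize_addmul_funpow[of "(diffmul 1 ^^ K) E" K] regularI[where N = 1 and K = 0 and F = "(diffmul 1 ^^ K) E"] Etr
      by simp
    also have "specialize 1 ((diffmul 1 ^^ K) E) = (\<lambda>c0 c2. specialize 1 E (c0 - int K) c2)"
      by (intro ext specialize_diffmul_funpow[OF _ Ereg]) simp
    also have "(addmul ^^ K) \<dots> (c0 + int K) c2 = (addmul ^^ K) (specialize 1 E) c0 c2"
      using addmul_funpow_shift[of K "specialize 1 E" "int K" 0] by simp
    finally show ?thesis .
  qed
  moreover have "X c0 c2 = 0" if "c0 < - int K" for c0 c2
  proof -
    have "specialize12 N F c0 = (\<lambda>p q. 0)"
      unfolding FX using nth_product_below[OF N u v uv that] by simp
    then show ?thesis
      by (simp add: X specialize_truncated[OF N] truncated_def substitute_def)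
  qed
  moreover have "specialize 1 E c0 c2 = 0" if "c0 < - int K" for c0 c2
    by (rule specialize_below[OF _ Etr that]) simp
  \<comment> \<open>Both sides vanish for exponents of z0 below -K, so the factor (z0 + z2)^K may be
    cancelled.\<close>
  ultimately have "X = specialize 1 E"
    by (intro addmul_inj[of "- int K" X "specialize 1 E" K]) (auto simp: fun_eq_iff)
  then show ?thesis by (simp add: X_def E_def fun_eq_iff)
qed

end

section \<open>Roots of unity\<close>

lemma omega_power_int: "omega N powi k = exp (2 * of_real pi * \<i> * of_int k / of_nat N)"
  by (simp add: omega_def exp_power_int mult_ac)

lemma omega_power_int_eq_1_iff:
  assumes "N > 0"
  shows "omega N powi k = 1 \<longleftrightarrow> int N dvd k"
proof -
  have "omega N powi k = 1 \<longleftrightarrow> (\<exists>n::int. 2 * pi * of_int k / real N = of_int (2 * n) * pi)"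
    by (simp add: omega_power_int exp_eq_1)
  also have "\<dots> \<longleftrightarrow> (\<exists>n::int. real_of_int k = real_of_int (int N * n))"
    using assms by (simp add: field_simps)
  also have "\<dots> \<longleftrightarrow> int N dvd k"
    unfolding of_int_eq_iff dvd_def ..
  finally show ?thesis .
qed

lemma omega_nonzero [simp]: "omega N \<noteq> 0"
  by (simp add: omega_def)

lemma omega_power_int_add: "omega N powi (a + b) = omega N powi a * omega N powi b"
  by (simp add: power_int_add)

text \<open>Orthogonality of the characters of Z/N, from the geometric series with ratio an N-th
  root of unity.\<close>

lemma sum_omega:
  assumes N: "N > 0"
  shows "(\<Sum>j<N. omega N powi (int j * d)) = (if int N dvd d then of_nat N else 0)"
proof (cases "int N dvd d")
  case True
  then have "omega N powi (int j * d) = 1" for j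
    by (simp add: omega_power_int_eq_1_iff[OF N])
  then show ?thesis using True by simp
next
  case False
  define z where "z = omega N powi d"
  have z: "z \<noteq> 1" using False by (simp add: z_def omega_power_int_eq_1_iff[OF N])
  have pow: "omega N powi (int j * d) = z ^ j" for j
    by (simp add: z_def mult.commute[of "int j"] power_int_mult)
  have "z ^ N = 1"
    using omega_power_int_eq_1_iff[OF N, of "int N * d"] pow[of N] by simp
  then have "(\<Sum>j<N. z ^ j) = 0"
    using z by (simp add: geometric_sum)
  then show ?thesis using False by (simp add: pow)
qed

lemma residue_unique:
  assumes "N > 0"
  shows "\<exists>!j. j < N \<and> int N dvd n + int j"
proof (rule ex1I)
  let ?j = "nat ((- n) mod int N)"
  have j: "int ?j = (- n) mod int N" using assms by simp
  then have "int ?j < int N" using assms by simp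
  moreover have "int N dvd n + int ?j"
    unfolding j by (simp add: dvd_eq_mod_eq_0 mod_simps)
  ultimately show "?j < N \<and> int N dvd n + int ?j" by (simp only: of_nat_less_iff)
next
  fix j assume j: "j < N \<and> int N dvd n + int j"
  then have "int N dvd int j - (- n)" by (simp add: add.commute)
  then have "int j mod int N = (- n) mod int N" by (simp only: mod_eq_dvd_iff)
  moreover have "int j mod int N = int j" using j by simp
  ultimately have "int j = (- n) mod int N" by (simp only:)
  then show "j = nat ((- n) mod int N)" by (metis nat_int)
qed

lemma sum_residue:
  fixes x :: "'b::comm_monoid_add"
  assumes "N > 0"
  shows "(\<Sum>j<N. if int N dvd n + int j then x else 0) = x"
proof -
  obtain i where i: "i < N" "int N dvd n + int i" "\<And>j. j < N \<Longrightarrow> int N dvd n + int j \<Longrightarrow> j = i"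
    using residue_unique[OF assms, of n] by metis
  have "int N dvd n + int j \<longleftrightarrow> j = i" if "j < N" for j
    using i that by blast
  then have "(\<Sum>j<N. if int N dvd n + int j then x else 0) = (\<Sum>j<N. if j = i then x else 0)"
    by simp
  with i(1) show ?thesis by simp
qed

section \<open>Fields in several variables\<close>

context complex_vector_space
begin

lemma diffmul_funpow_sum:
  "(diffmul N ^^ k) G p q = (\<Sum>i\<le>k. scale (binomial_coeff (of_nat k) i) (G (p - int N * int (k - i)) (q - int N * int i)))"
proof (induction k arbitrary: p q)
  case (Suc k)
  define g where "g i = G (p - int N * (int k + 1 - int i)) (q - int N * int i)" for i
  have z: "binomial_coeff (of_nat k) (Suc k) = 0"
    by (simp add: binomial_coeff_def binomial_eq_0 flip: binomial_gbinomial)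
  have "(diffmul N ^^ Suc k) G p q = (\<Sum>i\<le>k. scale (binomial_coeff (of_nat k) i) (g i)) -
      (\<Sum>i\<le>k. scale (binomial_coeff (of_nat k) i) (g (Suc i)))"
  proof -
    have "G (p - int N - int N * int (k - i)) (q - int N * int i) = g i"
      "G (p - int N * int (k - i)) (q - int N - int N * int i) = g (Suc i)" if "i \<le> k" for i
      using that by (simp_all add: g_def of_nat_diff algebra_simps)
    then show ?thesis by (simp add: diffmul_def[of N "(diffmul N ^^ k) G"] Suc)
  qed
  also have "(\<Sum>i\<le>k. scale (binomial_coeff (of_nat k) i) (g i)) =
      g 0 + (\<Sum>i\<le>k. scale (binomial_coeff (of_nat k) (Suc i)) (g (Suc i)))"
    using sum.atMost_Suc_shift[of "\<lambda>i. scale (binomial_coeff (of_nat k) i) (g i)" k] z by simp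
  also have "\<dots> - (\<Sum>i\<le>k. scale (binomial_coeff (of_nat k) i) (g (Suc i))) =
      g 0 + (\<Sum>i\<le>k. scale (binomial_coeff (of_nat (Suc k)) (Suc i)) (g (Suc i)))"
    using binomial_coeff_Suc[of "of_nat k"]
    by (simp add: scale_left_diff_distrib sum_subtractf add.commute)
  also have "\<dots> = (\<Sum>i\<le>Suc k. scale (binomial_coeff (of_nat (Suc k)) i) (g i))"
    by (simp add: sum.atMost_Suc_shift del: sum.atMost_Suc)
  also have "\<dots> = (\<Sum>i\<le>Suc k. scale (binomial_coeff (of_nat (Suc k)) i) (G (p - int N * int (Suc k - i)) (q - int N * int i)))"
    by (rule sum.cong) (simp_all add: g_def of_nat_diff algebra_simps)
  finally show ?case .
qed simp

text \<open>Locality involves only the exponents of x0 and y0, so it splits into the toroidal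
  components; K remains uniform in m and m', which later gives uniform bounds.\<close>

lemma mutually_local_iff:
  "mutually_local scale N a b \<longleftrightarrow> (\<exists>K. \<forall>m m'. local_order N K (\<lambda>p. a p m) (\<lambda>q. b q m'))"
proof -
  have "local_order N K (\<lambda>p. a p m) (\<lambda>q. b q m') \<longleftrightarrow> (\<forall>p q w.
    (\<Sum>i\<le>K. scale (binomial_coeff (of_nat K) i)
      (a (p - int N * int (K - i)) m (b (q - int N * int i) m' w) -
       b (q - int N * int i) m' (a (p - int N * int (K - i)) m w))) = 0)" for K m m'
  proof -
    have "(diffmul N ^^ K) (\<lambda>p q. a p m (b q m' w)) = (diffmul N ^^ K) (\<lambda>p q. b q m' (a p m w)) \<longleftrightarrow>
        (\<forall>p q. (diffmul N ^^ K) (\<lambda>p q. a p m (b q m' w) - b q m' (a p m w)) p q = 0)" for w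
      by (simp add: diffmul_funpow_minus fun_eq_iff)
    then show ?thesis
      unfolding local_order_def by (simp add: diffmul_funpow_sum) blast
  qed
  then show ?thesis unfolding mutually_local_def by simp blast
qed

lemma mutually_local_sym: "mutually_local scale N a b \<Longrightarrow> mutually_local scale N b a"
  unfolding mutually_local_iff by (blast intro: local_order_sym)

lemma fields_iff:
  "a \<in> fields scale \<longleftrightarrow> (\<forall>n m x y. a n m (x + y) = a n m x + a n m y) \<and>
    (\<forall>n m c x. a n m (scale c x) = scale c (a n m x)) \<and> (\<forall>w. \<exists>L. \<forall>n<L. \<forall>m. a n m w = 0)"
  unfolding fields_on_def linear_on_def by auto

lemma is_field_component: "a \<in> fields scale \<Longrightarrow> is_field (\<lambda>n. a n m)"
  unfolding fields_iff is_field_def by blast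

lemma common_order:
  assumes "mutually_local scale N a b" "mutually_local scale N c d" "mutually_local scale N e f"
  obtains K where "\<And>m m'. local_order N K (\<lambda>p. a p m) (\<lambda>q. b q m')"
    "\<And>m m'. local_order N K (\<lambda>p. c p m) (\<lambda>q. d q m')"
    "\<And>m m'. local_order N K (\<lambda>p. e p m) (\<lambda>q. f q m')"
proof -
  obtain K1 K2 K3 where "\<forall>m m'. local_order N K1 (\<lambda>p. a p m) (\<lambda>q. b q m')"
    "\<forall>m m'. local_order N K2 (\<lambda>p. c p m) (\<lambda>q. d q m')"
    "\<forall>m m'. local_order N K3 (\<lambda>p. e p m) (\<lambda>q. f q m')"
    using assms unfolding mutually_local_iff by blast
  moreover have "K1 \<le> max K1 (max K2 K3)" "K2 \<le> max K1 (max K2 K3)" "K3 \<le> max K1 (max K2 K3)"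
    by simp_all
  ultimately show thesis
    using that[of "max K1 (max K2 K3)"] local_order_mono by blast
qed

lemma product_term_eq:
  "product_term scale N a b c p q k l w = expand N (- c - 1) (\<lambda>p q. a p k (b q (l - k) w)) p q"
  by (simp add: product_term_def expand_def Let_def)

lemma opposite_term_eq:
  "opposite_term scale N a b c p q k l w = expand_op N (- c - 1) (\<lambda>p q. b q (l - k) (a p k w)) p q"
  by (simp add: opposite_term_def expand_op_def expand_def Let_def scale_Sum_any)

lemma restrict_residue_idem: "restrict_residue N r (restrict_residue N r F) = restrict_residue N r F"
  by (simp add: restrict_residue_def fun_eq_iff)

text \<open>Taking the degree-j part restricts the first exponent to a residue class modulo N. This
  commutes with multiplication by x - y, so the restricted products are local of the same
  order.\<close>

lemma vertex_op_hom_eq: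
  assumes N: "N > 0" and a: "a \<in> fields scale" and b: "b \<in> fields scale" and loc: "mutually_local scale N a b"
  shows "vertex_op_hom scale N j (homogeneous_part N j a) c k b q l w =
    specialize N (restrict_residue N (- int j) (\<lambda>p q. a p k (b q (l - k) w))) c q"
proof -
  let ?a = "\<lambda>p. a p k" and ?b = "\<lambda>q. b q (l - k)"
  let ?r = "restrict_residue N (- int j)"
  have fa: "is_field ?a" and fb: "is_field ?b" using a b by (simp_all add: is_field_component)
  obtain K where K: "local_order N K ?a ?b" using loc unfolding mutually_local_iff by blast
  obtain L where L: "\<forall>n<L. ?a n w = 0" using is_field_bound[OF fa] by blast
  obtain L' where L': "\<forall>n<L'. ?b n w = 0" using is_field_bound[OF fb] by blast
  have A: "(\<lambda>p q. homogeneous_part N j a p k (b q (l - k) w)) = ?r (\<lambda>p q. ?a p (?b q w))"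
    by (simp add: homogeneous_part_def restrict_residue_def fun_eq_iff)
  have B: "(\<lambda>p q. b q (l - k) (homogeneous_part N j a p k w)) = ?r (\<lambda>p q. ?b q (?a p w))"
    using is_field_0[OF fb] by (simp add: homogeneous_part_def restrict_residue_def fun_eq_iff)
  have "vertex_op_hom scale N j (homogeneous_part N j a) c k b q l w =
      specialize N (?r (?r (\<lambda>p q. ?a p (?b q w)))) c q"
    unfolding vertex_op_hom_def product_term_eq opposite_term_eq A B Let_def
  proof (rule specialize_residue_formula[OF N, where K = K, unfolded Let_def])
    show "?r (\<lambda>p q. ?a p (?b q w)) p q = 0" if "q < L'" for p q
      using that L' is_field_0[OF fa] by (simp add: restrict_residue_def)
    show "?r (\<lambda>p q. ?b q (?a p w)) p q = 0" if "p < L" for p q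
      using that L is_field_0[OF fb] by (simp add: restrict_residue_def)
    show "(diffmul N ^^ K) (?r (\<lambda>p q. ?a p (?b q w))) = (diffmul N ^^ K) (?r (\<lambda>p q. ?b q (?a p w)))"
      using K by (simp add: diffmul_restrict_residue local_order_def)
  qed
  then show ?thesis by (simp add: restrict_residue_idem)
qed

text \<open>The residue classes of - j for j < N partition the exponents and
  \<open>specialize\<close> is additive, so the formulas for the separate degrees add up to one
  substitution without reference to the grading.\<close>

theorem vertex_op_eq:
  assumes N: "N > 0" and a: "a \<in> fields scale" and b: "b \<in> fields scale" and loc: "mutually_local scale N a b"
  shows "vertex_op scale N a c k b = (\<lambda>q l w. nth_product N (\<lambda>p. a p k) c (\<lambda>q. b q (l - k)) q w)"
proof (intro ext)
  fix q l w
  let ?A = "\<lambda>p q. a p k (b q (l - k) w)"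
  obtain K where K: "local_order N K (\<lambda>p. a p k) (\<lambda>q. b q (l - k))"
    using loc unfolding mutually_local_iff by blast
  have reg: "regular N ?A"
    by (rule product_regular[OF is_field_component[OF a] is_field_component[OF b] K])
  have "vertex_op scale N a c k b q l w = (\<Sum>j<N. specialize N (restrict_residue N (- int j) ?A) c q)"
    by (simp add: vertex_op_def sum_fun_apply vertex_op_hom_eq[OF assms])
  also have "\<dots> = specialize N (\<lambda>p q. \<Sum>j<N. restrict_residue N (- int j) ?A p q) c q"
    using specialize_sum[OF N, of "{..<N}" "\<lambda>j. restrict_residue N (- int j) ?A" c q]
      regular_restrict_residue[OF reg] by simp
  also have "(\<lambda>p q. \<Sum>j<N. restrict_residue N (- int j) ?A p q) = ?A"
    by (simp add: restrict_residue_def sum_residue[OF N])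
  finally show "vertex_op scale N a c k b q l w = nth_product N (\<lambda>p. a p k) c (\<lambda>q. b q (l - k)) q w"
    by (simp add: nth_product_def)
qed

lemma vertex_op_in_fields:
  assumes N: "N > 0" and a: "a \<in> fields scale" and b: "b \<in> fields scale" and loc: "mutually_local scale N a b"
  shows "vertex_op scale N a c k b \<in> fields scale"
proof -
  note fa = is_field_component[OF a] and fb = is_field_component[OF b]
  obtain K where K: "\<And>m m'. local_order N K (\<lambda>p. a p m) (\<lambda>q. b q m')"
    using loc unfolding mutually_local_iff by blast
  have f: "is_field (nth_product N (\<lambda>p. a p k) c (\<lambda>q. b q (l - k)))" for l
    by (rule is_field_nth_product[OF N fa fb K])
  \<comment> \<open>Membership in \<open>fields\<close> asks for one bound for all l; the uniform K,
    L and L' supply it.\<close>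
  have "\<exists>L. \<forall>n<L. \<forall>l. nth_product N (\<lambda>p. a p k) c (\<lambda>q. b q (l - k)) n w = 0" for w
  proof -
    obtain L where L: "\<forall>n<L. \<forall>m. a n m w = 0" using a unfolding fields_iff by blast
    obtain L' where L': "\<forall>n<L'. \<forall>m. b n m w = 0" using b unfolding fields_iff by blast
    show ?thesis
      by (intro exI allI impI nth_product_zero[OF N fa fb K, of L _ _ L']) (use L L' in auto)
  qed
  then show ?thesis
    unfolding vertex_op_eq[OF assms] fields_iff
    using is_field_add[OF f] is_field_scale[OF f] by blast
qed

lemma vertex_op_below:
  assumes N: "N > 0" and a: "a \<in> fields scale" and b: "b \<in> fields scale" and loc: "mutually_local scale N a b"
  shows "\<exists>L. \<forall>c<L. \<forall>k. vertex_op scale N a c k b = 0"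
proof -
  obtain K where K: "\<And>m m'. local_order N K (\<lambda>p. a p m) (\<lambda>q. b q m')"
    using loc unfolding mutually_local_iff by blast
  have "vertex_op scale N a c k b = 0" if "c < - int K" for c k
    unfolding vertex_op_eq[OF assms]
    using nth_product_below[OF N is_field_component[OF a] is_field_component[OF b] K that] by (simp add: fun_eq_iff)
  then show ?thesis by blast
qed

lemma mutually_local_vertex_op:
  assumes N: "N > 0" and a: "a \<in> fields scale" and b: "b \<in> fields scale" and c: "c \<in> fields scale"
    and ab: "mutually_local scale N a b" and ca: "mutually_local scale N c a" and cb: "mutually_local scale N c b"
  shows "mutually_local scale N c (vertex_op scale N a n k b)"
proof -
  obtain K where K: "\<And>m m'. local_order N K (\<lambda>p. a p m) (\<lambda>q. b q m')"
    "\<And>m m'. local_order N K (\<lambda>p. c p m) (\<lambda>q. a q m')"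
    "\<And>m m'. local_order N K (\<lambda>p. c p m) (\<lambda>q. b q m')"
    by (rule common_order[OF ab ca cb]) blast
  have "local_order N (2 * K + nat (n + int K)) (\<lambda>p. c p m) (nth_product N (\<lambda>p. a p k) n (\<lambda>q. b q (m' - k)))" for m m'
    by (rule local_order_nth_product[OF N]) (simp_all add: is_field_component a b c K)
  then show ?thesis
    unfolding mutually_local_iff vertex_op_eq[OF N a b ab] by blast
qed

lemma series_vector_space: "complex_vector_space (series_scale scale)"
  by unfold_locales
    (simp_all add: series_scale_def fun_eq_iff scale_right_distrib scale_left_distrib)

section \<open>Local subspaces\<close>

lemma fields_add: "a \<in> fields scale \<Longrightarrow> b \<in> fields scale \<Longrightarrow> a + b \<in> fields scale"
  unfolding fields_iff
proof (intro conjI allI; (elim conjE)?)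
  fix w
  assume "\<forall>w. \<exists>L. \<forall>n<L. \<forall>m. a n m w = 0" "\<forall>w. \<exists>L. \<forall>n<L. \<forall>m. b n m w = 0"
  then obtain L L' where "\<forall>n<L. \<forall>m. a n m w = 0" "\<forall>n<L'. \<forall>m. b n m w = 0" by blast
  then show "\<exists>L. \<forall>n<L. \<forall>m. (a + b) n m w = 0"
    by (intro exI[of _ "min L L'"]) simp
qed (simp_all add: scale_right_distrib)

lemma fields_scale: "a \<in> fields scale \<Longrightarrow> series_scale scale c a \<in> fields scale"
  unfolding fields_iff series_scale_def by (fastforce simp: scale_right_distrib mult.commute)

lemma fields_homogeneous_part: "a \<in> fields scale \<Longrightarrow> homogeneous_part N j a \<in> fields scale"
  unfolding fields_iff homogeneous_part_def by fastforce

lemma fields_identity: "identity_field \<in> fields scale"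
  unfolding fields_iff identity_field_def by auto

lemma fields_zero: "0 \<in> fields scale"
  unfolding fields_iff by simp

lemma mutually_local_zero: "c \<in> fields scale \<Longrightarrow> mutually_local scale N c 0"
  unfolding mutually_local_iff local_order_def
  using is_field_0[OF is_field_component[of c]] by simp

lemma mutually_local_add:
  assumes c: "c \<in> fields scale" and "mutually_local scale N c a" "mutually_local scale N c b"
  shows "mutually_local scale N c (a + b)"
proof -
  obtain K where K: "\<And>m m'. local_order N K (\<lambda>p. c p m) (\<lambda>q. a q m')"
    "\<And>m m'. local_order N K (\<lambda>p. c p m) (\<lambda>q. b q m')"
    by (rule common_order[OF assms(2,3,3)]) blast
  have add: "(diffmul N ^^ K) (\<lambda>p q. F p q + G p q) = (\<lambda>p q. (diffmul N ^^ K) F p q + (diffmul N ^^ K) G p q)"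
    for F G :: "int \<Rightarrow> int \<Rightarrow> 'w"
    using diffmul_funpow_minus[of K N "\<lambda>p q. F p q + G p q" G] by (simp add: fun_eq_iff algebra_simps)
  have "local_order N K (\<lambda>p. c p m) (\<lambda>q. (a + b) q m')" for m m'
    using K[of m m'] is_field_add[OF is_field_component[OF c]] by (simp add: local_order_def add)
  then show ?thesis unfolding mutually_local_iff by blast
qed

lemma mutually_local_scale:
  assumes c: "c \<in> fields scale" and "mutually_local scale N c a"
  shows "mutually_local scale N c (series_scale scale x a)"
proof -
  obtain K where K: "\<And>m m'. local_order N K (\<lambda>p. c p m) (\<lambda>q. a q m')"
    using assms unfolding mutually_local_iff by blast
  have "(diffmul N ^^ K) (\<lambda>p q. scale x (F p q)) = (\<lambda>p q. scale x ((diffmul N ^^ K) F p q))" for F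
    by (rule diffmul_funpow_additive) (rule scale_right_diff_distrib)
  then have "local_order N K (\<lambda>p. c p m) (\<lambda>q. series_scale scale x a q m')" for m m'
    using K[of m m'] is_field_scale[OF is_field_component[OF c]]
    by (simp add: local_order_def series_scale_def)
  then show ?thesis unfolding mutually_local_iff by blast
qed

lemma mutually_local_homogeneous_part:
  assumes c: "c \<in> fields scale" and "mutually_local scale N c a"
  shows "mutually_local scale N c (homogeneous_part N j a)"
proof -
  obtain K where K: "\<And>m m'. local_order N K (\<lambda>p. a p m) (\<lambda>q. c q m')"
    using assms(2)[THEN mutually_local_sym] unfolding mutually_local_iff by blast
  have "local_order N K (\<lambda>p. homogeneous_part N j a p m) (\<lambda>q. c q m')" for m m'
    unfolding local_order_def
  proof
    fix w
    have "(\<lambda>p q. homogeneous_part N j a p m (c q m' w)) = restrict_residue N (- int j) (\<lambda>p q. a p m (c q m' w))"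
      "(\<lambda>p q. c q m' (homogeneous_part N j a p m w)) = restrict_residue N (- int j) (\<lambda>p q. c q m' (a p m w))"
      using is_field_0[OF is_field_component[OF c]]
      by (simp_all add: homogeneous_part_def restrict_residue_def fun_eq_iff)
    then show "(diffmul N ^^ K) (\<lambda>p q. homogeneous_part N j a p m (c q m' w)) =
        (diffmul N ^^ K) (\<lambda>p q. c q m' (homogeneous_part N j a p m w))"
      using K[of m m'] by (simp add: diffmul_restrict_residue local_order_def)
  qed
  then have "mutually_local scale N (homogeneous_part N j a) c"
    unfolding mutually_local_iff by blast
  then show ?thesis by (rule mutually_local_sym)
qed

lemma mutually_local_identity:
  assumes c: "c \<in> fields scale"
  shows "mutually_local scale N c identity_field"
proof -
  have "local_order N 0 (\<lambda>p. c p m) (\<lambda>q. identity_field q m')" for m m'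
    using is_field_0[OF is_field_component[OF c]] by (simp add: local_order_def identity_field_def fun_eq_iff)
  then show ?thesis unfolding mutually_local_iff by blast
qed

lemma sum_homogeneous_part: "N > 0 \<Longrightarrow> (\<Sum>j<N. homogeneous_part N j a) = a"
  by (simp add: fun_eq_iff sum_fun_apply homogeneous_part_def if_distribR sum_residue cong: if_cong)

lemma subspace_series_iff:
  "module.subspace (series_scale scale) U \<longleftrightarrow>
    0 \<in> U \<and> (\<forall>a\<in>U. \<forall>b\<in>U. a + b \<in> U) \<and> (\<forall>c. \<forall>a\<in>U. series_scale scale c a \<in> U)"
proof -
  interpret S: complex_vector_space "series_scale scale" by (rule series_vector_space)
  show ?thesis by (rule S.subspace_def)
qed

lemma homogeneous_part_in_grade:
  "a \<in> fields scale \<Longrightarrow> homogeneous_part N j a \<in> fields_grade scale N j"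
  unfolding fields_grade_def by (auto simp: fields_homogeneous_part) (simp add: homogeneous_part_def)

lemma homogeneous_part_of_grade:
  assumes "N > 0" "g \<in> fields_grade scale N i" "i < N" "j < N"
  shows "homogeneous_part N j g = (if i = j then g else 0)"
proof (intro ext)
  fix n m w
  have g: "int N dvd n + int i \<or> g n m w = 0"
    using assms(2) by (auto simp: fields_grade_def)
  have "i = j" if "int N dvd n + int i" "int N dvd n + int j"
    using residue_unique[OF assms(1), of n] assms(3,4) that by blast
  then show "homogeneous_part N j g n m w = (if i = j then g else 0) n m w"
    using g by (auto simp: homogeneous_part_def)
qed

text \<open>Projecting a homogeneous decomposition to degree j forces its j-th entry to be
  \<open>homogeneous_part N j a\<close>. Uniqueness is thus automatic, and existence means stability
  under the projections.\<close>

lemma graded_subspace_iff: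
  assumes N: "N > 0"
  shows "graded_subspace scale N U \<longleftrightarrow> U \<subseteq> fields scale \<and> module.subspace (series_scale scale) U \<and>
    (\<forall>a\<in>U. \<forall>j<N. homogeneous_part N j a \<in> U)"
proof -
  have "(\<exists>!f. f \<in> (\<Pi>\<^sub>E j\<in>{..<N}. U \<inter> fields_grade scale N j) \<and> a = (\<Sum>j<N. f j)) \<longleftrightarrow>
      (\<forall>j<N. homogeneous_part N j a \<in> U)" if U: "U \<subseteq> fields scale" and a: "a \<in> U" for a
  proof
    have parts: "f j = homogeneous_part N j a"
      if f: "f \<in> (\<Pi>\<^sub>E j\<in>{..<N}. U \<inter> fields_grade scale N j)" "a = (\<Sum>j<N. f j)" "j < N" for f j
    proof -
      have "homogeneous_part N j a = (\<Sum>i<N. homogeneous_part N j (f i))"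
        unfolding f(2) by (auto simp: homogeneous_part_def sum_fun_apply fun_eq_iff)
      also have "\<dots> = (\<Sum>i<N. if i = j then f i else 0)"
      proof (rule sum.cong)
        fix i assume "i \<in> {..<N}"
        then have "f i \<in> fields_grade scale N i" "i < N" using f(1) by (auto simp: PiE_iff)
        then show "homogeneous_part N j (f i) = (if i = j then f i else 0)"
          using homogeneous_part_of_grade[OF N _ _ f(3)] by blast
      qed simp
      finally show ?thesis using f(3) by simp
    qed
    show "\<forall>j<N. homogeneous_part N j a \<in> U"
      if "\<exists>!f. f \<in> (\<Pi>\<^sub>E j\<in>{..<N}. U \<inter> fields_grade scale N j) \<and> a = (\<Sum>j<N. f j)"
    proof (intro allI impI)
      fix j assume j: "j < N"
      obtain f where f: "f \<in> (\<Pi>\<^sub>E j\<in>{..<N}. U \<inter> fields_grade scale N j)" "a = (\<Sum>j<N. f j)"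
        using \<open>\<exists>!f. _ f\<close> by blast
      have "f j \<in> U" using f(1) j by (auto simp: PiE_iff)
      then show "homogeneous_part N j a \<in> U" by (simp add: parts[OF f j])
    qed
    assume h: "\<forall>j<N. homogeneous_part N j a \<in> U"
    have part: "homogeneous_part N j a \<in> U \<inter> fields_grade scale N j" if "j < N" for j
      using h that U a homogeneous_part_in_grade[of a N j] by blast
    show "\<exists>!f. f \<in> (\<Pi>\<^sub>E j\<in>{..<N}. U \<inter> fields_grade scale N j) \<and> a = (\<Sum>j<N. f j)"
    proof (rule ex1I)
      let ?f = "\<lambda>j\<in>{..<N}. homogeneous_part N j a"
      show "?f \<in> (\<Pi>\<^sub>E j\<in>{..<N}. U \<inter> fields_grade scale N j) \<and> a = (\<Sum>j<N. ?f j)"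
        using part sum_homogeneous_part[OF N, of a] by (auto simp: PiE_iff)
      fix f assume f: "f \<in> (\<Pi>\<^sub>E j\<in>{..<N}. U \<inter> fields_grade scale N j) \<and> a = (\<Sum>j<N. f j)"
      show "f = ?f"
      proof
        fix j
        show "f j = ?f j"
        proof (cases "j < N")
          case True
          then show ?thesis using parts[of f j] f by simp
        next
          case False
          then have "f j = undefined" using f by (auto intro: PiE_arb)
          with False show ?thesis by simp
        qed
      qed
    qed
  qed
  then show ?thesis
    unfolding graded_subspace_def by (intro conj_cong ball_cong refl)
qed

text \<open>Zorn's lemma is applied to bare local sets of fields, without linear or graded
  structure; maximality then provides linearity, grading, the identity and all products at
  once.\<close>

lemma closed_superset_exists:
  assumes N: "N > 0" and U: "graded_local_subspace scale N U"
  shows "\<exists>M. closed_graded_local_subspace scale N M \<and> U \<subseteq> M"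
proof -
  define \<A> where "\<A> = {M. M \<subseteq> fields scale \<and> U \<subseteq> M \<and> (\<forall>a\<in>M. \<forall>b\<in>M. mutually_local scale N a b)}"
  have "\<exists>M\<in>\<A>. \<forall>X\<in>\<A>. M \<subseteq> X \<longrightarrow> X = M"
  proof (rule subset_Zorn_nonempty)
    show "\<A> \<noteq> {}"
      using U unfolding \<A>_def graded_local_subspace_def graded_subspace_def by blast
    fix \<C> assume C: "\<C> \<noteq> {}" "subset.chain \<A> \<C>"
    then have sub: "\<C> \<subseteq> \<A>" and ch: "\<And>X Y. X \<in> \<C> \<Longrightarrow> Y \<in> \<C> \<Longrightarrow> X \<subseteq> Y \<or> Y \<subseteq> X"
      unfolding subset_chain_def by blast+
    have "mutually_local scale N a b" if "a \<in> \<Union>\<C>" "b \<in> \<Union>\<C>" for a b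
    proof -
      obtain X Y where XY: "X \<in> \<C>" "a \<in> X" "Y \<in> \<C>" "b \<in> Y" using \<open>a \<in> \<Union>\<C>\<close> \<open>b \<in> \<Union>\<C>\<close> by blast
      then obtain Z where "Z \<in> \<C>" "a \<in> Z" "b \<in> Z" using ch[of X Y] by blast
      then show ?thesis using sub unfolding \<A>_def by blast
    qed
    moreover have "\<Union>\<C> \<subseteq> fields scale"
      by (rule Union_least) (use sub in \<open>auto simp: \<A>_def\<close>)
    moreover have "U \<subseteq> \<Union>\<C>"
    proof -
      obtain X where "X \<in> \<C>" using C(1) by blast
      then have "U \<subseteq> X" using sub by (auto simp: \<A>_def)
      with \<open>X \<in> \<C>\<close> show ?thesis by blast
    qed
    ultimately show "\<Union>\<C> \<in> \<A>" unfolding \<A>_def by simp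
  qed
  then obtain M where M: "M \<in> \<A>" "\<And>X. X \<in> \<A> \<Longrightarrow> M \<subseteq> X \<Longrightarrow> X = M" by blast
  have MF: "M \<subseteq> fields scale" and UM: "U \<subseteq> M" and loc: "\<And>a b. a \<in> M \<Longrightarrow> b \<in> M \<Longrightarrow> mutually_local scale N a b"
    using M(1) unfolding \<A>_def by auto
  \<comment> \<open>The criterion for adjoining x: every field that is local to all of
    \<open>M\<close> must also be local to x.\<close>
  have maximal: "x \<in> M" if x: "x \<in> fields scale"
    and step: "\<And>c. c \<in> fields scale \<Longrightarrow> \<forall>a\<in>M. mutually_local scale N c a \<Longrightarrow> mutually_local scale N c x" for x
  proof -
    have 1: "mutually_local scale N c x" if "c \<in> M" for c
      by (rule step) (use that MF loc in auto)
    \<comment> \<open>Self-locality comes from a second use of the criterion, with c = x, after x is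
      known to be local to all of \<open>M\<close>.\<close>
    then have "mutually_local scale N x x"
      by (intro step x ballI mutually_local_sym[OF 1])
    with 1 have "insert x M \<in> \<A>"
      using MF UM loc x mutually_local_sym unfolding \<A>_def by blast
    from M(2)[OF this] show ?thesis by blast
  qed
  have "graded_subspace scale N M"
    unfolding graded_subspace_iff[OF N] subspace_series_iff
  proof (intro conjI ballI allI impI MF)
    show "0 \<in> M" by (rule maximal) (auto intro: fields_zero mutually_local_zero)
    show "a + b \<in> M" if "a \<in> M" "b \<in> M" for a b
      by (rule maximal) (use that MF in \<open>auto intro: fields_add mutually_local_add\<close>)
    show "series_scale scale c a \<in> M" if "a \<in> M" for a c
      by (rule maximal) (use that MF in \<open>auto intro: fields_scale mutually_local_scale\<close>)
    show "homogeneous_part N j a \<in> M" if "a \<in> M" for a j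
      by (rule maximal) (use that MF in \<open>auto intro: fields_homogeneous_part mutually_local_homogeneous_part\<close>)
  qed
  moreover have "identity_field \<in> M"
    by (rule maximal) (auto intro: fields_identity mutually_local_identity)
  moreover have "vertex_op scale N a c k b \<in> M" if "a \<in> M" "b \<in> M" for a b c k
    by (rule maximal) (use that MF loc in \<open>auto intro!: vertex_op_in_fields[OF N] mutually_local_vertex_op[OF N]\<close>)
  ultimately show ?thesis
    using UM loc unfolding closed_graded_local_subspace_def graded_local_subspace_def by blast
qed

lemma closed_graded_local_subspace_Inter:
  assumes N: "N > 0" and ne: "\<B> \<noteq> {}" and B: "\<And>B. B \<in> \<B> \<Longrightarrow> closed_graded_local_subspace scale N B"
  shows "closed_graded_local_subspace scale N (\<Inter>\<B>)"
proof -
  note defs = closed_graded_local_subspace_def graded_local_subspace_def graded_subspace_iff[OF N] subspace_series_iff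
  have fields: "B \<subseteq> fields scale" and zero: "0 \<in> B"
    and add: "\<And>a b. a \<in> B \<Longrightarrow> b \<in> B \<Longrightarrow> a + b \<in> B"
    and scale: "\<And>c a. a \<in> B \<Longrightarrow> series_scale scale c a \<in> B"
    and part: "\<And>j a. a \<in> B \<Longrightarrow> j < N \<Longrightarrow> homogeneous_part N j a \<in> B"
    and local: "\<And>a b. a \<in> B \<Longrightarrow> b \<in> B \<Longrightarrow> mutually_local scale N a b"
    and unit: "identity_field \<in> B"
    and closed: "\<And>a b m0 m. a \<in> B \<Longrightarrow> b \<in> B \<Longrightarrow> vertex_op scale N a (- m0 - 1) (- m) b \<in> B"
    if "B \<in> \<B>" for B
    using B[OF that] unfolding defs by simp_all
  obtain B0 where B0: "B0 \<in> \<B>" using ne by blast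
  then have "\<Inter>\<B> \<subseteq> fields scale" using fields by blast
  moreover have "mutually_local scale N a b" if "a \<in> \<Inter>\<B>" "b \<in> \<Inter>\<B>" for a b
    using local[OF B0] B0 that by simp
  ultimately show ?thesis
    unfolding defs by (simp add: zero add scale part unit closed)
qed

section \<open>The grading automorphism\<close>

text \<open>In degree j the exponents n/N satisfy n = - j modulo N, so the scalar omega^j is
  omega^(-n): sigma replaces x0^(1/N) by omega^(-1) x0^(1/N).\<close>

lemma sigma_eq:
  assumes N: "N > 0"
  shows "sigma scale N a = (\<lambda>n m w. scale (omega N powi (- n)) (a n m w))"
proof (intro ext)
  fix n m w
  have "omega N ^ j = omega N powi (- n)" if "int N dvd n + int j" for j
  proof -
    have "omega N powi (n + int j) = 1" using that by (simp add: omega_power_int_eq_1_iff[OF N])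
    then have "omega N powi (- n) * omega N powi (n + int j) = omega N powi (- n)" by simp
    then show ?thesis by (simp flip: omega_power_int_add)
  qed
  then have "scale (omega N ^ j) (homogeneous_part N j a n m w) =
      (if int N dvd n + int j then scale (omega N powi (- n)) (a n m w) else 0)" for j
    by (simp add: homogeneous_part_def)
  then show "sigma scale N a n m w = scale (omega N powi (- n)) (a n m w)"
    by (simp add: sigma_def sum_fun_apply series_scale_def sum_residue[OF N])
qed

lemma sigma_funpow:
  assumes N: "N > 0"
  shows "(sigma scale N ^^ j) a = (\<lambda>n m w. scale (omega N powi (- (int j * n))) (a n m w))"
proof (induction j)
  case (Suc j)
  have "- (int (Suc j) * n) = - n + - (int j * n)" for n by (simp add: algebra_simps)
  then show ?case
    unfolding funpow.simps o_apply Suc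
    by (simp only: sigma_eq[OF N] omega_power_int_add scale_scale)
qed simp

text \<open>On the product, sigma multiplies the coefficient at x^(p/N) y^(q/N) by omega^(-(p + q)),
  which has period N in the total exponent; \<open>specialize_twist\<close> carries it through the
  substitution.\<close>

lemma sigma_vertex_op:
  assumes N: "N > 0" and a: "a \<in> fields scale" and b: "b \<in> fields scale" and loc: "mutually_local scale N a b"
    and a': "sigma scale N a \<in> fields scale" and b': "sigma scale N b \<in> fields scale"
    and loc': "mutually_local scale N (sigma scale N a) (sigma scale N b)"
  shows "sigma scale N (vertex_op scale N a c k b) = vertex_op scale N (sigma scale N a) c k (sigma scale N b)"
proof (intro ext)
  fix q l w
  obtain K where K: "\<And>m m'. local_order N K (\<lambda>p. a p m) (\<lambda>q. b q m')"
    using loc unfolding mutually_local_iff by blast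
  have reg: "regular N (\<lambda>p q. a p k (b q (l - k) w))"
    by (rule product_regular[OF is_field_component[OF a] is_field_component[OF b] K])
  have per: "omega N powi (- (n - int N)) = omega N powi (- n)" for n
  proof -
    have "omega N powi (int N) = 1" using omega_power_int_eq_1_iff[OF N, of "int N"] by simp
    then show ?thesis using omega_power_int_add[of N "- n" "int N"] by simp
  qed
  have "(\<lambda>p q. sigma scale N a p k (sigma scale N b q (l - k) w)) =
      (\<lambda>p q. scale (omega N powi (- (p + q))) (a p k (b q (l - k) w)))"
    using is_field_scale[OF is_field_component[OF a]] omega_power_int_add[of N "- _" "- _"]
    by (simp add: sigma_eq[OF N])
  then have "vertex_op scale N (sigma scale N a) c k (sigma scale N b) q l w =
      scale (omega N powi (- q)) (specialize N (\<lambda>p q. a p k (b q (l - k) w)) c q)"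
    using specialize_twist[OF N reg, of "\<lambda>n. omega N powi (- n)", OF per]
    by (simp add: vertex_op_eq[OF N a' b' loc'] nth_product_def)
  then show "sigma scale N (vertex_op scale N a c k b) q l w = vertex_op scale N (sigma scale N a) c k (sigma scale N b) q l w"
    by (simp add: sigma_eq[OF N] vertex_op_eq[OF N a b loc] nth_product_def)
qed

end

lemma Sum_any_series_apply:
  fixes f :: "'i \<Rightarrow> ('r::finite, 'w::ab_group_add) field_series"
  assumes "finite {i. f i \<noteq> 0}"
  shows "Sum_any f q l w = Sum_any (\<lambda>i. f i q l w)"
proof -
  have "finite {i. f i q \<noteq> 0}" "finite {i. f i q l \<noteq> 0}"
    by (rule finite_subset[OF _ assms], auto)+
  then show ?thesis by (simp add: Sum_any_fun_apply assms)
qed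

context complex_vector_space
begin

section \<open>The vertex algebra structure\<close>

text \<open>Transfers the iterate formula from single coefficients to series-valued products: one
  power K clears all coefficients together, and the common finite support permits evaluation inside
  \<open>Sum_any\<close>.\<close>

lemma specialize_series_apply:
  fixes F :: "int \<Rightarrow> int \<Rightarrow> ('r::finite, 'w) field_series"
  assumes "truncated ((diffmul 1 ^^ K) F)"
  shows "complex_vector_space.specialize (series_scale scale) 1 F c d q l w = specialize 1 (\<lambda>c d. F c d q l w) c d"
proof -
  interpret series: complex_vector_space "series_scale scale :: complex \<Rightarrow> ('r, 'w) field_series \<Rightarrow> ('r, 'w) field_series"
    by (rule series_vector_space)
  have e: "(diffmul 1 ^^ K) (\<lambda>c d. F c d q l w) = (\<lambda>c d. (diffmul 1 ^^ K) F c d q l w)"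
    by (rule diffmul_funpow_additive[where h = "\<lambda>X. X q l w"]) simp
  have t: "truncated ((diffmul 1 ^^ K) (\<lambda>c d. F c d q l w))"
    unfolding e by (rule truncated_compose[OF assms]) simp
  have "series.specialize 1 F c d q l w = series.substitute 1 ((diffmul 1 ^^ K) F) (c + int K) d q l w"
    by (simp only: series.specialize_eq[OF zero_less_one assms])
  also have "\<dots> = substitute 1 ((diffmul 1 ^^ K) (\<lambda>c d. F c d q l w)) (c + int K) d"
    unfolding series.substitute_def substitute_def e
    by (subst Sum_any_series_apply[OF series.substitute_finite[OF assms]]) (simp add: series_scale_def)
  also have "\<dots> = specialize 1 (\<lambda>c d. F c d q l w) c d"
    by (simp only: specialize_eq[OF zero_less_one t])
  finally show ?thesis .
qed

lemma nth_product_zero_right: "N > 0 \<Longrightarrow> is_field a \<Longrightarrow> nth_product N a c (\<lambda>q w. 0) q w = 0"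
  by (simp add: nth_product_def specialize_truncated truncated_def substitute_def)

context
  fixes N :: nat and A :: "('r::finite, 'w) field_series set"
  assumes N: "N > 0" and A: "closed_graded_local_subspace scale N A"
begin

lemma closed_fields: "a \<in> A \<Longrightarrow> a \<in> fields scale"
  and closed_zero: "0 \<in> A"
  and closed_add: "a \<in> A \<Longrightarrow> b \<in> A \<Longrightarrow> a + b \<in> A"
  and closed_scale: "a \<in> A \<Longrightarrow> series_scale scale x a \<in> A"
  and closed_part: "a \<in> A \<Longrightarrow> j < N \<Longrightarrow> homogeneous_part N j a \<in> A"
  and closed_local: "a \<in> A \<Longrightarrow> b \<in> A \<Longrightarrow> mutually_local scale N a b"
  and closed_identity: "identity_field \<in> A"
  using A unfolding closed_graded_local_subspace_def graded_local_subspace_def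
    graded_subspace_iff[OF N] subspace_series_iff by auto

lemma closed_vertex_op:
  assumes "a \<in> A" "b \<in> A"
  shows "vertex_op scale N a c k b \<in> A"
proof -
  have "vertex_op scale N a (- (- c - 1) - 1) (- (- k)) b \<in> A"
    using A assms unfolding closed_graded_local_subspace_def by blast
  then show ?thesis by simp
qed

lemma closed_vertex_op_eq:
  "a \<in> A \<Longrightarrow> b \<in> A \<Longrightarrow>
    vertex_op scale N a c k b = (\<lambda>q l w. nth_product N (\<lambda>p. a p k) c (\<lambda>q. b q (l - k)) q w)"
  by (rule vertex_op_eq[OF N]) (simp_all add: closed_fields closed_local)

lemma closed_component: "a \<in> A \<Longrightarrow> is_field (\<lambda>n. a n m)"
  by (rule is_field_component) (rule closed_fields)

lemma closed_regular:
  assumes "a \<in> A" "b \<in> A"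
  shows "regular N (\<lambda>p q. a p m (b q m' w))"
proof -
  obtain K where "local_order N K (\<lambda>p. a p m) (\<lambda>q. b q m')"
    using closed_local[OF assms] unfolding mutually_local_iff by blast
  then show ?thesis
    by (rule product_regular[OF closed_component[OF assms(1)] closed_component[OF assms(2)]])
qed

lemma closed_vertex_op_add_left:
  "a \<in> A \<Longrightarrow> a' \<in> A \<Longrightarrow> b \<in> A \<Longrightarrow>
    vertex_op scale N (a + a') c k b = vertex_op scale N a c k b + vertex_op scale N a' c k b"
  by (simp add: closed_vertex_op_eq closed_add nth_product_def specialize_add[OF N] closed_regular fun_eq_iff)

lemma closed_vertex_op_add_right:
  "a \<in> A \<Longrightarrow> b \<in> A \<Longrightarrow> b' \<in> A \<Longrightarrow>
    vertex_op scale N a c k (b + b') = vertex_op scale N a c k b + vertex_op scale N a c k b'"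
  by (simp add: closed_vertex_op_eq closed_add nth_product_def specialize_add[OF N] closed_regular fun_eq_iff
      is_field_add[OF closed_component])

lemma closed_vertex_op_scale_left:
  "a \<in> A \<Longrightarrow> b \<in> A \<Longrightarrow>
    vertex_op scale N (series_scale scale x a) c k b = series_scale scale x (vertex_op scale N a c k b)"
  by (simp add: closed_vertex_op_eq closed_scale)
    (simp add: series_scale_def nth_product_def specialize_scale[OF N] closed_regular)

lemma closed_vertex_op_scale_right:
  "a \<in> A \<Longrightarrow> b \<in> A \<Longrightarrow>
    vertex_op scale N a c k (series_scale scale x b) = series_scale scale x (vertex_op scale N a c k b)"
  by (simp add: closed_vertex_op_eq closed_scale)
    (simp add: series_scale_def nth_product_def specialize_scale[OF N] closed_regular
      is_field_scale[OF closed_component])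

lemma closed_vertex_op_identity_left:
  assumes "b \<in> A"
  shows "vertex_op scale N identity_field c k b = identity_field c k b"
proof (intro ext)
  fix q l w
  let ?F = "\<lambda>p q. identity_field p k (b q (l - k) w)"
  obtain L where L: "\<forall>n<L. b n (l - k) w = 0" using is_field_bound[OF closed_component[OF assms]] by blast
  have "truncated ?F"
    by (rule truncatedI[of 0 _ L]) (use L in \<open>auto simp: identity_field_def\<close>)
  then have "vertex_op scale N identity_field c k b q l w = substitute N ?F c q"
    by (simp add: closed_vertex_op_eq closed_identity assms nth_product_def specialize_truncated[OF N])
  also have "\<dots> = scale (gbin 0 c) (?F 0 (q + int N * c))"
    unfolding substitute_def by (subst Sum_any_on[of "{0}"]) (auto simp: identity_field_def)
  also have "\<dots> = identity_field c k b q l w"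
  proof (cases "c = 0")
    case False
    then have "gbin 0 c = 0"
      by (cases "nat c") (auto simp: gbin_def)
    with False show ?thesis by (simp add: identity_field_def)
  qed (simp add: identity_field_def)
  finally show "vertex_op scale N identity_field c k b q l w = identity_field c k b q l w" .
qed

lemma closed_vertex_op_identity_right:
  assumes "a \<in> A" "c < 0"
  shows "vertex_op scale N a c k identity_field = 0"
proof (intro ext)
  fix q l w
  let ?F = "\<lambda>p q. a p k (identity_field q (l - k) w)"
  obtain L where L: "\<forall>n<L. a n k w = 0" using is_field_bound[OF closed_component[OF assms(1)]] by blast
  have "truncated ?F"
    by (rule truncatedI[of L _ 0])
      (use L is_field_0[OF closed_component[OF assms(1)]] in \<open>auto simp: identity_field_def\<close>)
  then show "vertex_op scale N a c k identity_field q l w = 0 q l w"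
    using assms(2)
    by (simp add: closed_vertex_op_eq closed_identity assms(1) nth_product_def specialize_truncated[OF N] substitute_neg)
qed

text \<open>This is \<open>expand_jacobi\<close> with step 1 over the vector space of series. Its
  locality hypothesis is \<open>nth_product_local\<close>, and the specialized product is identified
  with the iterate by \<open>nth_product_iterate\<close>.\<close>

lemma closed_jacobi:
  assumes u: "u \<in> A" and v: "v \<in> A" and w: "w \<in> A"
  shows "product_term (series_scale scale) 1 (vertex_op scale N u) (vertex_op scale N v) c p q k l w -
      opposite_term (series_scale scale) 1 (vertex_op scale N u) (vertex_op scale N v) c p q k l w =
    iterate_term (series_scale scale) 1 0 (vertex_op scale N) (\<lambda>e k. vertex_op scale N u e k v) c p q k l w"
proof -
  interpret series: complex_vector_space "series_scale scale :: complex \<Rightarrow> ('r, 'w) field_series \<Rightarrow> ('r, 'w) field_series"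
    by (rule series_vector_space)
  let ?Y = "vertex_op scale N"
  define P where "P = (\<lambda>c1 c2. ?Y u c1 k (?Y v c2 (l - k) w))"
  define Q where "Q = (\<lambda>c1 c2. ?Y v c2 (l - k) (?Y u c1 k w))"
  obtain K where K: "\<And>m m'. local_order N K (\<lambda>p. u p m) (\<lambda>q. v q m')"
    "\<And>m m'. local_order N K (\<lambda>p. u p m) (\<lambda>q. w q m')"
    "\<And>m m'. local_order N K (\<lambda>p. v p m) (\<lambda>q. w q m')"
    by (rule common_order[OF closed_local[OF u v] closed_local[OF u w] closed_local[OF v w]]) blast
  note f = closed_component[OF u] closed_component[OF v] closed_component[OF w]
  have P: "P c1 c2 q' l' \<omega> = nth_product N (\<lambda>p. u p k) c1 (nth_product N (\<lambda>p. v p (l - k)) c2 (\<lambda>q. w q (l' - l))) q' \<omega>"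
    for c1 c2 q' l' \<omega>
    unfolding P_def closed_vertex_op_eq[OF u closed_vertex_op[OF v w]]
    unfolding closed_vertex_op_eq[OF v w] by simp
  have Q: "Q c1 c2 q' l' \<omega> = nth_product N (\<lambda>p. v p (l - k)) c2 (nth_product N (\<lambda>p. u p k) c1 (\<lambda>q. w q (l' - l))) q' \<omega>"
    for c1 c2 q' l' \<omega>
    unfolding Q_def closed_vertex_op_eq[OF v closed_vertex_op[OF u w]]
    unfolding closed_vertex_op_eq[OF u w]
    by (simp add: algebra_simps)
  have loc: "(diffmul 1 ^^ K) P = (diffmul 1 ^^ K) Q"
  proof (intro ext)
    fix c1 c2 q' l' \<omega>
    have e: "(diffmul 1 ^^ K) F c1 c2 q' l' \<omega> = (diffmul 1 ^^ K) (\<lambda>c1 c2. F c1 c2 q' l' \<omega>) c1 c2" for F :: "int \<Rightarrow> int \<Rightarrow> ('r, 'w) field_series"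
      by (subst diffmul_funpow_additive[where h = "\<lambda>X. X q' l' \<omega>"]) simp_all
    show "(diffmul 1 ^^ K) P c1 c2 q' l' \<omega> = (diffmul 1 ^^ K) Q c1 c2 q' l' \<omega>"
      unfolding e P Q nth_product_local[OF N f K] ..
  qed
  have P0: "P c1 c2 = 0" if "c2 < - int K" for c1 c2
  proof (intro ext)
    fix q' l' \<omega>
    have "nth_product N (\<lambda>p. v p (l - k)) c2 (\<lambda>q. w q (l' - l)) = (\<lambda>q w. 0)"
      using nth_product_below[OF N f(2,3) K(3) that] by (simp add: fun_eq_iff)
    then show "P c1 c2 q' l' \<omega> = 0 q' l' \<omega>"
      by (simp add: P nth_product_zero_right[OF N f(1)])
  qed
  have Q0: "Q c1 c2 = 0" if "c1 < - int K" for c1 c2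
  proof (intro ext)
    fix q' l' \<omega>
    have "nth_product N (\<lambda>p. u p k) c1 (\<lambda>q. w q (l' - l)) = (\<lambda>q w. 0)"
      using nth_product_below[OF N f(1,3) K(2) that] by (simp add: fun_eq_iff)
    then show "Q c1 c2 q' l' \<omega> = 0 q' l' \<omega>"
      by (simp add: Q nth_product_zero_right[OF N f(2)])
  qed
  have tr: "truncated ((diffmul 1 ^^ K) P)"
    by (rule local_truncated[OF P0 Q0 loc])
  have S: "series.specialize 1 P e d = ?Y (?Y u e k v) d l w" for e d
  proof (intro ext)
    fix q' l' \<omega>
    have "series.specialize 1 P e d q' l' \<omega> = specialize 1 (\<lambda>c1 c2. P c1 c2 q' l' \<omega>) e d"
      by (rule specialize_series_apply[OF tr])
    also have "\<dots> = nth_product N (nth_product N (\<lambda>p. u p k) e (\<lambda>q. v q (l - k))) d (\<lambda>q. w q (l' - l)) q' \<omega>"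
      unfolding P by (rule nth_product_iterate[OF N f K, symmetric])
    also have "\<dots> = ?Y (?Y u e k v) d l w q' l' \<omega>"
      unfolding closed_vertex_op_eq[OF closed_vertex_op[OF u v] w]
      unfolding closed_vertex_op_eq[OF u v] ..
    finally show "series.specialize 1 P e d q' l' \<omega> = ?Y (?Y u e k v) d l w q' l' \<omega>" .
  qed
  have r: "restrict_residue 1 p P = P"
    by (simp add: restrict_residue_def)
  have "product_term (series_scale scale) 1 (?Y u) (?Y v) c p q k l w -
      opposite_term (series_scale scale) 1 (?Y u) (?Y v) c p q k l w =
      series.expand 1 (- c - 1) P p q - series.expand_op 1 (- c - 1) Q p q"
    by (simp only: series.product_term_eq series.opposite_term_eq P_def Q_def)
  also have "\<dots> = Sum_any (\<lambda>i::nat. series_scale scale (binomial_coeff (of_int (p + int 1 * int i) / of_nat 1) i)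
      (series.specialize 1 (restrict_residue 1 p P) (- (- c - 1) - 1 - int i) (q + int 1 + p + int 1 * int i)))"
    by (rule series.expand_jacobi[OF zero_less_one P0 Q0 loc])
  also have "\<dots> = iterate_term (series_scale scale) 1 0 ?Y (\<lambda>e k. ?Y u e k v) c p q k l w"
    unfolding iterate_term_def r S Let_def by (simp add: algebra_simps)
  finally show ?thesis .
qed

lemma closed_toroidal_vertex_algebra:
  "toroidal_vertex_algebra (series_scale scale) A (vertex_op scale N) identity_field"
proof -
  interpret series: complex_vector_space "series_scale scale :: complex \<Rightarrow> ('r, 'w) field_series \<Rightarrow> ('r, 'w) field_series"
    by (rule series_vector_space)
  show ?thesis
  proof unfold_locales
    show "module.subspace (series_scale scale) A"
      unfolding subspace_series_iff by (simp add: closed_zero closed_add closed_scale)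
    show "identity_field \<in> A" by (rule closed_identity)
    show "vertex_op scale N v \<in> fields_on (series_scale scale) A" if v: "v \<in> A" for v
    proof -
      have "\<exists>L. \<forall>n<L. \<forall>m. vertex_op scale N v n m w = 0" if "w \<in> A" for w
        by (rule vertex_op_below[OF N closed_fields[OF v] closed_fields[OF that] closed_local[OF v that]])
      then show ?thesis
        unfolding fields_on_def linear_on_def
        by (simp add: image_subset_iff v closed_vertex_op closed_vertex_op_add_right closed_vertex_op_scale_right)
    qed
    show "linear_on (series_scale scale) A (series_scale scale) (\<lambda>v. vertex_op scale N v n m u)" if "u \<in> A" for u n m
      using that unfolding linear_on_def
      by (simp add: closed_vertex_op_add_left closed_vertex_op_scale_left)
    show "vertex_op scale N identity_field n m v = identity_field n m v" if "v \<in> A" for v n m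
      by (rule closed_vertex_op_identity_left[OF that])
    show "vertex_op scale N v n m identity_field = 0" if "v \<in> A" "n < 0" for v n m
      by (rule closed_vertex_op_identity_right[OF that])
    show "product_term (series_scale scale) 1 (vertex_op scale N u) (vertex_op scale N v) c p q k l w -
        opposite_term (series_scale scale) 1 (vertex_op scale N u) (vertex_op scale N v) c p q k l w =
      iterate_term (series_scale scale) 1 0 (vertex_op scale N) (\<lambda>e k. vertex_op scale N u e k v) c p q k l w"
      if "u \<in> A" "v \<in> A" "w \<in> A" for u v w c p q k l
      by (rule closed_jacobi[OF that])
  qed
qed

section \<open>The automorphism sigma and the twisted module\<close>

lemma closed_sigma:
  assumes "a \<in> A"
  shows "sigma scale N a \<in> A"
proof -
  have sum: "sum f I \<in> A" if "\<And>i. i \<in> I \<Longrightarrow> f i \<in> A" for f and I :: "nat set"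
    using that by (induction I rule: infinite_finite_induct) (auto intro: closed_zero closed_add)
  show ?thesis
    unfolding sigma_def by (rule sum) (simp add: closed_scale closed_part assms)
qed

lemma closed_periodic_automorphism:
  "periodic_automorphism (series_scale scale) A (vertex_op scale N) identity_field (sigma scale N) N"
proof -
  interpret V: toroidal_vertex_algebra "series_scale scale" A "vertex_op scale N" identity_field
    by (rule closed_toroidal_vertex_algebra)
  have period: "(sigma scale N ^^ N) a = a" for a :: "('r, 'w) field_series"
  proof -
    have "omega N powi (- (int N * n)) = 1" for n
      by (simp add: omega_power_int_eq_1_iff[OF N])
    then show ?thesis by (simp add: sigma_funpow[OF N])
  qed
  have closed_funpow: "(sigma scale N ^^ j) a \<in> A" if "a \<in> A" for a j
    using that by (induction j) (simp_all add: closed_sigma)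
  show ?thesis
  proof unfold_locales
    show "N > 0" by (rule N)
    show "linear_on (series_scale scale) A (series_scale scale) (sigma scale N)"
      unfolding linear_on_def sigma_eq[OF N] series_scale_def
      by (simp add: fun_eq_iff scale_right_distrib mult.commute)
    \<comment> \<open>The inverse of sigma is its (N - 1)-st power.\<close>
    have eq: "(sigma scale N ^^ (N - 1)) (sigma scale N a) = a" "sigma scale N ((sigma scale N ^^ (N - 1)) a) = a" for a :: "('r, 'w) field_series"
      using period[of a] N by (cases N; simp add: funpow_swap1)+
    show "bij_betw (sigma scale N) A A"
      by (rule bij_betw_byWitness[where f' = "sigma scale N ^^ (N - 1)"])
        (auto simp: eq[unfolded One_nat_def] closed_sigma closed_funpow)
    show "sigma scale N identity_field = (identity_field :: ('r, 'w) field_series)"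
      by (simp add: sigma_eq[OF N] identity_field_def fun_eq_iff)
    show "sigma scale N (vertex_op scale N u n m v) = vertex_op scale N (sigma scale N u) n m (sigma scale N v)"
      if "u \<in> A" "v \<in> A" for u v n m
      by (rule sigma_vertex_op[OF N]) (use that in \<open>simp_all add: closed_fields closed_local closed_sigma\<close>)
    show "(sigma scale N ^^ N) v = v" for v :: "('r, 'w) field_series"
      by (rule period)
  qed
qed

text \<open>The power sigma^j twists the coefficient at x^(p'/N) by omega^(-j p'). Averaged against
  the factor omega^(j n) of the kernel, this restricts p' to one residue class, and
  \<open>expand_jacobi\<close> finishes.\<close>

lemma closed_twisted_jacobi:
  assumes u: "u \<in> A" and v: "v \<in> A"
  shows "product_term scale N u v c p q k l w - opposite_term scale N u v c p q k l w =
    scale (1 / of_nat N)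
      (\<Sum>j<N. iterate_term scale N j (\<lambda>a. a) (\<lambda>e k. vertex_op scale N ((sigma scale N ^^ j) u) e k v) c p q k l w)"
proof -
  define F where "F = (\<lambda>p q. u p k (v q (l - k) w))"
  obtain K where K: "\<And>m m'. local_order N K (\<lambda>p. u p m) (\<lambda>q. v q m')"
    using closed_local[OF u v] unfolding mutually_local_iff by blast
  note fu = closed_component[OF u] and fv = closed_component[OF v]
  obtain L where L: "\<forall>n<L. u n k w = 0" using is_field_bound[OF fu] by blast
  obtain L' where L': "\<forall>n<L'. v n (l - k) w = 0" using is_field_bound[OF fv] by blast
  have reg: "regular N F" unfolding F_def by (rule closed_regular[OF u v])
  have tr: "truncated ((diffmul N ^^ K) F)"
    unfolding F_def by (rule product_truncated[OF fu fv K])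
  define n where "n i = p + int N * int i" for i :: nat
  define F' where "F' j = (\<lambda>p q. scale (omega N powi (- (int j * p))) (F p q))" for j
  have sA: "(sigma scale N ^^ j) u \<in> A" for j
    using u by (induction j) (simp_all add: closed_sigma)
  have F': "F' j = (\<lambda>p q. (sigma scale N ^^ j) u p k (v q (l - k) w))" for j
    by (simp add: F'_def F_def sigma_funpow[OF N])
  have reg': "regular N (F' j)" for j
    unfolding F' by (rule closed_regular[OF sA v])
  have Y: "vertex_op scale N ((sigma scale N ^^ j) u) e k v d l w = specialize N (F' j) e d" for j e d
    by (simp add: closed_vertex_op_eq sA v nth_product_def F')
  define T where "T j i = scale (omega N powi (int j * n i) * binomial_coeff (of_int (n i) / of_nat N) i)
    (specialize N (F' j) (c - int i) (q + int N + n i))" for j i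
  \<comment> \<open>The twist has period N in the exponent and commutes with
    \<open>diffmul N\<close>, so every sigma^j u has the same order K relative to v. One bound i <=
    c + K therefore serves all j, and the sums can be interchanged.\<close>
  have low: "specialize N (F' j) e d = 0" if "e < - int K" for j e d
  proof -
    have "truncated ((diffmul N ^^ K) (F' j))"
    proof -
      have "local_order N K (\<lambda>p. (sigma scale N ^^ j) u p k) (\<lambda>q. v q (l - k))"
        unfolding local_order_def
      proof
        fix w
        define \<psi> where "\<psi> p = omega N powi (- (int j * p))" for p
        have "omega N powi (- (int j * (p - int N))) = omega N powi (- (int j * p))" for p
        proof -
          have "omega N powi (int j * int N) = 1" by (simp add: omega_power_int_eq_1_iff[OF N])
          then show ?thesis
            using omega_power_int_add[of N "- (int j * p)" "int j * int N"] by (simp add: algebra_simps)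
        qed
        then have per: "\<psi> (p - int N) = \<psi> p" for p by (simp add: \<psi>_def)
        have tw: "(diffmul N ^^ m) (\<lambda>p q. scale (\<psi> p) (G p q)) = (\<lambda>p q. scale (\<psi> p) ((diffmul N ^^ m) G p q))" for m G
          by (induction m) (simp_all add: diffmul_def per scale_right_diff_distrib)
        show "(diffmul N ^^ K) (\<lambda>p q. (sigma scale N ^^ j) u p k (v q (l - k) w)) =
            (diffmul N ^^ K) (\<lambda>p q. v q (l - k) ((sigma scale N ^^ j) u p k w))"
          using K[of k "l - k"] tw
          by (simp add: sigma_funpow[OF N] is_field_scale[OF fv] local_order_def flip: \<psi>_def)
      qed
      then show ?thesis
        unfolding F' by (rule product_truncated[OF closed_component[OF sA] fv])
    qed
    with that show ?thesis by (intro specialize_below[OF N])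
  qed
  have T0: "T j i = 0" if "int i > c + int K" for j i
    using that by (simp add: T_def low)
  have iter: "iterate_term scale N j (\<lambda>a. a) (\<lambda>e k. vertex_op scale N ((sigma scale N ^^ j) u) e k v) c p q k l w = Sum_any (T j)" for j
    unfolding iterate_term_def T_def Y Let_def n_def by simp
  define I where "I = {..nat (c + int K)}"
  have I: "T j i = 0" if "i \<notin> I" for j i
    by (rule T0) (use that in \<open>auto simp: I_def\<close>)
  \<comment> \<open>The sum over j of omega^(j (n i - p')) is a character sum; since n i = p + N i,
    it keeps exactly the exponents p' congruent to p modulo N, with a factor N that cancels
    1/N.\<close>
  have avg: "scale (1 / of_nat N) (\<Sum>j<N. T j i) =
      scale (binomial_coeff (of_int (n i) / of_nat N) i) (specialize N (restrict_residue N p F) (c - int i) (q + int N + n i))" for i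
  proof -
    have "(\<lambda>p' q'. \<Sum>j<N. scale (omega N powi (int j * n i)) (F' j p' q')) = (\<lambda>p' q'. scale (of_nat N) (restrict_residue N p F p' q'))"
    proof (intro ext)
      fix p' q'
      have "int N dvd n i - p' \<longleftrightarrow> int N dvd p' - p"
      proof -
        have "n i - p' = int N * int i - (p' - p)" by (simp add: n_def)
        then show ?thesis by (metis dvd_diff_right_iff dvd_triv_left)
      qed
      moreover have "omega N powi (int j * n i) * omega N powi (- (int j * p')) = omega N powi (int j * (n i - p'))" for j
        by (simp add: algebra_simps flip: omega_power_int_add)
      ultimately show "(\<Sum>j<N. scale (omega N powi (int j * n i)) (F' j p' q')) = scale (of_nat N) (restrict_residue N p F p' q')"
        by (simp add: F'_def sum_omega[OF N] restrict_residue_def flip: scale_sum_left)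
    qed
    moreover have "specialize N (\<lambda>p' q'. \<Sum>j<N. scale (omega N powi (int j * n i)) (F' j p' q')) (c - int i) (q + int N + n i) =
        (\<Sum>j<N. scale (omega N powi (int j * n i)) (specialize N (F' j) (c - int i) (q + int N + n i)))"
      using specialize_sum[OF N, of "{..<N}" "\<lambda>j p' q'. scale (omega N powi (int j * n i)) (F' j p' q')"]
      by (simp add: specialize_scale[OF N reg'])
    ultimately have "(\<Sum>j<N. scale (omega N powi (int j * n i)) (specialize N (F' j) (c - int i) (q + int N + n i))) =
        scale (of_nat N) (specialize N (restrict_residue N p F) (c - int i) (q + int N + n i))"
      by (simp add: specialize_scale[OF N regular_restrict_residue[OF reg]])
    moreover have "(\<Sum>j<N. T j i) = scale (binomial_coeff (of_int (n i) / of_nat N) i)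
        (\<Sum>j<N. scale (omega N powi (int j * n i)) (specialize N (F' j) (c - int i) (q + int N + n i)))"
      by (simp add: T_def scale_sum_right mult.commute)
    ultimately show ?thesis using N by simp
  qed
  have "scale (1 / of_nat N) (\<Sum>j<N. Sum_any (T j)) = scale (1 / of_nat N) (\<Sum>j<N. \<Sum>i\<in>I. T j i)"
    using Sum_any_on[of I, OF _ I] by (simp add: I_def)
  also have "\<dots> = (\<Sum>i\<in>I. scale (1 / of_nat N) (\<Sum>j<N. T j i))"
    by (subst sum.swap) (simp add: scale_sum_right)
  also have "\<dots> = Sum_any (\<lambda>i. scale (1 / of_nat N) (\<Sum>j<N. T j i))"
    by (rule Sum_any_on[symmetric]) (simp_all add: I_def[symmetric] I, simp add: I_def)
  also have "\<dots> = Sum_any (\<lambda>i::nat. scale (binomial_coeff (of_int (p + int N * int i) / of_nat N) i)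
      (specialize N (restrict_residue N p F) (- (- c - 1) - 1 - int i) (q + int N + p + int N * int i)))"
    unfolding avg n_def by (simp add: algebra_simps)
  also have "\<dots> = expand N (- c - 1) F p q - expand_op N (- c - 1) (\<lambda>p q. v q (l - k) (u p k w)) p q"
  proof (rule expand_jacobi[OF N, symmetric])
    show "F p q = 0" if "q < L'" for p q
      using that L' is_field_0[OF fu] by (simp add: F_def)
    show "v q (l - k) (u p k w) = 0" if "p < L" for p q
      using that L is_field_0[OF fv] by simp
    show "(diffmul N ^^ K) F = (diffmul N ^^ K) (\<lambda>p q. v q (l - k) (u p k w))"
      using K[of k "l - k"] by (simp add: F_def local_order_def)
  qed
  finally show ?thesis
    unfolding iter product_term_eq opposite_term_eq F_def by simp
qed

lemma closed_faithful_twisted_module: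
  "faithful_twisted_module (series_scale scale) A (vertex_op scale N) identity_field (sigma scale N) N scale (\<lambda>a. a)"
proof -
  interpret V: periodic_automorphism "series_scale scale" A "vertex_op scale N" identity_field "sigma scale N" N
    by (rule closed_periodic_automorphism)
  show ?thesis
    by unfold_locales (simp_all add: closed_fields linear_on_def closed_twisted_jacobi)
qed

end

end

theorem corollary3p6:
  fixes scale :: "complex \<Rightarrow> 'w::ab_group_add \<Rightarrow> 'w"
    and N :: nat
    and U :: "('r::finite, 'w) field_series set"
  assumes "vector_space scale"
    and "N > 0"
    and "graded_local_subspace scale N U"
  shows "\<exists>A. closed_graded_local_subspace scale N A \<and> U \<subseteq> A \<and>
      (\<forall>B. closed_graded_local_subspace scale N B \<and> U \<subseteq> B \<longrightarrow> A \<subseteq> B) \<and>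
      toroidal_vertex_algebra (series_scale scale) A (vertex_op scale N) identity_field \<and>
      faithful_twisted_module (series_scale scale) A (vertex_op scale N) identity_field
        (sigma scale N) N scale (\<lambda>a. a)"
proof -
  interpret vector_space scale by (rule assms(1))
  interpret complex_vector_space scale ..
  let ?\<B> = "{B. closed_graded_local_subspace scale N B \<and> U \<subseteq> B}"
  \<comment> \<open>The Zorn argument makes the family nonempty; an empty intersection would be the
    whole type, including series that are not fields.\<close>
  have closed: "closed_graded_local_subspace scale N (\<Inter>?\<B>)"
    by (rule closed_graded_local_subspace_Inter[OF assms(2)])
      (use closed_superset_exists[OF assms(2,3)] in auto)
  show ?thesis
  proof (intro exI[of _ "\<Inter>?\<B>"] conjI)
    show "toroidal_vertex_algebra (series_scale scale) (\<Inter>?\<B>) (vertex_op scale N) identity_field"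
      by (rule closed_toroidal_vertex_algebra[OF assms(2) closed])
    show "faithful_twisted_module (series_scale scale) (\<Inter>?\<B>) (vertex_op scale N) identity_field
        (sigma scale N) N scale (\<lambda>a. a)"
      by (rule closed_faithful_twisted_module[OF assms(2) closed])
  qed (use closed in auto)
qed

end
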